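(* Let $\ell\ge1$ and $\underline\lambda\in\mathbb R^{\ell+1}$, and let $\overline{\mathcal D}_{\ell+1}=\{x\in\mathbb R^{\ell+1}: x_1\ge x_2\ge\dots\ge x_{\ell+1}\}$. The elementary $\mathfrak{gl}_{\ell+1}$-Whittaker function $\Psi^{(0)}_{\underline\lambda}$ is a common eigenfunction of the elementary Toda chain (quantum billiard) Hamiltonians: for every symmetric polynomial $P\in\mathbb C[y_1,\dots,y_{\ell+1}]^{\mathfrak S_{\ell+1}}$, $$P(\partial_{x_1},\dots,\partial_{x_{\ell+1}})\,\Psi^{(0)}_{\underline\lambda}(x)=P(i\lambda_1,\dots,i\lambda_{\ell+1})\,\Psi^{(0)}_{\underline\lambda}(x),\qquad x\in\overline{\mathcal D}_{\ell+1},$$ with Dirichlet boundary conditions $$\Psi^{(0)}_{\underline\lambda}(x)\big|_{x_j=x_{j+1}}=0,\qquad j=1,\dots,\ell .$$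
   Context: $i=\sqrt{-1}$. Elementary $\mathfrak{gl}_{\ell+1}$-Whittaker function: for $\underline\lambda,\underline x\in\mathbb R^{\ell+1}$, $$\Psi^{(0)}_{\underline\lambda}(\underline x)= i^{-\ell(\ell+1)/2}\int_{\mathcal S}\prod_{n=1}^{\ell}\frac{\prod_{s\ne p}(\gamma_{n,s}-\gamma_{n,p})}{n!\prod_{k=1}^n\prod_{m=1}^{n+1}(\gamma_{n,k}-\gamma_{n+1,m})}\; e^{i\sum_{n=1}^{\ell+1}\sum_{j=1}^n(\gamma_{n,j}-\gamma_{n-1,j})x_n}\prod_{n=1}^\ell\prod_{j=1}^n\frac{d\gamma_{n,j}}{2\pi i},$$ where $(s,p)$ runs over ordered pairs of distinct indices in $\{1,\dots,n\}$, $\gamma_{\ell+1,j}:=\lambda_j$, $\gamma_{n,j}:=0$ for $j>n$, and $\mathcal S$ means that each $\gamma_{n,j}$ ($1\le j\le n\le\ell$) runs over a horizontal line $\mathbb R-i\varepsilon_{n,j}$ with fixed real $\varepsilon_{n,j}$ chosen so that $\max_j\mathrm{Im}\,\gamma_{k,j}<\min_m\mathrm{Im}\,\gamma_{k+1,m}$ for $k=1,\dots,\ell$. The symmetric group $\mathfrak S_{\ell+1}$ acts by permuting variables. At boundary points of $\overline{\mathcal D}_{\ell+1}$ the derivatives are understood as limits from the interior; the boundary condition refers to points of $\overline{\mathcal D}_{\ell+1}$ with $x_j=x_{j+1}$. *)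

theory Defs
  imports
    "HOL-Analysis.Analysis"
    "HOL-Library.Poly_Mapping"
    "HOL-Combinatorics.Permutations"
begin

text \<open>
  Points of \<open>\<real>\<^sup>N\<close> are functions in \<open>{1..N} \<rightarrow>\<^sub>E UNIV\<close>, with \<open>N = l + 1\<close>;
  the topology is the library's product topology on
  functions, which on this set is the Euclidean one.
\<close>

section \<open>The elementary Whittaker function\<close>

definition contour_im :: "nat \<Rightarrow> (nat \<Rightarrow> nat \<Rightarrow> real) \<Rightarrow> nat \<Rightarrow> nat \<Rightarrow> real" where
  "contour_im l eps n j = (if n = l + 1 then 0 else - eps n j)"

definition admissible_contour :: "nat \<Rightarrow> (nat \<Rightarrow> nat \<Rightarrow> real) \<Rightarrow> bool" where
  "admissible_contour l eps \<longleftrightarrow>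
     (\<forall>k\<in>{1..l}. Max (contour_im l eps k ` {1..k}) < Min (contour_im l eps (k + 1) ` {1..k + 1}))"

text \<open>
  The variable \<open>\<gamma>\<^sub>n\<^sub>,\<^sub>j\<close> as a function of the real parameters \<open>t (n, j)\<close> of the horizontal lines;
  the top row \<open>n = l + 1\<close> is \<open>\<lambda>\<close>, and \<open>\<gamma>\<^sub>n\<^sub>,\<^sub>j = 0\<close> for \<open>j > n\<close>.
\<close>
definition gamma_var ::
  "nat \<Rightarrow> (nat \<Rightarrow> nat \<Rightarrow> real) \<Rightarrow> (nat \<Rightarrow> real) \<Rightarrow> (nat \<times> nat \<Rightarrow> real) \<Rightarrow> nat \<Rightarrow> nat \<Rightarrow> complex"
where
  "gamma_var l eps lam t n j =
     (if 1 \<le> j \<and> j \<le> n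
      then Complex (if n = l + 1 then lam j else t (n, j)) (contour_im l eps n j)
      else 0)"

definition whittaker_integrand ::
  "nat \<Rightarrow> (nat \<Rightarrow> nat \<Rightarrow> complex) \<Rightarrow> (nat \<Rightarrow> real) \<Rightarrow> complex"
where
  "whittaker_integrand l \<gamma> x =
     (\<Prod>n=1..l.
        (\<Prod>(s, p)\<in>{(s, p). s \<in> {1..n} \<and> p \<in> {1..n} \<and> s \<noteq> p}. \<gamma> n s - \<gamma> n p)
        / (fact n * (\<Prod>k=1..n. \<Prod>m=1..n + 1. \<gamma> n k - \<gamma> (n + 1) m)))
     * exp (\<i> * (\<Sum>n=1..l + 1. \<Sum>j=1..n. (\<gamma> n j - \<gamma> (n - 1) j) * complex_of_real (x n)))"

text \<open>
  Along the line \<open>\<gamma> = t - \<i> \<epsilon>\<close> one has \<open>d\<gamma> = dt\<close>.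
\<close>
definition elementary_whittaker ::
  "nat \<Rightarrow> (nat \<Rightarrow> nat \<Rightarrow> real) \<Rightarrow> (nat \<Rightarrow> real) \<Rightarrow> (nat \<Rightarrow> real) \<Rightarrow> complex"
where
  "elementary_whittaker l eps lam x =
     \<i> powi (- int (l * (l + 1) div 2)) *
     (LINT t | Pi\<^sub>M {(n, j). 1 \<le> j \<and> j \<le> n \<and> n \<le> l} (\<lambda>_. lborel).
        whittaker_integrand l (gamma_var l eps lam t) x *
        (\<Prod>n=1..l. \<Prod>j=1..n. 1 / (2 * complex_of_real pi * \<i>)))"

section \<open>The chamber\<close>

definition closed_chamber :: "nat \<Rightarrow> (nat \<Rightarrow> real) set" where
  "closed_chamber l = {x \<in> {1..l + 1} \<rightarrow>\<^sub>E UNIV. \<forall>j\<in>{1..l}. x j \<ge> x (j + 1)}"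

definition open_chamber :: "nat \<Rightarrow> (nat \<Rightarrow> real) set" where
  "open_chamber l = {x \<in> {1..l + 1} \<rightarrow>\<^sub>E UNIV. \<forall>j\<in>{1..l}. x j > x (j + 1)}"

section \<open>Polynomials in \<open>N\<close> variables\<close>

type_synonym mpolynomial = "(nat \<Rightarrow>\<^sub>0 nat) \<Rightarrow>\<^sub>0 complex"

definition symmetric_polynomial :: "nat \<Rightarrow> mpolynomial \<Rightarrow> bool" where
  "symmetric_polynomial N P \<longleftrightarrow>
     (\<forall>m\<in>Poly_Mapping.keys P. Poly_Mapping.keys m \<subseteq> {1..N}) \<and>
     (\<forall>\<pi>. \<pi> permutes {1..N} \<longrightarrow>
        (\<forall>m. Poly_Mapping.lookup P (Poly_Mapping.map_key \<pi> m) = Poly_Mapping.lookup P m))"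

definition eval_polynomial :: "nat \<Rightarrow> mpolynomial \<Rightarrow> (nat \<Rightarrow> complex) \<Rightarrow> complex" where
  "eval_polynomial N P y =
     (\<Sum>m\<in>Poly_Mapping.keys P.
        Poly_Mapping.lookup P m * (\<Prod>j=1..N. y j ^ Poly_Mapping.lookup m j))"

section \<open>Differential operators on the closed chamber\<close>

definition partial_deriv ::
  "nat \<Rightarrow> ((nat \<Rightarrow> real) \<Rightarrow> complex) \<Rightarrow> (nat \<Rightarrow> real) \<Rightarrow> complex"
where
  "partial_deriv k f x = vector_derivative (\<lambda>t. f (x(k := t))) (at (x k))"

definition iter_deriv ::
  "nat list \<Rightarrow> ((nat \<Rightarrow> real) \<Rightarrow> complex) \<Rightarrow> (nat \<Rightarrow> real) \<Rightarrow> complex"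
where
  "iter_deriv ks f = foldr partial_deriv ks f"

text \<open>
  Iterated partial derivatives exist in the interior and have limits at all points of the closed
  chamber. At interior points the limit condition makes every iterated partial derivative
  continuous, so \<open>f\<close> is \<open>C\<^sup>\<infinity>\<close> there and the order of differentiation is immaterial.
\<close>
definition smooth_up_to_boundary :: "nat \<Rightarrow> ((nat \<Rightarrow> real) \<Rightarrow> complex) \<Rightarrow> bool" where
  "smooth_up_to_boundary l f \<longleftrightarrow>
     (\<forall>ks. set ks \<subseteq> {1..l + 1} \<longrightarrow>
        (\<forall>x\<in>open_chamber l. \<forall>k\<in>{1..l + 1}.
           (\<lambda>t. iter_deriv ks f (x(k := t))) differentiable (at (x k))) \<and>
        (\<forall>x\<in>closed_chamber l. \<exists>L. (iter_deriv ks f \<longlongrightarrow> L) (at x within open_chamber l)))"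

definition chamber_deriv ::
  "nat \<Rightarrow> nat list \<Rightarrow> ((nat \<Rightarrow> real) \<Rightarrow> complex) \<Rightarrow> (nat \<Rightarrow> real) \<Rightarrow> complex"
where
  "chamber_deriv l ks f x =
     (if x \<in> open_chamber l then iter_deriv ks f x
      else Lim (at x within open_chamber l) (iter_deriv ks f))"

text \<open>
  \<open>P(\<partial>\<^sub>1, \<dots>, \<partial>\<^sub>l\<^sub>+\<^sub>1)\<close>; the monomial with exponents \<open>m\<close> acts by the index list
  \<open>1, \<dots>, 1, 2, \<dots>, 2, \<dots>\<close> in which \<open>j\<close> occurs \<open>m j\<close> times.
\<close>
definition diff_operator ::
  "nat \<Rightarrow> mpolynomial \<Rightarrow> ((nat \<Rightarrow> real) \<Rightarrow> complex) \<Rightarrow> (nat \<Rightarrow> real) \<Rightarrow> complex"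
where
  "diff_operator l P f x =
     (\<Sum>m\<in>Poly_Mapping.keys P.
        Poly_Mapping.lookup P m *
        chamber_deriv l
          (concat (map (\<lambda>j. replicate (Poly_Mapping.lookup m j) j) [1..<l + 2])) f x)"

end

theory Submission
  imports Defs "HOL-Complex_Analysis.Complex_Analysis" "Jordan_Normal_Form.Determinant"
begin

text \<open>
  The integral is evaluated in closed form. For nodes \<open>\<nu>\<^sub>1, \<nu>\<^sub>2, \<dots>\<close> let \<open>D\<^sub>j f\<close> be the
  divided difference of an entire function \<open>f\<close> at \<open>\<nu>\<^sub>1, \<dots>, \<nu>\<^sub>j\<close>, written as the contour integral
  of \<open>f(z) / \<Prod>\<^bsub>r \<le> j\<^esub> (z - \<nu>\<^sub>r)\<close> over a circle around the nodes (divided by \<open>2 \<pi> \<i>\<close>), so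
  that coinciding nodes need no separate treatment. With the nodes \<open>\<lambda>\<close> and a constant \<open>K\<close>,
  the identity \<open>\<Psi>(x) = K det (D\<^sub>i (exp(\<i> z x\<^sub>k)))\<close>, where \<open>i\<close> and \<open>k\<close> run from \<open>1\<close> to \<open>l + 1\<close>,
  holds on the closed chamber (\<open>elementary_whittaker_eq_det\<close>); for distinct \<open>\<lambda>\<close> this is a
  multiple of \<open>det (exp(\<i> \<lambda>\<^sub>j x\<^sub>k))\<close> divided by the Vandermonde product of \<open>\<lambda>\<close>. The assertions can be
  read off the right-hand side. It is smooth in \<open>x\<close>, and two equal coordinates give two equal
  columns. Differentiation in \<open>x\<^sub>k\<close> multiplies the function in column \<open>k\<close> by \<open>\<i> z\<close>; for
  distinct nodes Newton interpolation turns the determinant of divided differences into one of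
  values at the nodes, where the symmetry of \<open>P\<close> pulls out the scalar \<open>P(\<i> \<lambda>)\<close>, and coinciding nodes
  follow by continuity (\<open>fdet_divdiff_symmetric\<close>).

  The closed form is proved by induction on the number of rows, for an arbitrary complex top row
  \<open>\<nu>\<close> above the contours (\<open>whittaker_integral_formula\<close>). By the induction hypothesis the
  integral over all rows below the row \<open>\<mu>\<close> under \<open>\<nu>\<close> is a determinant of divided differences at
  \<open>\<mu>\<close>. Of the squared Vandermonde product of \<open>\<mu>\<close> in the integrand, one factor turns it into
  \<open>det (exp(\<i> \<mu>\<^sub>j x\<^sub>k))\<close>, and the other is a determinant of monic polynomials in the \<open>\<mu>\<^sub>j\<close>, chosen
  so that after division by \<open>\<Prod> (\<mu>\<^sub>j - \<nu>\<^sub>r)\<close> only partial products of the denominators remain.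
  Andreief's identity reduces the integral over \<open>\<mu>\<close> to a determinant of integrals over one line.
  Those can be closed in the upper half-plane, because \<open>x\<^sub>k - x\<^bsub>l+1\<^esub> \<ge> 0\<close> in the chamber, and are divided
  differences at \<open>\<nu>\<close> (\<open>line_integral_divdiff\<close>).

  This uses Fubini's theorem, hence absolute convergence, which is delicate: bounding the
  interlacing kernels by products of \<open>1 / \<bar>\<mu>\<^sub>k - \<nu>\<^sub>q\<bar>\<close> over a matching just fails to be integrable.
  Using one entry of \<open>\<nu>\<close> as a pivot supplies the missing decay at the cost of factors that grow
  slower than every power of \<open>\<nu>\<close>. Therefore the absolute integral over the rows below \<open>\<nu>\<close>,
  multiplied by the Vandermonde product of \<open>\<nu>\<close>, is bounded by \<open>C \<Prod> (1 + \<bar>\<nu>\<^sub>j\<bar>)\<^sup>\<delta>\<close>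
  for every \<open>\<delta> > 0\<close>, a statement that reproduces itself from row to row (\<open>weights_bound\<close>).
\<close>

section \<open>Divided differences as contour integrals\<close>

text \<open>
  The divided difference of \<open>f\<close> at \<open>\<nu>\<^sub>1, \<dots>, \<nu>\<^sub>j\<close>, counted with multiplicity, provided
  that the circle of radius \<open>R\<close> encloses these nodes. The radius stays a parameter so that all orders
  \<open>j\<close> can be taken over one common circle.
\<close>
definition divdiff :: "real \<Rightarrow> (nat \<Rightarrow> complex) \<Rightarrow> nat \<Rightarrow> (complex \<Rightarrow> complex) \<Rightarrow> complex" where
  "divdiff R \<nu> j f =
     contour_integral (circlepath 0 R) (\<lambda>z. f z / (\<Prod>r=1..j. z - \<nu> r)) / (2 * of_real pi * \<i>)"

definition encloses :: "real \<Rightarrow> (nat \<Rightarrow> complex) \<Rightarrow> nat \<Rightarrow> bool" where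
  "encloses R \<nu> n \<longleftrightarrow> 0 < R \<and> (\<forall>r\<in>{1..n}. cmod (\<nu> r) < R)"

lemma encloses_mono: "encloses R \<nu> n \<Longrightarrow> m \<le> n \<Longrightarrow> encloses R \<nu> m"
  by (auto simp: encloses_def)

lemma encloses_exists: "\<exists>R. encloses R \<nu> n"
proof -
  have "cmod (\<nu> r) < 1 + (\<Sum>s=1..n. cmod (\<nu> s))" if "r \<in> {1..n}" for r
  proof -
    have "cmod (\<nu> r) \<le> (\<Sum>s=1..n. cmod (\<nu> s))"
      using that by (intro member_le_sum) auto
    then show ?thesis by simp
  qed
  moreover have "0 < 1 + (\<Sum>s=1..n. cmod (\<nu> s))"
    by (smt (verit) sum_nonneg norm_ge_zero)
  ultimately show ?thesis unfolding encloses_def by blast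
qed

lemma encloses_off_circle:
  assumes "encloses R \<nu> j" "z \<in> path_image (circlepath 0 R)"
  shows "(\<Prod>r=1..j. z - \<nu> r) \<noteq> 0"
  using assms by (force simp: encloses_def)

lemma divdiff_integrable:
  assumes "encloses R \<nu> j" "continuous_on UNIV f"
  shows "(\<lambda>z. f z / (\<Prod>r=1..j. z - \<nu> r)) contour_integrable_on circlepath 0 R"
proof (rule contour_integrable_continuous_circlepath)
  show "continuous_on (path_image (circlepath 0 R)) (\<lambda>z. f z / (\<Prod>r=1..j. z - \<nu> r))"
    using encloses_off_circle[OF assms(1)]
    by (intro continuous_intros continuous_on_subset[OF assms(2)]) auto
qed

text \<open>
  Without nodes there is no pole; this value starts the recursions in the order \<open>j\<close>.
\<close>
lemma divdiff_zero:
  assumes "f holomorphic_on UNIV"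
  shows "divdiff R \<nu> 0 f = 0"
proof -
  have "(f has_contour_integral 0) (circlepath 0 R)"
    by (rule Cauchy_theorem_convex_simple[where S = UNIV]) (use assms in auto)
  then show ?thesis unfolding divdiff_def
    by (simp add: contour_integral_unique)
qed

lemma divdiff_add:
  assumes "encloses R \<nu> j" "continuous_on UNIV f" "continuous_on UNIV g"
  shows "divdiff R \<nu> j (\<lambda>z. f z + g z) = divdiff R \<nu> j f + divdiff R \<nu> j g"
  unfolding divdiff_def
  using contour_integral_add[OF divdiff_integrable[OF assms(1,2)] divdiff_integrable[OF assms(1,3)]]
  by (simp add: add_divide_distrib)

lemma divdiff_cmult:
  assumes "encloses R \<nu> j" "continuous_on UNIV f"
  shows "divdiff R \<nu> j (\<lambda>z. c * f z) = c * divdiff R \<nu> j f"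
  unfolding divdiff_def
  using contour_integral_lmul[OF divdiff_integrable[OF assms], of c]
  by simp

lemma divdiff_factor:
  assumes "encloses R \<nu> j" "1 \<le> j"
  shows "divdiff R \<nu> j (\<lambda>z. (z - \<nu> j) * f z) = divdiff R \<nu> (j - 1) f"
proof -
  obtain i where j: "j = Suc i" using assms(2) by (cases j) auto
  have "(z - \<nu> j) * f z / (\<Prod>r=1..j. z - \<nu> r) = f z / (\<Prod>r=1..j - 1. z - \<nu> r)"
    if "z \<in> path_image (circlepath 0 R)" for z
  proof -
    have "z - \<nu> j \<noteq> 0"
      using encloses_off_circle[OF assms(1) that] assms(2) by (auto simp: prod_zero_iff)
    then show ?thesis by (simp add: j)
  qed
  then have "contour_integral (circlepath 0 R) (\<lambda>z. (z - \<nu> j) * f z / (\<Prod>r=1..j. z - \<nu> r))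
      = contour_integral (circlepath 0 R) (\<lambda>z. f z / (\<Prod>r=1..j - 1. z - \<nu> r))"
    by (rule contour_integral_eq)
  then show ?thesis by (simp add: divdiff_def)
qed

lemma divdiff_first:
  assumes "encloses R \<nu> 1" "f holomorphic_on UNIV"
  shows "divdiff R \<nu> 1 f = f (\<nu> 1)"
proof -
  have "((\<lambda>u. f u / (u - \<nu> 1)) has_contour_integral 2 * of_real pi * \<i> * f (\<nu> 1)) (circlepath 0 R)"
    by (rule Cauchy_integral_circlepath_simple)
       (use assms holomorphic_on_subset in \<open>auto simp: encloses_def\<close>)
  then show ?thesis unfolding divdiff_def
    by (simp add: contour_integral_unique)
qed

text \<open>
  In the basis of divided differences, multiplication by an entire function \<open>h\<close> is a lower
  triangular matrix with diagonal \<open>h(\<nu>\<^sub>j)\<close>: splitting \<open>h = h(\<nu>\<^sub>j) + (z - \<nu>\<^sub>j) q\<close>, the second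
  summand cancels the last denominator, and \<open>q\<close> is again entire. The coefficients \<open>H\<close> do not depend
  on \<open>f\<close>, which is why the quantifiers stand in this order.
\<close>
lemma divdiff_mult_triangular:
  assumes "h holomorphic_on UNIV"
  shows "\<exists>H. \<forall>f. f holomorphic_on UNIV \<longrightarrow> encloses R \<nu> j \<longrightarrow> 1 \<le> j \<longrightarrow>
     divdiff R \<nu> j (\<lambda>z. h z * f z) = h (\<nu> j) * divdiff R \<nu> j f + (\<Sum>i=1..<j. H i * divdiff R \<nu> i f)"
  using assms
proof (induction j arbitrary: h)
  case 0
  show ?case by simp
next
  case (Suc i)
  define q where "q = (\<lambda>z. if z = \<nu> (Suc i) then deriv h (\<nu> (Suc i)) else (h z - h (\<nu> (Suc i))) / (z - \<nu> (Suc i)))"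
  have qh: "q holomorphic_on UNIV"
    unfolding q_def by (rule pole_lemma) (use Suc.prems in auto)
  have hq: "h z = h (\<nu> (Suc i)) + (z - \<nu> (Suc i)) * q z" for z
    by (simp add: q_def)
  obtain H where H: "\<And>f. f holomorphic_on UNIV \<Longrightarrow> encloses R \<nu> i \<Longrightarrow> 1 \<le> i \<Longrightarrow>
     divdiff R \<nu> i (\<lambda>z. q z * f z) = q (\<nu> i) * divdiff R \<nu> i f + (\<Sum>k=1..<i. H k * divdiff R \<nu> k f)"
    using Suc.IH[OF qh] by blast
  define H' where "H' = H(i := q (\<nu> i))"
  show ?case
  proof (intro exI[of _ H'] allI impI)
    fix f assume f: "f holomorphic_on UNIV" and e: "encloses R \<nu> (Suc i)"
    have cont: "continuous_on UNIV f" "continuous_on UNIV q"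
      using f qh holomorphic_on_imp_continuous_on by blast+
    have "divdiff R \<nu> (Suc i) (\<lambda>z. h z * f z) =
        divdiff R \<nu> (Suc i) (\<lambda>z. h (\<nu> (Suc i)) * f z + (z - \<nu> (Suc i)) * (q z * f z))"
      by (subst hq) (simp add: algebra_simps)
    also have "\<dots> = h (\<nu> (Suc i)) * divdiff R \<nu> (Suc i) f
        + divdiff R \<nu> (Suc i) (\<lambda>z. (z - \<nu> (Suc i)) * (q z * f z))"
      by (subst divdiff_add[OF e])
         (auto intro!: continuous_intros cont simp: divdiff_cmult[OF e cont(1)])
    also have "divdiff R \<nu> (Suc i) (\<lambda>z. (z - \<nu> (Suc i)) * (q z * f z)) = divdiff R \<nu> i (\<lambda>z. q z * f z)"
      using divdiff_factor[OF e] by simp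
    also have "\<dots> = (\<Sum>k=1..<Suc i. H' k * divdiff R \<nu> k f)"
    proof (cases "i = 0")
      case True
      then show ?thesis using divdiff_zero[OF holomorphic_on_mult[OF qh f]] by simp
    next
      case False
      then have i: "1 \<le> i" by simp
      have "(\<Sum>k=1..<i. H k * divdiff R \<nu> k f) = (\<Sum>k=1..<i. H' k * divdiff R \<nu> k f)"
        by (intro sum.cong) (auto simp: H'_def)
      moreover have "(\<Sum>k=1..<Suc i. H' k * divdiff R \<nu> k f)
          = (\<Sum>k=1..<i. H' k * divdiff R \<nu> k f) + H' i * divdiff R \<nu> i f"
        using i by (simp add: sum.atLeastLessThan_Suc)
      ultimately show ?thesis
        using H[OF f encloses_mono[OF e] i] by (simp add: H'_def)
    qed
    finally show "divdiff R \<nu> (Suc i) (\<lambda>z. h z * f z) = h (\<nu> (Suc i)) * divdiff R \<nu> (Suc i) f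
        + (\<Sum>k=1..<Suc i. H' k * divdiff R \<nu> k f)" .
  qed
qed

text \<open>
  Newton's interpolation formula with remainder, where the remainder is the divided difference
  in which the evaluation point itself is the last node. The recursion in \<open>k\<close> is the identity
  \<open>1 / (z - a) - 1 / (z - b) = (a - b) / ((z - a) (z - b))\<close> under the integral.
\<close>
lemma divdiff_newton_step:
  assumes e: "encloses R \<nu> (Suc n)" and f: "f holomorphic_on UNIV" and k: "k \<le> n"
  shows "f (\<nu> (Suc n)) = (\<Sum>i=1..k. (\<Prod>m=1..<i. \<nu> (Suc n) - \<nu> m) * divdiff R \<nu> i f)
     + (\<Prod>m=1..k. \<nu> (Suc n) - \<nu> m) * divdiff R (\<lambda>r. if r = Suc k then \<nu> (Suc n) else \<nu> r) (Suc k) f"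
  using k
proof (induction k)
  case 0
  have "encloses R (\<lambda>r. if r = Suc 0 then \<nu> (Suc n) else \<nu> r) 1"
    using e by (auto simp: encloses_def)
  from divdiff_first[OF this f] show ?case by simp
next
  case (Suc k)
  define \<rho> where "\<rho> = (\<lambda>r. if r = Suc (Suc k) then \<nu> (Suc n) else \<nu> r)"
  define \<rho>' where "\<rho>' = (\<lambda>r. if r = Suc k then \<nu> (Suc n) else \<nu> r)"
  have e1: "encloses R \<rho> (Suc (Suc k))" using e Suc.prems by (auto simp: encloses_def \<rho>_def)
  have e2: "encloses R \<nu> (Suc k)" using e Suc.prems by (auto simp: encloses_def)
  have e3: "encloses R \<rho>' (Suc k)" using e Suc.prems by (auto simp: encloses_def \<rho>'_def)
  have cf: "continuous_on UNIV f" using f holomorphic_on_imp_continuous_on by blast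
  have P1: "(\<Prod>r=1..k. z - \<rho> r) = (\<Prod>r=1..k. z - \<nu> r)" 
    and P2: "(\<Prod>r=1..k. z - \<rho>' r) = (\<Prod>r=1..k. z - \<nu> r)" for z
    by (rule prod.cong; simp add: \<rho>_def \<rho>'_def)+
  have "f z / (\<Prod>r=1..Suc k. z - \<rho>' r) - f z / (\<Prod>r=1..Suc k. z - \<nu> r) 
     = (\<nu> (Suc n) - \<nu> (Suc k)) * (f z / (\<Prod>r=1..Suc (Suc k). z - \<rho> r))"
    if z: "z \<in> path_image (circlepath 0 R)" for z
  proof -
    have "(\<Prod>r=1..Suc (Suc k). z - \<rho> r) \<noteq> 0" using encloses_off_circle[OF e1 z] .
    then have *: "(\<Prod>r=1..k. z - \<nu> r) \<noteq> 0" "z - \<nu> (Suc k) \<noteq> 0" "z - \<nu> (Suc n) \<noteq> 0"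
      using P1[of z] by (auto simp: \<rho>_def)
    have "(\<Prod>r=1..Suc k. z - \<rho>' r) = (\<Prod>r=1..k. z - \<nu> r) * (z - \<nu> (Suc n))"
      using P2[of z] by (simp add: \<rho>'_def)
    moreover have "(\<Prod>r=1..Suc (Suc k). z - \<rho> r) = (\<Prod>r=1..k. z - \<nu> r) * (z - \<nu> (Suc k)) * (z - \<nu> (Suc n))"
      using P1[of z] by (simp add: \<rho>_def)
    moreover have "(\<Prod>r=1..Suc k. z - \<nu> r) = (\<Prod>r=1..k. z - \<nu> r) * (z - \<nu> (Suc k))"
      by simp
    moreover have "a / (P * y) - a / (P * x) = (x - y) * (a / (P * x * y))"
      if "P \<noteq> 0" "x \<noteq> 0" "y \<noteq> 0" for a P x y :: complex
      using that by (simp add: field_simps)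
    ultimately show ?thesis using *(1) *(2) *(3) by (smt (verit) diff_diff_eq2 add_diff_cancel_left' diff_add_cancel)
  qed
  then have "contour_integral (circlepath 0 R) (\<lambda>z. f z / (\<Prod>r=1..Suc k. z - \<rho>' r) - f z / (\<Prod>r=1..Suc k. z - \<nu> r)) =
     contour_integral (circlepath 0 R) (\<lambda>z. (\<nu> (Suc n) - \<nu> (Suc k)) * (f z / (\<Prod>r=1..Suc (Suc k). z - \<rho> r)))"
    by (rule contour_integral_eq)
  then have "divdiff R \<rho>' (Suc k) f - divdiff R \<nu> (Suc k) f = (\<nu> (Suc n) - \<nu> (Suc k)) * divdiff R \<rho> (Suc (Suc k)) f"
    unfolding divdiff_def
    by (subst (asm) contour_integral_diff[OF divdiff_integrable[OF e3 cf] divdiff_integrable[OF e2 cf]],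
        subst (asm) contour_integral_lmul[OF divdiff_integrable[OF e1 cf]])
       (simp add: diff_divide_distrib[symmetric])
  then have *: "divdiff R \<rho>' (Suc k) f = divdiff R \<nu> (Suc k) f + (\<nu> (Suc n) - \<nu> (Suc k)) * divdiff R \<rho> (Suc (Suc k)) f"
    by (simp add: algebra_simps)
  have "f (\<nu> (Suc n)) = (\<Sum>i=1..k. (\<Prod>m=1..<i. \<nu> (Suc n) - \<nu> m) * divdiff R \<nu> i f)
     + (\<Prod>m=1..k. \<nu> (Suc n) - \<nu> m) * divdiff R \<rho>' (Suc k) f"
    using Suc.IH Suc.prems unfolding \<rho>'_def by simp
  also have "\<dots> = (\<Sum>i=1..Suc k. (\<Prod>m=1..<i. \<nu> (Suc n) - \<nu> m) * divdiff R \<nu> i f)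
     + (\<Prod>m=1..Suc k. \<nu> (Suc n) - \<nu> m) * divdiff R \<rho> (Suc (Suc k)) f"
    unfolding * by (simp add: algebra_simps atLeastLessThanSuc_atLeastAtMost)
  finally show ?case unfolding \<rho>_def .
qed

text \<open>
  At a node the remainder has become the last term of the sum.
\<close>
lemma divdiff_newton:
  assumes e: "encloses R \<nu> k" and f: "f holomorphic_on UNIV" and k: "1 \<le> k"
  shows "f (\<nu> k) = (\<Sum>i=1..k. (\<Prod>m=1..<i. \<nu> k - \<nu> m) * divdiff R \<nu> i f)"
proof -
  obtain n where n: "k = Suc n" using k by (cases k) auto
  have "(\<lambda>r. if r = Suc n then \<nu> (Suc n) else \<nu> r) = \<nu>" by auto
  with divdiff_newton_step[of R \<nu> n f n] e f show ?thesis
    by (simp add: n atLeastLessThanSuc_atLeastAtMost)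
qed

section \<open>Integrals over horizontal lines\<close>

lemma nn_integral_one_plus_abs_powr:
  assumes "1 < (p::real)"
  shows "(\<integral>\<^sup>+s. ennreal ((1 + \<bar>s\<bar>) powr - p) \<partial>lborel) < \<infinity>"
proof -
  define h where "h = (\<lambda>s::real. ennreal ((1 + \<bar>s\<bar>) powr - p) * indicator {0..} s)"
  have [measurable]: "h \<in> borel_measurable borel" unfolding h_def by measurable
  have "(\<integral>\<^sup>+s. ennreal ((1 + s) powr - p) * indicator {0..} s \<partial>lborel)
      = 0 - (- (1 / (p - 1)) * (1 + 0) powr (1 - p))"
  proof (rule nn_integral_FTC_atLeast)
    show "((\<lambda>s. - (1 / (p - 1)) * (1 + s) powr (1 - p)) has_real_derivative (1 + x) powr - p) (at x)"
      if "0 \<le> x" for x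
      by (rule derivative_eq_intros refl | use that assms in \<open>simp add: field_simps\<close>)+
    show "((\<lambda>s. - (1 / (p - 1)) * (1 + s) powr (1 - p)) \<longlongrightarrow> 0) at_top"
      using assms by real_asymp
  qed auto
  moreover have "integral\<^sup>N lborel h = (\<integral>\<^sup>+s. ennreal ((1 + s) powr - p) * indicator {0..} s \<partial>lborel)"
    unfolding h_def by (intro nn_integral_cong) (auto simp: indicator_def)
  ultimately have h: "integral\<^sup>N lborel h < \<infinity>" by simp
  have "(\<integral>\<^sup>+s. ennreal ((1 + \<bar>s\<bar>) powr - p) \<partial>lborel) \<le> (\<integral>\<^sup>+s. h s + h (- s) \<partial>lborel)"
    by (intro nn_integral_mono) (auto simp: h_def indicator_def)
  also have "\<dots> = integral\<^sup>N lborel h + (\<integral>\<^sup>+s. h (- s) \<partial>lborel)"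
    by (rule nn_integral_add) auto
  also have "(\<integral>\<^sup>+s. h (- s) \<partial>lborel) = integral\<^sup>N lborel h"
    using nn_integral_real_affine[of h "-1" 0] by simp
  finally show ?thesis using h by (simp add: order_le_less_trans ennreal_add_eq_top less_top)
qed

lemma nn_integral_lborel_shift:
  fixes r :: real
  assumes [measurable]: "f \<in> borel_measurable borel"
  shows "(\<integral>\<^sup>+s. f (s - r) \<partial>lborel) = integral\<^sup>N lborel f"
  using nn_integral_real_affine[of f 1 "- r"] by (simp add: algebra_simps)

text \<open>
  Away from \<open>\<nu>\<close>, the factor \<open>1 / \<bar>\<mu> - \<nu>\<bar>\<close> decays like \<open>1 / (1 + \<bar>\<mu>\<bar>)\<close>, with a constant
  linear in \<open>1 + \<bar>\<nu>\<bar>\<close>.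
\<close>
lemma one_plus_norm_le:
  fixes \<mu> \<nu> :: complex
  assumes "0 < d" "d \<le> cmod (\<mu> - \<nu>)"
  shows "1 + cmod \<mu> \<le> (1 + 1 / d) * (1 + cmod \<nu>) * cmod (\<mu> - \<nu>)"
proof -
  have "1 \<le> cmod (\<mu> - \<nu>) / d" using assms by simp
  have "1 + cmod \<mu> \<le> 1 + cmod \<nu> + cmod (\<mu> - \<nu>)"
    by (smt (verit) norm_triangle_ineq2)
  also have "\<dots> \<le> (1 + cmod \<nu>) * (1 + cmod (\<mu> - \<nu>))" by (simp add: algebra_simps)
  also have "\<dots> \<le> (1 + cmod \<nu>) * (cmod (\<mu> - \<nu>) / d + cmod (\<mu> - \<nu>))"
    using \<open>1 \<le> cmod (\<mu> - \<nu>) / d\<close> by (intro mult_left_mono) auto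
  finally show ?thesis by (simp add: algebra_simps add_divide_distrib)
qed

lemma integrable_line_prod:
  fixes \<nu> :: "nat \<Rightarrow> complex"
  assumes j: "2 \<le> j" and im: "\<And>r. r \<in> {1..j} \<Longrightarrow> c < Im (\<nu> r)"
  shows "integrable lborel (\<lambda>t. exp (\<i> * Complex t c * of_real y) / (\<Prod>r=1..j. Complex t c - \<nu> r))"
proof -
  define d where "d = (\<lambda>r. Im (\<nu> r) - c)"
  define \<kappa> where "\<kappa> = (\<lambda>r. (1 + 1 / d r) * (1 + cmod (\<nu> r)))"
  have d: "0 < d r" "d r \<le> cmod (Complex t c - \<nu> r)" if "r \<in> {1..j}" for r t
    using im[OF that] abs_Im_le_cmod[of "Complex t c - \<nu> r"] by (simp_all add: d_def)
  have \<kappa>: "0 < \<kappa> r" if "r \<in> {1..j}" for r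
    using d[OF that] by (auto simp: \<kappa>_def intro!: mult_pos_pos add_pos_nonneg)
  have bound: "cmod (exp (\<i> * Complex t c * of_real y) / (\<Prod>r=1..j. Complex t c - \<nu> r))
      \<le> exp (- c * y) * (\<Prod>r=1..j. \<kappa> r) * (1 + \<bar>t\<bar>) powr - 2" for t
  proof -
    have "1 / cmod (Complex t c - \<nu> r) \<le> \<kappa> r / (1 + \<bar>t\<bar>)" if r: "r \<in> {1..j}" for r
    proof -
      have "1 + \<bar>t\<bar> \<le> 1 + cmod (Complex t c)" using abs_Re_le_cmod[of "Complex t c"] by simp
      also have "\<dots> \<le> \<kappa> r * cmod (Complex t c - \<nu> r)"
        using one_plus_norm_le[OF d[OF r]] by (simp add: \<kappa>_def)
      finally show ?thesis using less_le_trans[OF d(1)[OF r] d(2)[OF r, of t]]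
        by (simp add: divide_simps mult.commute add_pos_nonneg)
    qed
    then have "(\<Prod>r=1..j. 1 / cmod (Complex t c - \<nu> r)) \<le> (\<Prod>r=1..j. \<kappa> r / (1 + \<bar>t\<bar>))"
      by (intro prod_mono) auto
    also have "\<dots> = (\<Prod>r=1..j. \<kappa> r) * (1 / (1 + \<bar>t\<bar>)) ^ j"
      by (simp add: prod_dividef power_one_over divide_simps)
    also have "\<dots> \<le> (\<Prod>r=1..j. \<kappa> r) * (1 / (1 + \<bar>t\<bar>)) ^ 2"
      using \<kappa> by (intro mult_left_mono power_decreasing j prod_nonneg) (auto simp: less_imp_le)
    also have "(1 / (1 + \<bar>t\<bar>)) ^ 2 = (1 + \<bar>t\<bar>) powr - 2"
      by (simp add: powr_minus power_one_over divide_simps)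
    finally have "(\<Prod>r=1..j. 1 / cmod (Complex t c - \<nu> r)) \<le> (\<Prod>r=1..j. \<kappa> r) * (1 + \<bar>t\<bar>) powr - 2" .
    then have "exp (- c * y) * (\<Prod>r=1..j. 1 / cmod (Complex t c - \<nu> r)) \<le> exp (- c * y) * ((\<Prod>r=1..j. \<kappa> r) * (1 + \<bar>t\<bar>) powr - 2)"
      by (rule mult_left_mono) simp
    then show ?thesis by (simp add: norm_divide prod_norm prod_dividef mult.assoc)
  qed
  have cx: "Complex t c = of_real t + \<i> * of_real c" for t by (simp add: complex_eq_iff)
  show ?thesis
  proof (rule Bochner_Integration.integrable_bound)
    show "integrable lborel (\<lambda>t::real. exp (- c * y) * (\<Prod>r=1..j. \<kappa> r) * (1 + \<bar>t\<bar>) powr - 2)"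
    proof (intro integrable_mult_right)
      show "integrable lborel (\<lambda>t::real. (1 + \<bar>t\<bar>) powr - 2)"
        using nn_integral_one_plus_abs_powr[of 2] by (intro integrableI_nonneg) auto
    qed
    show "(\<lambda>t. exp (\<i> * Complex t c * of_real y) / (\<Prod>r=1..j. Complex t c - \<nu> r)) \<in> borel_measurable lborel"
      unfolding cx by measurable
    show "AE t in lborel. cmod (exp (\<i> * Complex t c * of_real y) / (\<Prod>r=1..j. Complex t c - \<nu> r))
      \<le> norm (exp (- c * y) * (\<Prod>r=1..j. \<kappa> r) * (1 + \<bar>t\<bar>) powr - 2)"
      using bound by (intro AE_I2) (smt (verit) real_norm_def)
  qed
qed

text \<open>
  The linear homotopy between the circles consists of circles that enclose the points as well, by
  convexity of the norm.
\<close>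
lemma contour_integral_circle_shift:
  fixes \<nu> :: "nat \<Rightarrow> complex"
  assumes f: "f holomorphic_on - (\<nu> ` {1..j})"
    and R: "0 < R" "\<And>r. r \<in> {1..j} \<Longrightarrow> cmod (\<nu> r - p) < R"
    and R': "0 < R'" "\<And>r. r \<in> {1..j} \<Longrightarrow> cmod (\<nu> r - p') < R'"
  shows "contour_integral (circlepath p R) f = contour_integral (circlepath p' R') f"
proof (rule Cauchy_theorem_homotopic_loops)
  show "open (- (\<nu> ` {1..j}))" by (intro open_Compl finite_imp_closed finite_imageI) simp
  show "f holomorphic_on - (\<nu> ` {1..j})" by fact
  show "homotopic_loops (- (\<nu> ` {1..j})) (circlepath p R) (circlepath p' R')"
  proof (rule homotopic_loops_linear)
    fix t :: real assume t: "t \<in> {0..1}"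
    show "closed_segment (circlepath p R t) (circlepath p' R' t) \<subseteq> - \<nu> ` {1..j}"
    proof
      fix w assume "w \<in> closed_segment (circlepath p R t) (circlepath p' R' t)"
      then obtain u where u: "0 \<le> u" "u \<le> 1"
        and w: "w = (1 - u) *\<^sub>R circlepath p R t + u *\<^sub>R circlepath p' R' t"
        by (auto simp: closed_segment_def)
      define e where "e = exp (2 * of_real pi * \<i> * of_real t)"
      define q where "q = (1 - u) *\<^sub>R p + u *\<^sub>R p'"
      have "w - q = of_real ((1 - u) * R + u * R') * e"
        unfolding w q_def e_def circlepath by (simp add: scaleR_conv_of_real algebra_simps)
      moreover have "cmod e = 1" by (simp add: e_def)
      moreover have "0 \<le> (1 - u) * R + u * R'" using u R(1) R'(1) by simp
      ultimately have 1: "cmod (w - q) = (1 - u) * R + u * R'"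
        by (simp add: norm_mult del: of_real_add of_real_mult of_real_diff)
      show "w \<in> - \<nu> ` {1..j}"
      proof
        assume "w \<in> \<nu> ` {1..j}"
        then obtain r where r: "r \<in> {1..j}" "w = \<nu> r" by auto
        have "w - q = (1 - u) *\<^sub>R (\<nu> r - p) + u *\<^sub>R (\<nu> r - p')"
          by (simp add: r q_def algebra_simps)
        then have "cmod (w - q) \<le> (1 - u) * cmod (\<nu> r - p) + u * cmod (\<nu> r - p')"
          using u by (metis (no_types, lifting) abs_of_nonneg diff_ge_0_iff_ge norm_scaleR norm_triangle_ineq)
        also have "\<dots> < (1 - u) * R + u * R'"
        proof (cases "u = 0")
          case True then show ?thesis using R(2)[OF r(1)] by simp
        next
          case False
          then have "u * cmod (\<nu> r - p') < u * R'" using R'(2)[OF r(1)] u by simp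
          moreover have "(1 - u) * cmod (\<nu> r - p) \<le> (1 - u) * R"
            using R(2)[OF r(1)] u by (intro mult_left_mono) auto
          ultimately show ?thesis by simp
        qed
        finally show False using 1 by simp
      qed
    qed
  qed simp_all
qed auto

text \<open>
  The integrand is \<open>O(\<bar>z\<bar>\<^sup>-\<^sup>2)\<close>, and the radius is arbitrary.
\<close>
lemma divdiff_one:
  assumes e: "encloses R \<nu> j" and j: "2 \<le> j"
  shows "divdiff R \<nu> j (\<lambda>z. 1) = 0"
proof -
  define I where "I = contour_integral (circlepath 0 R) (\<lambda>z. 1 / (\<Prod>r=1..j. z - \<nu> r))"
  have R: "0 < R" "\<And>r. r \<in> {1..j} \<Longrightarrow> cmod (\<nu> r) < R" using e by (auto simp: encloses_def)
  have bd: "cmod I \<le> 1 / s ^ j * (2 * pi * (R + s))" if s: "0 < s" for s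
  proof -
    have e': "encloses (R + s) \<nu> j" using e s by (force simp: encloses_def)
    have "I = contour_integral (circlepath 0 (R + s)) (\<lambda>z. 1 / (\<Prod>r=1..j. z - \<nu> r))"
      unfolding I_def
      by (rule contour_integral_circle_shift[where \<nu> = \<nu> and j = j])
         (use R e' s in \<open>auto intro!: holomorphic_intros simp: encloses_def\<close>)
    moreover have "(\<lambda>z. 1 / (\<Prod>r=1..j. z - \<nu> r)) contour_integrable_on circlepath 0 (R + s)"
      using divdiff_integrable[OF e', of "\<lambda>_. 1"] by simp
    ultimately have "((\<lambda>z. 1 / (\<Prod>r=1..j. z - \<nu> r)) has_contour_integral I) (circlepath 0 (R + s))"
      using has_contour_integral_integral by metis
    then show ?thesis
    proof (rule has_contour_integral_bound_circlepath)
      show "0 \<le> 1 / s ^ j" "0 < R + s" using s R by auto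
      fix x assume x: "cmod (x - 0) = R + s"
      have "s ^ j = (\<Prod>r=1..j. s)" by simp
      also have "\<dots> \<le> (\<Prod>r=1..j. cmod (x - \<nu> r))"
      proof (rule prod_mono, intro conjI)
        fix r assume "r \<in> {1..j}"
        then show "s \<le> cmod (x - \<nu> r)"
          using R(2)[of r] x norm_triangle_ineq2[of x "\<nu> r"] by simp
      qed (use s in auto)
      finally show "cmod (1 / (\<Prod>r=1..j. x - \<nu> r)) \<le> 1 / s ^ j"
        using s by (simp add: norm_divide prod_norm frac_le)
    qed
  qed
  have "((\<lambda>s. 1 / s ^ 2 * (2 * pi * (R + s))) \<longlongrightarrow> 0) at_top"
    by real_asymp
  moreover have "eventually (\<lambda>s. cmod I \<le> 1 / s ^ 2 * (2 * pi * (R + s))) at_top"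
    using eventually_ge_at_top[of "1::real"]
  proof eventually_elim
    case (elim s)
    have "s ^ 2 \<le> s ^ j" using elim j by (rule power_increasing[rotated])
    then have "1 / s ^ j * (2 * pi * (R + s)) \<le> 1 / s ^ 2 * (2 * pi * (R + s))"
      using elim R by (intro mult_right_mono frac_le) auto
    with bd[of s] elim show ?case by linarith
  qed
  ultimately have "cmod I \<le> 0" by (rule tendsto_lowerbound) simp
  then show ?thesis by (simp add: divdiff_def I_def)
qed

text \<open>
  The derivative is taken under the contour integral; the extra factor \<open>p\<close> lets the lemma be
  iterated.
\<close>
lemma divdiff_exp_has_vector_derivative:
  assumes e: "encloses R \<nu> j" and p: "continuous_on UNIV p"
  shows "((\<lambda>y. divdiff R \<nu> j (\<lambda>z. p z * exp (\<i> * z * of_real y))) has_vector_derivative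
      divdiff R \<nu> j (\<lambda>z. p z * (\<i> * z) * exp (\<i> * z * of_real y))) (at y)"
proof -
  define w where "w = (\<lambda>t. of_real R * cis t)"
  define q where "q = (\<lambda>t. p (w t) / (\<Prod>r=1..j. w t - \<nu> r) * of_real R * \<i> * cis t)"
  have R: "0 < R" using e by (simp add: encloses_def)
  have nz: "(\<Prod>r=1..j. w t - \<nu> r) \<noteq> 0" for t
  proof (rule encloses_off_circle[OF e])
    show "w t \<in> path_image (circlepath 0 R)" using R by (simp add: w_def norm_mult)
  qed
  have cw: "continuous_on A w" for A unfolding w_def by (intro continuous_intros)
  have cq: "continuous_on A q" for A
    unfolding q_def using nz by (intro continuous_intros cw continuous_on_compose2[OF p]) auto
  have eq: "divdiff R \<nu> j (\<lambda>z. p z * k z * exp (\<i> * z * of_real y))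
      = integral (cbox 0 (2 * pi)) (\<lambda>t. q t * k (w t) * exp (\<i> * w t * of_real y)) / (2 * of_real pi * \<i>)" for y k
  proof -
    have "contour_integral (circlepath 0 R) (\<lambda>z. p z * k z * exp (\<i> * z * of_real y) / (\<Prod>r=1..j. z - \<nu> r))
       = integral (cbox 0 (2 * pi)) (\<lambda>t. q t * k (w t) * exp (\<i> * w t * of_real y))"
      unfolding circlepath_def
      by (subst contour_integral_part_circlepath_eq)
         (auto simp: w_def q_def mult_ac intro!: arg_cong2[where f = integral])
    then show ?thesis by (simp add: divdiff_def)
  qed
  have "((\<lambda>y. integral (cbox 0 (2 * pi)) (\<lambda>t. q t * exp (\<i> * w t * of_real y))) has_vector_derivative
      integral (cbox 0 (2 * pi)) (\<lambda>t. q t * (\<i> * w t) * exp (\<i> * w t * of_real y))) (at y within UNIV)"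
  proof (rule leibniz_rule_vector_derivative)
    fix y t :: real
    have "((\<lambda>v. exp (\<i> * w t * v)) has_field_derivative \<i> * w t * exp (\<i> * w t * of_real y)) (at (of_real y))"
      by (auto intro!: derivative_eq_intros)
    from has_vector_derivative_real_field[OF this]
    show "((\<lambda>y. q t * exp (\<i> * w t * of_real y)) has_vector_derivative q t * (\<i> * w t) * exp (\<i> * w t * of_real y)) (at y within UNIV)"
      by (simp add: has_vector_derivative_mult_right mult.assoc)
  next
    show "(\<lambda>t. q t * exp (\<i> * w t * of_real y)) integrable_on cbox 0 (2 * pi)" for y
      by (intro integrable_continuous continuous_intros cq cw)
  next
    show "continuous_on (UNIV \<times> cbox 0 (2 * pi)) (\<lambda>(y, t). q t * (\<i> * w t) * exp (\<i> * w t * of_real y))"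
      unfolding case_prod_unfold
      by (intro continuous_intros continuous_on_compose2[OF cq] continuous_on_compose2[OF cw]) auto
  qed auto
  then have "((\<lambda>y. integral (cbox 0 (2 * pi)) (\<lambda>t. q t * exp (\<i> * w t * of_real y)) / (2 * of_real pi * \<i>)) has_vector_derivative
      integral (cbox 0 (2 * pi)) (\<lambda>t. q t * (\<i> * w t) * exp (\<i> * w t * of_real y)) / (2 * of_real pi * \<i>)) (at y)"
    by (rule has_vector_derivative_divide)
  then show ?thesis
    unfolding eq[of "\<lambda>z. \<i> * z"] using eq[of "\<lambda>z. 1"] by simp
qed

text \<open>
  The circle is moved to the centre \<open>\<i> c\<close>. Its lower half then lies, together with the chord on the
  line \<open>Im z = c\<close>, in a half-plane free of nodes, so it may be replaced by the chord; the upper half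
  contributes \<open>O(T\<^sup>1\<^sup>-\<^sup>j)\<close> as the radius \<open>T\<close> grows, because \<open>y \<ge> 0\<close> bounds the exponential there.
\<close>
lemma line_integral_divdiff:
  assumes e: "encloses R \<nu> j" and j: "2 \<le> j" and y: "0 \<le> y"
    and im: "\<And>r. r \<in> {1..j} \<Longrightarrow> c < Im (\<nu> r)"
  shows "(\<integral>t. exp (\<i> * Complex t c * of_real y) / (\<Prod>r=1..j. Complex t c - \<nu> r) \<partial>lborel)
     = 2 * of_real pi * \<i> * divdiff R \<nu> j (\<lambda>z. exp (\<i> * z * of_real y))"
proof -
  define p where "p = Complex 0 c"
  define f where "f = (\<lambda>z. exp (\<i> * z * of_real y) / (\<Prod>r=1..j. z - \<nu> r))"
  define M where "M = (\<Sum>r=1..j. cmod (\<nu> r - p))"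
  define H where "H = {z. \<forall>r\<in>{1..j}. Im z < Im (\<nu> r)}"
  have M: "cmod (\<nu> r - p) \<le> M" if "r \<in> {1..j}" for r
    unfolding M_def using that by (intro member_le_sum) auto
  have M0: "0 \<le> M" unfolding M_def by (intro sum_nonneg) auto
  have R: "0 < R" "\<And>r. r \<in> {1..j} \<Longrightarrow> cmod (\<nu> r) < R" using e by (auto simp: encloses_def)
  have f_hol: "f holomorphic_on - (\<nu> ` {1..j})"
    unfolding f_def by (intro holomorphic_intros) auto
  have H_eq: "H = (\<Inter>r\<in>{1..j}. {z. Im z < Im (\<nu> r)})" by (auto simp: H_def)
  have H: "open H" "convex H"
    unfolding H_eq by (auto intro!: open_halfspace_Im_lt convex_INT convex_halfspace_Im_lt)
  have Hin: "z \<in> H" if "Im z \<le> c" for z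
    using that im by (force simp: H_def)
  have "f holomorphic_on H"
    by (rule holomorphic_on_subset[OF f_hol]) (auto simp: H_def)
  \<comment> \<open>On the node-free half-plane \<open>H\<close> a primitive compares the lower arc with the chord.\<close>
  then obtain F where F: "\<And>z. z \<in> H \<Longrightarrow> (F has_field_derivative f z) (at z)"
    using holomorphic_convex_primitive'[OF H(2,1)] at_within_open[OF _ H(1)] by metis
  have FTC: "((\<lambda>t. f (Complex t c)) has_integral F (Complex T c) - F (Complex (- T) c)) {- T..T}"
    if "0 \<le> T" for T
  proof (rule fundamental_theorem_of_calculus)
    show "- T \<le> T" using that by simp
    fix t
    have "((\<lambda>t. Complex t c) has_vector_derivative 1) (at t within {- T..T})"
      unfolding Complex_eq by (auto intro!: derivative_eq_intros)
    moreover have "(F has_field_derivative f (Complex t c)) (at (Complex t c))"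
      by (rule F) (auto intro: Hin)
    ultimately have "(F \<circ> (\<lambda>t. Complex t c) has_vector_derivative 1 * f (Complex t c)) (at t within {- T..T})"
      using field_vector_diff_chain_within has_field_derivative_at_within by blast
    then show "((\<lambda>t. F (Complex t c)) has_vector_derivative f (Complex t c)) (at t within {- T..T})"
      by (simp add: o_def)
  qed
  define I where "I = contour_integral (circlepath 0 R) f"
  have bd: "cmod (I - (F (Complex T c) - F (Complex (- T) c))) \<le> exp (- c * y) / (T - M) ^ j * T * pi"
    if T: "M < T" for T
  proof -
    have T0: "0 < T" using T M0 by simp
    have cmodT: "T - M \<le> cmod (z - \<nu> r)" if "cmod (z - p) = T" "r \<in> {1..j}" for z r
      using M[OF that(2)] that(1) norm_triangle_ineq2[of "z - p" "\<nu> r - p"] by simp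
    have cf: "continuous_on (sphere p T) f"
      using cmodT T by (intro holomorphic_on_imp_continuous_on holomorphic_on_subset[OF f_hol])
        (force simp: dist_norm norm_minus_commute)
    have ci: "f contour_integrable_on part_circlepath p T a b" for a b
      by (intro contour_integrable_continuous_part_circlepath continuous_on_subset[OF cf]
          path_image_part_circlepath_subset') (use T0 in simp)
    have "I = contour_integral (circlepath p T) f"
      unfolding I_def
      by (rule contour_integral_circle_shift[OF f_hol])
         (use R T0 T M in \<open>auto intro: le_less_trans\<close>)
    also have "\<dots> = integral {0..2 * pi} (\<lambda>t. f (p + T * cis t) * T * \<i> * cis t)"
      unfolding circlepath_def by (rule contour_integral_part_circlepath_eq) simp
    also have "\<dots> = integral {0..pi} (\<lambda>t. f (p + T * cis t) * T * \<i> * cis t)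
        + integral {pi..2 * pi} (\<lambda>t. f (p + T * cis t) * T * \<i> * cis t)"
      using ci[of 0 "2 * pi"]
      by (intro Henstock_Kurzweil_Integration.integral_combine[symmetric])
         (auto simp: contour_integrable_part_circlepath_iff)
    also have "\<dots> = contour_integral (part_circlepath p T 0 pi) f + contour_integral (part_circlepath p T pi (2 * pi)) f"
      by (simp add: contour_integral_part_circlepath_eq)
    finally have split: "I = contour_integral (part_circlepath p T 0 pi) f + contour_integral (part_circlepath p T pi (2 * pi)) f" .
    have "(f has_contour_integral F (pathfinish (part_circlepath p T pi (2 * pi))) - F (pathstart (part_circlepath p T pi (2 * pi))))
        (part_circlepath p T pi (2 * pi))"
    proof (rule contour_integral_primitive)
      show "(F has_field_derivative f z) (at z within H)" if "z \<in> H" for z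
        using F[OF that] by (rule has_field_derivative_at_within)
      show "path_image (part_circlepath p T pi (2 * pi)) \<subseteq> H"
      proof
        fix z assume "z \<in> path_image (part_circlepath p T pi (2 * pi))"
        then obtain x where x: "pi \<le> x" "x \<le> 2 * pi" "z = p + T * cis x"
          by (auto simp: path_image_part_circlepath' closed_segment_eq_real_ivl)
        have "sin x \<le> 0"
          using x sin_le_zero[of x] by (cases "x = 2 * pi") auto
        then show "z \<in> H" using T0 by (intro Hin) (simp add: x p_def mult_nonneg_nonpos)
      qed
    qed simp
    then have low: "contour_integral (part_circlepath p T pi (2 * pi)) f = F (Complex T c) - F (Complex (- T) c)"
      by (simp add: contour_integral_unique p_def Complex_eq exp_eq_polar[symmetric] cis_conv_exp[symmetric] mult.commute add.commute)
    have up: "cmod (contour_integral (part_circlepath p T 0 pi) f) \<le> exp (- c * y) / (T - M) ^ j * T * \<bar>pi - 0\<bar>"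
    proof (rule contour_integral_bound_part_circlepath[OF ci])
      show "0 \<le> exp (- c * y) / (T - M) ^ j" "0 \<le> T" using T T0 by auto
      fix z assume z: "z \<in> path_image (part_circlepath p T 0 pi)"
      then obtain x where x: "0 \<le> x" "x \<le> pi" "z = p + T * cis x"
        by (auto simp: path_image_part_circlepath' closed_segment_eq_real_ivl)
      have "c \<le> Im z" using T0 sin_ge_zero[OF x(1,2)] by (simp add: x p_def)
      then have "exp (- (Im z * y)) \<le> exp (- (c * y))" using y by (simp add: mult_right_mono)
      moreover have "(T - M) ^ j \<le> (\<Prod>r=1..j. cmod (z - \<nu> r))"
      proof -
        have zp: "cmod (z - p) = T" using x(3) T0 by (simp add: norm_mult)
        have "(T - M) ^ j = (\<Prod>r=1..j. T - M)" by simp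
        also have "\<dots> \<le> (\<Prod>r=1..j. cmod (z - \<nu> r))"
          using cmodT[OF zp] T by (intro prod_mono) auto
        finally show ?thesis .
      qed
      moreover have "0 < (T - M) ^ j" using T by simp
      ultimately show "cmod (f z) \<le> exp (- c * y) / (T - M) ^ j"
        unfolding f_def by (simp add: norm_divide prod_norm frac_le)
    qed
    from up show ?thesis unfolding split low by simp
  qed
  define g where "g = (\<lambda>t. f (Complex t c))"
  have gint: "integrable lborel g"
    unfolding g_def f_def by (rule integrable_line_prod[OF j im])
  have lim1: "(\<lambda>n. \<integral>t. indicator {- real n..real n} t *\<^sub>R g t \<partial>lborel) \<longlonglongrightarrow> (\<integral>t. g t \<partial>lborel)"
  proof (rule integral_dominated_convergence)
    show "integrable lborel (\<lambda>t. norm (g t))" using gint by (rule integrable_norm)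
    show "AE t in lborel. (\<lambda>n. indicator {- real n..real n} t *\<^sub>R g t) \<longlonglongrightarrow> g t"
    proof (intro AE_I2)
      fix t :: real
      obtain N :: nat where N: "\<bar>t\<bar> \<le> real N" using real_arch_simple by blast
      have "eventually (\<lambda>n. indicator {- real n..real n} t *\<^sub>R g t = g t) sequentially"
        using eventually_ge_at_top[of N] by eventually_elim (use N in \<open>auto simp: indicator_def\<close>)
      then show "(\<lambda>n. indicator {- real n..real n} t *\<^sub>R g t) \<longlonglongrightarrow> g t"
        by (rule tendsto_eventually)
    qed
    show "g \<in> borel_measurable lborel" using gint by simp
    then show "(\<lambda>t. indicator {- real n..real n} t *\<^sub>R g t) \<in> borel_measurable lborel" for n by simp
  qed (auto simp: indicator_def)
  have trunc: "(\<integral>t. indicator {- real n..real n} t *\<^sub>R g t \<partial>lborel) = F (Complex (real n) c) - F (Complex (- real n) c)" for n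
  proof -
    have "set_integrable lborel {- real n..real n} g"
      unfolding set_integrable_def by (rule integrable_mult_indicator[OF _ gint]) simp
    from set_borel_integral_eq_integral(2)[OF this] show ?thesis
      using integral_unique[OF FTC[of "real n"]] by (simp add: set_lebesgue_integral_def g_def)
  qed
  have lim2: "(\<lambda>n. \<integral>t. indicator {- real n..real n} t *\<^sub>R g t \<partial>lborel) \<longlonglongrightarrow> I"
  proof (rule LIM_zero_cancel, rule Lim_null_comparison)
    show "(\<lambda>n::nat. exp (- c * y) / (real n - M) ^ 2 * real n * pi) \<longlonglongrightarrow> 0"
      by real_asymp
    obtain N :: nat where N: "M + 1 \<le> real N" using real_arch_simple by blast
    show "eventually (\<lambda>n. cmod ((\<integral>t. indicator {- real n..real n} t *\<^sub>R g t \<partial>lborel) - I)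
        \<le> exp (- c * y) / (real n - M) ^ 2 * real n * pi) sequentially"
      using eventually_ge_at_top[of N]
    proof eventually_elim
      case (elim n)
      have n: "1 \<le> real n - M" using N elim by simp
      have "(real n - M) ^ 2 \<le> (real n - M) ^ j" using n j by (intro power_increasing) auto
      then have "exp (- c * y) / (real n - M) ^ j * real n * pi \<le> exp (- c * y) / (real n - M) ^ 2 * real n * pi"
        using n by (intro mult_right_mono frac_le) auto
      with bd[of "real n"] n show ?case unfolding trunc by (simp add: norm_minus_commute)
    qed
  qed
  have "(\<integral>t. g t \<partial>lborel) = I" using LIMSEQ_unique[OF lim1 lim2] .
  then show ?thesis by (simp add: g_def f_def I_def divdiff_def)
qed

section \<open>Determinants of functions of two indices\<close>

text \<open>
  The arrays of the problem are numbered from \<open>1\<close>, matrices from \<open>0\<close>.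
\<close>
definition fdet :: "nat \<Rightarrow> (nat \<Rightarrow> nat \<Rightarrow> complex) \<Rightarrow> complex" where
  "fdet n A = Determinant.det (Matrix.mat n n (\<lambda>(i, j). A (Suc i) (Suc j)))"

lemma fdet_cong:
  assumes "\<And>i j. i \<in> {1..n} \<Longrightarrow> j \<in> {1..n} \<Longrightarrow> A i j = B i j"
  shows "fdet n A = fdet n B"
  unfolding fdet_def using assms
  by (intro arg_cong[where f = Determinant.det]) (auto intro!: eq_matI)

lemma fdet_sum:
  "fdet n A = (\<Sum>\<sigma> | \<sigma> permutes {0..<n}. of_int (sign \<sigma>) * (\<Prod>j<n. A (Suc (\<sigma> j)) (Suc j)))"
proof -
  have "fdet n A = (\<Sum>\<sigma> | \<sigma> permutes {0..<n}. of_int (sign \<sigma>) *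
      (\<Prod>j<n. Matrix.mat n n (\<lambda>(i, j). A (Suc i) (Suc j)) $$ (\<sigma> j, j)))"
    unfolding fdet_def by (rule det_col) simp
  also have "\<dots> = (\<Sum>\<sigma> | \<sigma> permutes {0..<n}. of_int (sign \<sigma>) * (\<Prod>j<n. A (Suc (\<sigma> j)) (Suc j)))"
  proof (intro sum.cong refl arg_cong2[where f = "(*)"] prod.cong)
    fix \<sigma> j assume "\<sigma> \<in> {\<sigma>. \<sigma> permutes {0..<n}}" "j \<in> {..<n}"
    then show "Matrix.mat n n (\<lambda>(i, j). A (Suc i) (Suc j)) $$ (\<sigma> j, j) = A (Suc (\<sigma> j)) (Suc j)"
      using permutes_in_image[of \<sigma> "{0..<n}" j] by simp
  qed
  finally show ?thesis .
qed

lemma fdet_mult: "fdet n (\<lambda>i j. \<Sum>k=1..n. A i k * B k j) = fdet n A * fdet n B"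
proof -
  have "Matrix.mat n n (\<lambda>(i, j). \<Sum>k=1..n. A (Suc i) k * B k (Suc j))
     = Matrix.mat n n (\<lambda>(i, j). A (Suc i) (Suc j)) * Matrix.mat n n (\<lambda>(i, j). B (Suc i) (Suc j))"
    by (rule eq_matI)
       (auto simp: scalar_prod_def sum.atLeast1_atMost_eq atLeast0LessThan)
  then show ?thesis unfolding fdet_def
    by (simp add: det_mult[where n = n])
qed

lemma prod_list_diag_mat:
  "prod_list (diag_mat (Matrix.mat n n (\<lambda>(i, j). A (Suc i) (Suc j)))) = (\<Prod>i=1..n. (A i i :: complex))"
  by (auto simp: prod_list_diag_prod prod.atLeast1_atMost_eq atLeast0LessThan intro!: prod.cong)

lemma fdet_lower_triangular:
  assumes "\<And>i j. i \<in> {1..n} \<Longrightarrow> j \<in> {1..n} \<Longrightarrow> i < j \<Longrightarrow> A i j = 0"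
  shows "fdet n A = (\<Prod>i=1..n. A i i)"
  unfolding fdet_def using assms
  by (subst det_lower_triangular[where n = n]) (auto simp: prod_list_diag_mat)

lemma fdet_upper_triangular:
  assumes "\<And>i j. i \<in> {1..n} \<Longrightarrow> j \<in> {1..n} \<Longrightarrow> j < i \<Longrightarrow> A i j = 0"
  shows "fdet n A = (\<Prod>i=1..n. A i i)"
  unfolding fdet_def using assms
  by (subst det_upper_triangular[where n = n]) (auto simp: prod_list_diag_mat)

lemma fdet_equal_columns:
  assumes "a \<in> {1..n}" "b \<in> {1..n}" "a \<noteq> b" "\<And>i. i \<in> {1..n} \<Longrightarrow> A i a = A i b"
  shows "fdet n A = 0"
  unfolding fdet_def
proof (rule det_identical_columns)
  show "a - 1 \<noteq> b - 1" "a - 1 < n" "b - 1 < n" using assms by auto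
  then show "col (Matrix.mat n n (\<lambda>(i, j). A (Suc i) (Suc j))) (a - 1)
      = col (Matrix.mat n n (\<lambda>(i, j). A (Suc i) (Suc j))) (b - 1)"
    using assms by (intro eq_vecI) auto
qed simp

lemma fdet_scale_columns: "fdet n (\<lambda>i j. c j * A i j) = (\<Prod>j=1..n. c j) * fdet n A"
proof -
  have "(\<Prod>j=1..n. c j) = (\<Prod>j<n. c (Suc j))" by (simp add: prod.atLeast1_atMost_eq)
  then show ?thesis
    unfolding fdet_sum by (simp add: prod.distrib sum_distrib_left mult_ac)
qed

lemma fdet_transpose: "fdet n (\<lambda>i j. A j i) = fdet n A"
proof -
  have "transpose_mat (Matrix.mat n n (\<lambda>(i, j). A (Suc i) (Suc j))) = Matrix.mat n n (\<lambda>(i, j). A (Suc j) (Suc i))"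
    by (rule eq_matI) auto
  then show ?thesis unfolding fdet_def
    by (metis Determinant.det_transpose mat_carrier)
qed

text \<open>
  The divided differences of the constant function \<open>1\<close> form such a last column.
\<close>
lemma fdet_last_column_unit:
  assumes "\<And>i. i \<in> {1..Suc n} \<Longrightarrow> A i (Suc n) = (if i = 1 then 1 else 0)"
  shows "fdet (Suc n) A = (- 1) ^ n * fdet n (\<lambda>i j. A (Suc i) j)"
proof -
  let ?M = "Matrix.mat (Suc n) (Suc n) (\<lambda>(i, j). A (Suc i) (Suc j))"
  have "fdet (Suc n) A = (\<Sum>i<Suc n. ?M $$ (i, n) * cofactor ?M i n)"
    unfolding fdet_def by (rule laplace_expansion_column) auto
  also have "\<dots> = (\<Sum>i<Suc n. if i = 0 then cofactor ?M i n else 0)"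
    using assms by (intro sum.cong) auto
  also have "\<dots> = cofactor ?M 0 n" by (simp add: sum.delta)
  also have "mat_delete ?M 0 n = Matrix.mat n n (\<lambda>(i, j). A (Suc (Suc i)) (Suc j))"
    by (rule eq_matI) (auto simp: mat_delete_def)
  then have "cofactor ?M 0 n = (- 1) ^ n * fdet n (\<lambda>i j. A (Suc i) j)"
    by (simp add: cofactor_def fdet_def)
  finally show ?thesis .
qed

section \<open>Determinants of divided differences\<close>

definition vandermonde :: "nat \<Rightarrow> (nat \<Rightarrow> complex) \<Rightarrow> complex" where
  "vandermonde n \<mu> = (\<Prod>k=1..n. \<Prod>m=1..<k. \<mu> k - \<mu> m)"

lemma vandermonde_nonzero:
  assumes "inj_on \<mu> {1..n}"
  shows "vandermonde n \<mu> \<noteq> 0"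
  using assms by (fastforce simp: vandermonde_def inj_on_def)

text \<open>
  Newton's formula expresses the matrix of values as a triangular matrix, with the Vandermonde
  product as determinant, times the matrix of divided differences. It holds for coinciding nodes, too,
  where both sides vanish.
\<close>
lemma vandermonde_mult_divdiff:
  assumes e: "encloses R \<mu> n" and f: "\<And>j. j \<in> {1..n} \<Longrightarrow> f j holomorphic_on UNIV"
  shows "vandermonde n \<mu> * fdet n (\<lambda>i j. divdiff R \<mu> i (f j)) = fdet n (\<lambda>i j. f j (\<mu> i))"
proof -
  define L where "L = (\<lambda>k i. if i \<le> k then (\<Prod>m=1..<i. \<mu> k - \<mu> m) else 0)"
  have "fdet n L = vandermonde n \<mu>"
    unfolding vandermonde_def by (subst fdet_lower_triangular) (auto simp: L_def)
  moreover have "fdet n (\<lambda>i j. f j (\<mu> i)) = fdet n (\<lambda>i j. \<Sum>k=1..n. L i k * divdiff R \<mu> k (f j))"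
  proof (rule fdet_cong)
    fix i j assume ij: "i \<in> {1..n}" "j \<in> {1..n}"
    have "f j (\<mu> i) = (\<Sum>k=1..i. (\<Prod>m=1..<k. \<mu> i - \<mu> m) * divdiff R \<mu> k (f j))"
      using ij by (intro divdiff_newton f encloses_mono[OF e]) auto
    also have "\<dots> = (\<Sum>k=1..i. L i k * divdiff R \<mu> k (f j))"
      by (intro sum.cong) (auto simp: L_def)
    also have "\<dots> = (\<Sum>k=1..n. L i k * divdiff R \<mu> k (f j))"
      using ij by (intro sum.mono_neutral_left) (auto simp: L_def)
    finally show "f j (\<mu> i) = (\<Sum>k=1..n. L i k * divdiff R \<mu> k (f j))" .
  qed
  ultimately show ?thesis
    using fdet_mult[of n L "\<lambda>k j. divdiff R \<mu> k (f j)"] by simp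
qed

text \<open>
  Splitting the last factor of the product as \<open>(z - \<mu>\<^sub>j) + (\<mu>\<^sub>j - \<rho>\<^sub>m)\<close> lowers the degree, and in the
  first summand also the order, down to the divided differences of the constant \<open>1\<close>.
\<close>
lemma divdiff_monic:
  assumes "encloses R \<mu> j" "1 \<le> b" "b \<le> j"
  shows "divdiff R \<mu> j (\<lambda>z. \<Prod>m=1..<b. z - \<rho> m) = (if j = b then 1 else 0)"
  using assms(2,1,3)
proof (induction b arbitrary: j rule: nat_induct_at_least)
  case base
  show ?case
  proof (cases "j = 1")
    case True
    then show ?thesis using base divdiff_first[of R \<mu> "\<lambda>z. 1"] by simp
  next
    case False
    then show ?thesis using base divdiff_one[of R \<mu> j] by simp
  qed
next
  case (Suc b)
  let ?p = "\<lambda>z. \<Prod>m=1..<b. z - \<rho> m"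
  have c: "continuous_on UNIV ?p" by (intro continuous_intros)
  have e: "encloses R \<mu> (j - 1)" using encloses_mono[OF Suc.prems(1)] by simp
  have "(\<lambda>z. \<Prod>m=1..<Suc b. z - \<rho> m) = (\<lambda>z. (z - \<mu> j) * ?p z + (\<mu> j - \<rho> b) * ?p z)"
    using Suc.hyps by (auto simp: fun_eq_iff algebra_simps)
  then have "divdiff R \<mu> j (\<lambda>z. \<Prod>m=1..<Suc b. z - \<rho> m)
      = divdiff R \<mu> j (\<lambda>z. (z - \<mu> j) * ?p z) + divdiff R \<mu> j (\<lambda>z. (\<mu> j - \<rho> b) * ?p z)"
    by (simp only:) (intro divdiff_add Suc.prems continuous_intros)
  also have "\<dots> = divdiff R \<mu> (j - 1) ?p + (\<mu> j - \<rho> b) * divdiff R \<mu> j ?p"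
    using Suc.prems Suc.hyps divdiff_factor[of R \<mu> j ?p] divdiff_cmult[OF Suc.prems(1) c] by simp
  also have "\<dots> = (if j = Suc b then 1 else 0)"
    using Suc.IH[OF e] Suc.IH[OF Suc.prems(1)] Suc.prems by auto
  finally show ?case .
qed

text \<open>
  Multiplication by this matrix from the right reverses the order of the columns.
\<close>
definition antidiagonal :: "nat \<Rightarrow> nat \<Rightarrow> nat \<Rightarrow> complex" where
  "antidiagonal n i j = (if i + j = Suc n then 1 else 0)"

text \<open>
  The product with index \<open>a\<close> has degree \<open>n - a\<close>, so the columns form a monic basis in descending
  order. These partial products are what cancels the factors with \<open>r > a + 1\<close> in the denominators of
  the integrand.
\<close>
lemma fdet_monic_basis:
  "fdet n (\<lambda>i a. \<Prod>m=a+2..n+1. \<mu> i - \<nu> m) = vandermonde n \<mu> * fdet n (antidiagonal n)"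
proof -
  obtain R where e: "encloses R \<mu> n" using encloses_exists by blast
  define \<rho> where "\<rho> = (\<lambda>m. \<nu> (n + 2 - m))"
  define p where "p = (\<lambda>b z. \<Prod>m=1..<b. z - \<rho> m)"
  have hol: "p b holomorphic_on UNIV" for b unfolding p_def by (intro holomorphic_intros)
  have "fdet n (\<lambda>i b. divdiff R \<mu> i (p b)) = (\<Prod>i=1..n. divdiff R \<mu> i (p i))"
    unfolding p_def by (rule fdet_upper_triangular) (auto simp: divdiff_monic[OF encloses_mono[OF e]] simp del: One_nat_def)
  also have "\<dots> = 1"
    unfolding p_def by (rule prod.neutral) (auto simp: divdiff_monic[OF encloses_mono[OF e]] simp del: One_nat_def)
  finally have 1: "fdet n (\<lambda>i b. p b (\<mu> i)) = vandermonde n \<mu>"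
    using vandermonde_mult_divdiff[OF e, of p] hol by simp
  have "fdet n (\<lambda>i a. \<Prod>m=a+2..n+1. \<mu> i - \<nu> m) = fdet n (\<lambda>i a. \<Sum>b=1..n. p b (\<mu> i) * antidiagonal n b a)"
  proof (rule fdet_cong)
    fix i a assume a: "a \<in> {1..n}"
    have "(\<Sum>b=1..n. p b (\<mu> i) * antidiagonal n b a) = (\<Sum>b=1..n. if b = Suc n - a then p b (\<mu> i) else 0)"
      using a by (intro sum.cong) (auto simp: antidiagonal_def)
    also have "\<dots> = p (Suc n - a) (\<mu> i)" using a by (subst sum.delta) auto
    also have "\<dots> = (\<Prod>m=a+2..n+1. \<mu> i - \<nu> m)"
      unfolding p_def \<rho>_def using a
      by (intro prod.reindex_bij_witness[of _ "\<lambda>m. n + 2 - m" "\<lambda>m. n + 2 - m"]) auto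
    finally show "(\<Prod>m=a+2..n+1. \<mu> i - \<nu> m) = (\<Sum>b=1..n. p b (\<mu> i) * antidiagonal n b a)" ..
  qed
  also have "\<dots> = vandermonde n \<mu> * fdet n (antidiagonal n)"
    using fdet_mult[of n "\<lambda>i b. p b (\<mu> i)" "antidiagonal n"] by (simp add: 1)
  finally show ?thesis .
qed

lemma fdet_divdiff_mult:
  assumes e: "encloses R \<nu> n" and h: "h holomorphic_on UNIV"
    and f: "\<And>j. j \<in> {1..n} \<Longrightarrow> f j holomorphic_on UNIV"
  shows "fdet n (\<lambda>i j. divdiff R \<nu> i (\<lambda>z. h z * f j z)) = (\<Prod>i=1..n. h (\<nu> i)) * fdet n (\<lambda>i j. divdiff R \<nu> i (f j))"
proof -
  have "\<forall>i. \<exists>H. \<forall>f. f holomorphic_on UNIV \<longrightarrow> encloses R \<nu> i \<longrightarrow> 1 \<le> i \<longrightarrow>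
     divdiff R \<nu> i (\<lambda>z. h z * f z) = h (\<nu> i) * divdiff R \<nu> i f + (\<Sum>k=1..<i. H k * divdiff R \<nu> k f)"
    using divdiff_mult_triangular[OF h] by blast
  then obtain H where H: "\<And>i f. f holomorphic_on UNIV \<Longrightarrow> encloses R \<nu> i \<Longrightarrow> 1 \<le> i \<Longrightarrow>
     divdiff R \<nu> i (\<lambda>z. h z * f z) = h (\<nu> i) * divdiff R \<nu> i f + (\<Sum>k=1..<i. H i k * divdiff R \<nu> k f)"
    by metis
  define L where "L = (\<lambda>i k. if k < i then H i k else if k = i then h (\<nu> i) else 0)"
  have "fdet n (\<lambda>i j. divdiff R \<nu> i (\<lambda>z. h z * f j z)) = fdet n (\<lambda>i j. \<Sum>k=1..n. L i k * divdiff R \<nu> k (f j))"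
  proof (rule fdet_cong)
    fix i j assume ij: "i \<in> {1..n}" "j \<in> {1..n}"
    have "(\<Sum>k=1..n. L i k * divdiff R \<nu> k (f j)) = (\<Sum>k=1..i. L i k * divdiff R \<nu> k (f j))"
      using ij by (intro sum.mono_neutral_right) (auto simp: L_def)
    also have "\<dots> = L i i * divdiff R \<nu> i (f j) + (\<Sum>k=1..<i. L i k * divdiff R \<nu> k (f j))"
      using ij by (simp add: sum.last_plus)
    also have "(\<Sum>k=1..<i. L i k * divdiff R \<nu> k (f j)) = (\<Sum>k=1..<i. H i k * divdiff R \<nu> k (f j))"
      by (intro sum.cong) (auto simp: L_def)
    also have "L i i * divdiff R \<nu> i (f j) + \<dots> = divdiff R \<nu> i (\<lambda>z. h z * f j z)"
      using H[OF f[OF ij(2)] encloses_mono[OF e]] ij by (simp add: L_def)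
    finally show "divdiff R \<nu> i (\<lambda>z. h z * f j z) = (\<Sum>k=1..n. L i k * divdiff R \<nu> k (f j))" ..
  qed
  also have "\<dots> = fdet n L * fdet n (\<lambda>i j. divdiff R \<nu> i (f j))" by (rule fdet_mult)
  also have "fdet n L = (\<Prod>i=1..n. h (\<nu> i))"
    by (subst fdet_lower_triangular) (auto simp: L_def)
  finally show ?thesis .
qed

text \<open>
  Pulling the factor \<open>exp(\<i> z x\<^bsub>n+1\<^esub>)\<close> out of all columns leaves the constant function
  \<open>1\<close> in the last column.
\<close>
lemma fdet_divdiff_exp_translate:
  assumes e: "encloses R \<nu> (Suc n)"
  shows "fdet (Suc n) (\<lambda>i k. divdiff R \<nu> i (\<lambda>z. exp (\<i> * z * of_real (x k))))
     = exp (\<i> * (\<Sum>r=1..Suc n. \<nu> r) * of_real (x (Suc n))) * (- 1) ^ n *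
       fdet n (\<lambda>i k. divdiff R \<nu> (Suc i) (\<lambda>z. exp (\<i> * z * of_real (x k - x (Suc n)))))"
proof -
  let ?h = "\<lambda>z. exp (\<i> * z * of_real (x (Suc n)))"
  let ?f = "\<lambda>k z. exp (\<i> * z * of_real (x k - x (Suc n)))"
  have "(\<lambda>z. exp (\<i> * z * of_real (x k))) = (\<lambda>z. ?h z * ?f k z)" for k
    by (simp add: fun_eq_iff exp_add[symmetric] algebra_simps)
  then have "fdet (Suc n) (\<lambda>i k. divdiff R \<nu> i (\<lambda>z. exp (\<i> * z * of_real (x k))))
     = (\<Prod>i=1..Suc n. ?h (\<nu> i)) * fdet (Suc n) (\<lambda>i k. divdiff R \<nu> i (?f k))"
    by (simp only:) (intro fdet_divdiff_mult e holomorphic_intros)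
  also have "(\<Prod>i=1..Suc n. ?h (\<nu> i)) = exp (\<i> * (\<Sum>r=1..Suc n. \<nu> r) * of_real (x (Suc n)))"
    by (simp add: exp_sum[symmetric] sum_distrib_left sum_distrib_right del: sum.cl_ivl_Suc prod.cl_ivl_Suc)
  also have "fdet (Suc n) (\<lambda>i k. divdiff R \<nu> i (?f k)) = (- 1) ^ n * fdet n (\<lambda>i k. divdiff R \<nu> (Suc i) (?f k))"
  proof (rule fdet_last_column_unit)
    fix i assume i: "i \<in> {1..Suc n}"
    show "divdiff R \<nu> i (?f (Suc n)) = (if i = 1 then 1 else 0)"
      using i divdiff_monic[OF encloses_mono[OF e], of i 1] by simp
  qed
  finally show ?thesis by (simp add: mult.assoc)
qed

text \<open>
  Continuity in the nodes is what extends identities from distinct to coinciding nodes.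
\<close>
lemma divdiff_continuous_nodes:
  fixes N :: "real \<Rightarrow> nat \<Rightarrow> complex"
  assumes e: "\<And>s. s \<in> U \<Longrightarrow> encloses R (N s) j" and N: "\<And>r. continuous_on U (\<lambda>s. N s r)"
    and f: "continuous_on UNIV f"
  shows "continuous_on U (\<lambda>s. divdiff R (N s) j f)"
proof -
  have nz: "of_real R * cis t \<noteq> N s r" if "s \<in> U" "r \<in> {1..j}" for s t r
    using e[OF that(1)] that(2) by (metis encloses_def less_irrefl mult.right_neutral norm_cis norm_mult norm_of_real abs_of_pos)
  have "continuous_on (U \<times> cbox 0 (2 * pi)) (\<lambda>(s, t). f (0 + of_real R * cis t) / (\<Prod>r=1..j. (0 + of_real R * cis t) - N s r) * of_real R * \<i> * cis t)"
    unfolding case_prod_unfold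
    by (intro continuous_intros continuous_on_compose2[OF f] continuous_on_compose2[OF N]) (auto simp: nz)
  from integral_continuous_on_param[OF this]
  show ?thesis
    unfolding divdiff_def circlepath_def
    by (subst contour_integral_part_circlepath_eq) (auto intro!: continuous_intros simp: mult_ac)
qed

lemma permutes_shift_Suc:
  assumes "\<sigma> permutes {0..<n::nat}"
  obtains \<tau> where "\<tau> permutes {1..n}" "\<And>k. k < n \<Longrightarrow> \<tau> (Suc k) = Suc (\<sigma> k)"
proof
  let ?\<tau> = "\<lambda>k. case k of 0 \<Rightarrow> 0 | Suc i \<Rightarrow> Suc (\<sigma> i)"
  show "?\<tau> permutes {1..n}"
  proof (rule bij_imp_permutes)
    show "bij_betw ?\<tau> {1..n} {1..n}"
    proof (rule bij_betwI[where g = "\<lambda>k. case k of 0 \<Rightarrow> 0 | Suc i \<Rightarrow> Suc (inv_into UNIV \<sigma> i)"])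
      show "?\<tau> \<in> {1..n} \<rightarrow> {1..n}"
        using permutes_in_image[OF assms] by (force split: nat.splits simp: less_eq_Suc_le[symmetric])
      show "(\<lambda>k. case k of 0 \<Rightarrow> 0 | Suc i \<Rightarrow> Suc (inv_into UNIV \<sigma> i)) \<in> {1..n} \<rightarrow> {1..n}"
        using permutes_in_image[OF permutes_inv[OF assms]] by (force split: nat.splits simp: less_eq_Suc_le[symmetric])
    qed (use permutes_inverses[OF assms] in \<open>auto split: nat.splits\<close>)
    show "?\<tau> k = k" if "k \<notin> {1..n}" for k
      using that permutes_not_in[OF assms] by (auto split: nat.splits)
  qed
qed auto

text \<open>
  For distinct nodes the determinants may be replaced by determinants of values at the nodes; in
  the expansion over permutations \<open>\<sigma>\<close> the weighted sum is then evaluated at a permutation of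
  the \<open>h(\<nu>\<^sub>k)\<close>, which by symmetry gives the same scalar for each \<open>\<sigma>\<close>.
\<close>
lemma fdet_divdiff_symmetric:
  fixes w :: "'m \<Rightarrow> complex" and m :: "'m \<Rightarrow> nat \<Rightarrow> nat"
  assumes fin: "finite S" and n: "encloses R \<nu> n"
    and sym: "\<And>\<tau> v. \<tau> permutes {1..n} \<Longrightarrow>
       (\<Sum>a\<in>S. w a * (\<Prod>k=1..n. v (\<tau> k) ^ m a k)) = (\<Sum>a\<in>S. w a * (\<Prod>k=1..n. v k ^ m a k :: complex))"
    and h: "h holomorphic_on UNIV" and f: "\<And>k. f k holomorphic_on UNIV"
  shows "(\<Sum>a\<in>S. w a * fdet n (\<lambda>i k. divdiff R \<nu> i (\<lambda>z. h z ^ m a k * f k z)))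
      = (\<Sum>a\<in>S. w a * (\<Prod>k=1..n. h (\<nu> k) ^ m a k)) * fdet n (\<lambda>i k. divdiff R \<nu> i (f k))"
proof -
  define lhs where "lhs = (\<lambda>\<nu>. \<Sum>a\<in>S. w a * fdet n (\<lambda>i k. divdiff R \<nu> i (\<lambda>z. h z ^ m a k * f k z)))"
  define rhs where "rhs = (\<lambda>\<nu>. (\<Sum>a\<in>S. w a * (\<Prod>k=1..n. h (\<nu> k) ^ m a k)) * fdet n (\<lambda>i k. divdiff R \<nu> i (f k)))"
  have hf: "(\<lambda>z. h z ^ a * f k z) holomorphic_on UNIV" for a k
    by (intro holomorphic_intros h f)
  have distinct: "lhs \<rho> = rhs \<rho>" if e: "encloses R \<rho> n" and inj: "inj_on \<rho> {1..n}" for \<rho>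
  proof -
    have "vandermonde n \<rho> * lhs \<rho> = (\<Sum>a\<in>S. w a * fdet n (\<lambda>i k. h (\<rho> i) ^ m a k * f k (\<rho> i)))"
      using vandermonde_mult_divdiff[OF e hf]
      by (simp add: lhs_def sum_distrib_left mult.left_commute[of "vandermonde n \<rho>"])
    also have "\<dots> = (\<Sum>\<sigma> | \<sigma> permutes {0..<n}. of_int (sign \<sigma>) * (\<Prod>k<n. f (Suc k) (\<rho> (Suc (\<sigma> k)))) *
        (\<Sum>a\<in>S. w a * (\<Prod>k<n. h (\<rho> (Suc (\<sigma> k))) ^ m a (Suc k))))"
      unfolding fdet_sum sum_distrib_left
      by (subst sum.swap) (simp add: prod.distrib mult_ac)
    also have "\<dots> = (\<Sum>\<sigma> | \<sigma> permutes {0..<n}. of_int (sign \<sigma>) * (\<Prod>k<n. f (Suc k) (\<rho> (Suc (\<sigma> k)))) *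
        (\<Sum>a\<in>S. w a * (\<Prod>k=1..n. h (\<rho> k) ^ m a k)))"
    proof (rule sum.cong[OF refl], rule arg_cong2[where f = "(*)", OF refl])
      fix \<sigma> assume "\<sigma> \<in> {\<sigma>. \<sigma> permutes {0..<n}}"
      then obtain \<tau> where \<tau>: "\<tau> permutes {1..n}" "\<And>k. k < n \<Longrightarrow> \<tau> (Suc k) = Suc (\<sigma> k)"
        using permutes_shift_Suc by blast
      have "(\<Sum>a\<in>S. w a * (\<Prod>k<n. h (\<rho> (Suc (\<sigma> k))) ^ m a (Suc k))) = (\<Sum>a\<in>S. w a * (\<Prod>k=1..n. h (\<rho> (\<tau> k)) ^ m a k))"
        by (simp add: prod.atLeast1_atMost_eq \<tau>(2))
      then show "(\<Sum>a\<in>S. w a * (\<Prod>k<n. h (\<rho> (Suc (\<sigma> k))) ^ m a (Suc k))) = (\<Sum>a\<in>S. w a * (\<Prod>k=1..n. h (\<rho> k) ^ m a k))"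
        using sym[OF \<tau>(1), of "\<lambda>k. h (\<rho> k)"] by simp
    qed
    also have "\<dots> = (\<Sum>a\<in>S. w a * (\<Prod>k=1..n. h (\<rho> k) ^ m a k)) * fdet n (\<lambda>i k. f k (\<rho> i))"
      unfolding fdet_sum by (simp add: sum_distrib_right sum_distrib_left mult_ac)
    also have "\<dots> = vandermonde n \<rho> * rhs \<rho>"
      using vandermonde_mult_divdiff[OF e f] by (simp add: rhs_def)
    finally show ?thesis using vandermonde_nonzero[OF inj] by simp
  qed
  \<comment> \<open>Coinciding nodes are the limit of the distinct nodes \<open>\<nu> r + s r\<close>.\<close>
  define N where "N = (\<lambda>s r. \<nu> r + of_real (s * real r))"
  have Nlim: "((\<lambda>s. N s r) \<longlongrightarrow> \<nu> r) (at 0)" for r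
    unfolding N_def by (auto intro!: tendsto_eq_intros)
  have Ncont: "continuous_on A (\<lambda>s. N s r)" for A r
    unfolding N_def by (intro continuous_intros)
  have R: "0 < R" using n by (simp add: encloses_def)
  define M where "M = Max ((\<lambda>r. cmod (\<nu> r)) ` {1..n})"
  define \<delta> where "\<delta> = (if n = 0 then 1 else (R - M) / (2 * real n))"
  have \<delta>: "0 < \<delta>" "\<And>s. s \<in> {- \<delta>..\<delta>} \<Longrightarrow> encloses R (N s) n"
  proof -
    have M: "M < R" if "n \<noteq> 0"
      unfolding M_def using that n by (subst Max_less_iff) (auto simp: encloses_def)
    then show "0 < \<delta>" by (simp add: \<delta>_def)
    fix s assume s: "s \<in> {- \<delta>..\<delta>}"
    have "cmod (N s r) < R" if r: "r \<in> {1..n}" for r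
    proof -
      have n0: "n \<noteq> 0" using r by auto
      have "\<bar>s * real r\<bar> \<le> \<delta> * real n" using s r by (auto simp: abs_mult intro!: mult_mono)
      also have "\<dots> < R - M"
        using n0 M[OF n0] by (simp add: \<delta>_def)
      also have "\<dots> \<le> R - cmod (\<nu> r)" unfolding M_def using r by (intro diff_left_mono Max_ge) auto
      finally have "\<bar>s * real r\<bar> < R - cmod (\<nu> r)" .
      then show ?thesis unfolding N_def
        using norm_triangle_ineq[of "\<nu> r" "of_real (s * real r)"] by (simp only: norm_of_real)
    qed
    then show "encloses R (N s) n" using R by (simp add: encloses_def)
  qed
  have cd: "continuous_on {- \<delta>..\<delta>} (\<lambda>s. divdiff R (N s) i g)" if "i \<le> n" "g holomorphic_on UNIV" for i g
    using that \<delta>(2) encloses_mono holomorphic_on_imp_continuous_on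
    by (intro divdiff_continuous_nodes Ncont) blast+
  have cdet: "continuous_on {- \<delta>..\<delta>} (\<lambda>s. fdet n (\<lambda>i k. divdiff R (N s) i (g k)))"
    if "\<And>k. g k holomorphic_on UNIV" for g
    unfolding fdet_sum
  proof (intro continuous_intros cd that)
    fix \<sigma> j assume "\<sigma> \<in> {\<sigma>. \<sigma> permutes {0..<n}}" "j \<in> {..<n}"
    then show "Suc (\<sigma> j) \<le> n" using permutes_in_image[of \<sigma> "{0..<n}" j] by (simp add: Suc_le_eq)
  qed
  have ch: "continuous_on {- \<delta>..\<delta>} (\<lambda>s. h (N s r))" for r
    using holomorphic_on_imp_continuous_on[OF h] by (rule continuous_on_compose2) (auto intro: Ncont)
  have "continuous_on {- \<delta>..\<delta>} (\<lambda>s. lhs (N s) - rhs (N s))"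
    unfolding lhs_def rhs_def by (intro continuous_intros cdet ch hf f)
  then have "((\<lambda>s. lhs (N s) - rhs (N s)) \<longlongrightarrow> lhs (N 0) - rhs (N 0)) (at 0)"
    using \<delta>(1) by (auto simp: continuous_on_def at_within_Icc_at dest!: bspec[of _ _ 0])
  moreover have "eventually (\<lambda>s. lhs (N s) - rhs (N s) = 0) (at 0)"
  proof -
    have "eventually (\<lambda>s. \<forall>r\<in>{1..n}. \<forall>q\<in>{1..n}. r \<noteq> q \<longrightarrow> N s r \<noteq> N s q) (at 0)"
    proof (intro eventually_ball_finite ballI finite_atLeastAtMost)
      fix r q
      show "eventually (\<lambda>s. r \<noteq> q \<longrightarrow> N s r \<noteq> N s q) (at 0)"
      proof (cases "\<nu> r = \<nu> q")
        case True
        have "eventually (\<lambda>s::real. s \<noteq> 0) (at 0)" by (simp add: eventually_at_filter)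
        then show ?thesis by eventually_elim (use True in \<open>auto simp: N_def\<close>)
      next
        case False
        have "((\<lambda>s. N s r - N s q) \<longlongrightarrow> \<nu> r - \<nu> q) (at 0)" by (intro tendsto_diff Nlim)
        then have "eventually (\<lambda>s. N s r - N s q \<noteq> 0) (at 0)"
          by (rule tendsto_imp_eventually_ne) (use False in simp)
        then show ?thesis by eventually_elim simp
      qed
    qed
    moreover have "eventually (\<lambda>s. s \<in> {- \<delta>..\<delta>}) (at 0)"
      using \<delta>(1) eventually_at_in_open'[of "{- \<delta><..<\<delta>}" "0::real"]
      by (auto elim!: eventually_mono)
    ultimately show ?thesis
    proof eventually_elim
      case (elim s)
      have "inj_on (N s) {1..n}" unfolding inj_on_def using elim(1) by blast
      from distinct[OF \<delta>(2)[OF elim(2)] this] show ?case by simp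
    qed
  qed
  ultimately have "lhs (N 0) - rhs (N 0) = 0"
    using tendsto_unique[OF _ _ tendsto_eventually] trivial_limit_at by metis
  moreover have "N 0 = \<nu>" by (simp add: N_def)
  ultimately show ?thesis by (simp add: lhs_def rhs_def)
qed

section \<open>A pointwise bound for the interlacing kernel\<close>

text \<open>
  Each unordered pair occurs twice, as in the squared Vandermonde product of the integrand.
\<close>
definition offdiag :: "'a set \<Rightarrow> ('a \<times> 'a) set" where
  "offdiag A = {(s, p). s \<in> A \<and> p \<in> A \<and> s \<noteq> p}"

lemma prod_offdiag_insert:
  assumes "finite A" "a \<notin> A"
  shows "(\<Prod>(s, p)\<in>offdiag (insert a A). g s p) = (\<Prod>(s, p)\<in>offdiag A. g s p) * (\<Prod>k\<in>A. g a k * (g k a :: 'b :: comm_monoid_mult))"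
proof -
  have eq: "offdiag (insert a A) = offdiag A \<union> (Pair a ` A \<union> (\<lambda>k. (k, a)) ` A)"
    using assms by (auto simp: offdiag_def)
  have fin: "finite (offdiag A)"
    by (rule finite_subset[of _ "A \<times> A"]) (use assms in \<open>auto simp: offdiag_def\<close>)
  have "(\<Prod>(s, p)\<in>Pair a ` A \<union> (\<lambda>k. (k, a)) ` A. g s p) = (\<Prod>(s, p)\<in>Pair a ` A. g s p) * (\<Prod>(s, p)\<in>(\<lambda>k. (k, a)) ` A. g s p)"
    using assms by (intro prod.union_disjoint) auto
  also have "\<dots> = (\<Prod>k\<in>A. g a k) * (\<Prod>k\<in>A. g k a)"
    by (subst (1 2) prod.reindex) (auto simp: inj_on_def)
  finally show ?thesis
    unfolding eq using assms fin
    by (subst prod.union_disjoint) (auto simp: offdiag_def prod.distrib)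
qed

lemma prod_offdiag_vandermonde:
  "(\<Prod>(s, p)\<in>offdiag {1..n}. \<mu> s - \<mu> p) = (\<Prod>k=1..n. (- 1) ^ (k - 1)) * vandermonde n \<mu> ^ 2"
proof (induction n)
  case 0
  then show ?case by (simp add: offdiag_def vandermonde_def)
next
  case (Suc n)
  have "(\<Prod>(s, p)\<in>offdiag {1..Suc n}. \<mu> s - \<mu> p)
      = (\<Prod>(s, p)\<in>offdiag {1..n}. \<mu> s - \<mu> p) * (\<Prod>k\<in>{1..n}. (\<mu> (Suc n) - \<mu> k) * (\<mu> k - \<mu> (Suc n)))"
    using prod_offdiag_insert[of "{1..n}" "Suc n" "\<lambda>s p. \<mu> s - \<mu> p"] by (simp add: atLeastAtMostSuc_conv)
  also have "(\<Prod>k\<in>{1..n}. (\<mu> (Suc n) - \<mu> k) * (\<mu> k - \<mu> (Suc n))) = (\<Prod>k\<in>{1..n}. (- 1) * (\<mu> (Suc n) - \<mu> k) ^ 2)"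
    by (intro prod.cong refl) (simp add: power2_eq_square algebra_simps)
  also have "\<dots> = (- 1) ^ n * (\<Prod>k\<in>{1..n}. \<mu> (Suc n) - \<mu> k) ^ 2"
    by (simp only: prod.distrib prod_power_distrib prod_constant card_atLeastAtMost) simp
  finally show ?case
    unfolding Suc.IH by (simp add: vandermonde_def power_mult_distrib atLeastLessThanSuc_atLeastAtMost mult_ac)
qed

lemma norm_prod_offdiag:
  "cmod (\<Prod>(s, p)\<in>offdiag {1..n}. \<mu> s - \<mu> p) = cmod (vandermonde n \<mu>) ^ 2"
  unfolding prod_offdiag_vandermonde
  by (simp add: norm_mult norm_power prod_norm[symmetric])

text \<open>
  An inequality form of Cauchy's determinant \<open>det (1 / (u\<^sub>a - v\<^sub>b))\<close>. Matching a closest pair \<open>(a, b)\<close>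
  first, every remaining \<open>u\<^sub>k\<close> satisfies \<open>\<bar>u\<^sub>k - u\<^sub>a\<bar> \<le> 2 \<bar>u\<^sub>k - v\<^sub>b\<bar>\<close>, and likewise for the
  remaining \<open>v\<^sub>k\<close>; so all factors that involve \<open>a\<close> or \<open>b\<close> cancel except \<open>1 / \<bar>u\<^sub>a - v\<^sub>b\<bar>\<close>. Squares
  appear because the products run over ordered pairs.
\<close>
lemma greedy_matching:
  "\<exists>K>0. \<forall>(A :: 'a set) (B :: 'b set) (u :: 'a \<Rightarrow> complex) v.
     finite A \<longrightarrow> finite B \<longrightarrow> card A = m \<longrightarrow> card B = m \<longrightarrow>
     (\<exists>\<sigma>. bij_betw \<sigma> A B \<and>
       (\<Prod>(s, p)\<in>offdiag A. cmod (u s - u p)) * (\<Prod>(s, p)\<in>offdiag B. cmod (v s - v p)) *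
       (\<Prod>a\<in>A. cmod (u a - v (\<sigma> a))) ^ 2 \<le> K * (\<Prod>a\<in>A. \<Prod>b\<in>B. cmod (u a - v b)) ^ 2)"
proof (induction m)
  case 0
  show ?case by (intro exI[of _ "1::real"]) (auto simp: offdiag_def bij_betw_def)
next
  case (Suc m)
  then obtain K :: real where K: "0 < K" and IH: "\<And>(A :: 'a set) (B :: 'b set) (u :: 'a \<Rightarrow> complex) v.
     finite A \<Longrightarrow> finite B \<Longrightarrow> card A = m \<Longrightarrow> card B = m \<Longrightarrow>
     (\<exists>\<sigma>. bij_betw \<sigma> A B \<and>
       (\<Prod>(s, p)\<in>offdiag A. cmod (u s - u p)) * (\<Prod>(s, p)\<in>offdiag B. cmod (v s - v p)) *
       (\<Prod>a\<in>A. cmod (u a - v (\<sigma> a))) ^ 2 \<le> K * (\<Prod>a\<in>A. \<Prod>b\<in>B. cmod (u a - v b)) ^ 2)"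
    by blast
  show ?case
  proof (intro exI[of _ "K * 16 ^ m"] conjI allI impI)
    show "0 < K * 16 ^ m" using K by simp
    fix A :: "'a set" and B :: "'b set" and u :: "'a \<Rightarrow> complex" and v
    assume fin: "finite A" "finite B" and card: "card A = Suc m" "card B = Suc m"
    then have AB: "finite (A \<times> B)" "A \<times> B \<noteq> {}" by auto
    define ab where "ab = arg_min_on (\<lambda>x. cmod (u (fst x) - v (snd x))) (A \<times> B)"
    have ab: "ab \<in> A \<times> B" unfolding ab_def by (rule arg_min_if_finite(1)[OF AB])
    have min: "cmod (u (fst ab) - v (snd ab)) \<le> cmod (u (fst x) - v (snd x))" if "x \<in> A \<times> B" for x
      using arg_min_if_finite(2)[OF AB, of "\<lambda>x. cmod (u (fst x) - v (snd x))"] that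
      unfolding ab_def[symmetric] by (meson not_le)
    define a b where "a = fst ab" and "b = snd ab"
    define A' B' where "A' = A - {a}" and "B' = B - {b}"
    have A: "A = insert a A'" "a \<notin> A'" "finite A'" "card A' = m"
      and B: "B = insert b B'" "b \<notin> B'" "finite B'" "card B' = m"
      using ab fin card by (auto simp: a_def b_def A'_def B'_def)
    have close: "cmod (u a - v b) \<le> cmod (u x - v y)" if "x \<in> A" "y \<in> B" for x y
      using min[of "(x, y)"] that by (simp add: a_def b_def)
    obtain \<sigma> where \<sigma>: "bij_betw \<sigma> A' B'" and IH': "(\<Prod>(s, p)\<in>offdiag A'. cmod (u s - u p)) * (\<Prod>(s, p)\<in>offdiag B'. cmod (v s - v p)) *
       (\<Prod>a\<in>A'. cmod (u a - v (\<sigma> a))) ^ 2 \<le> K * (\<Prod>a\<in>A'. \<Prod>b\<in>B'. cmod (u a - v b)) ^ 2"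
      using IH[OF A(3) B(3) A(4) B(4), of u v] by blast
    define \<tau> where "\<tau> = \<sigma>(a := b)"
    have "bij_betw \<tau> A' B'" using \<sigma> A(2) by (subst bij_betw_cong[of _ _ \<sigma>]) (auto simp: \<tau>_def)
    then have bij: "bij_betw \<tau> A B"
      using A B notIn_Un_bij_betw[of a A' \<tau> B'] by (simp add: \<tau>_def)
    define p q where "p = (\<Prod>k\<in>A'. cmod (u k - v b))" and "q = (\<Prod>k\<in>B'. cmod (u a - v k))"
    have VA: "(\<Prod>(s, p)\<in>offdiag A. cmod (u s - u p)) \<le> (\<Prod>(s, p)\<in>offdiag A'. cmod (u s - u p)) * (4 ^ m * p ^ 2)"
    proof -
      have "(\<Prod>k\<in>A'. cmod (u a - u k) * cmod (u k - u a)) \<le> (\<Prod>k\<in>A'. 4 * cmod (u k - v b) ^ 2)"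
      proof (rule prod_mono, intro conjI)
        fix k assume k: "k \<in> A'"
        have "cmod (u k - u a) \<le> cmod (u k - v b) + cmod (u a - v b)"
          using norm_triangle_ineq4[of "u k - v b" "u a - v b"] by simp
        also have "\<dots> \<le> 2 * cmod (u k - v b)" using close[of k b] k A B by simp
        finally have "cmod (u k - u a) ^ 2 \<le> (2 * cmod (u k - v b)) ^ 2" by (intro power_mono) auto
        then show "cmod (u a - u k) * cmod (u k - u a) \<le> 4 * cmod (u k - v b) ^ 2"
          by (simp add: norm_minus_commute power2_eq_square)
      qed auto
      also have "\<dots> = 4 ^ m * p ^ 2" by (simp add: prod.distrib p_def prod_power_distrib A(4))
      finally show ?thesis
        unfolding A(1) using A(2,3)
        by (subst prod_offdiag_insert) (auto intro!: mult_left_mono prod_nonneg)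
    qed
    have VB: "(\<Prod>(s, p)\<in>offdiag B. cmod (v s - v p)) \<le> (\<Prod>(s, p)\<in>offdiag B'. cmod (v s - v p)) * (4 ^ m * q ^ 2)"
    proof -
      have "(\<Prod>k\<in>B'. cmod (v b - v k) * cmod (v k - v b)) \<le> (\<Prod>k\<in>B'. 4 * cmod (u a - v k) ^ 2)"
      proof (rule prod_mono, intro conjI)
        fix k assume k: "k \<in> B'"
        have "cmod (v k - v b) \<le> cmod (u a - v b) + cmod (u a - v k)"
          using norm_triangle_ineq4[of "u a - v b" "u a - v k"] by simp
        also have "\<dots> \<le> 2 * cmod (u a - v k)" using close[of a k] k A B by simp
        finally have "cmod (v k - v b) ^ 2 \<le> (2 * cmod (u a - v k)) ^ 2" by (intro power_mono) auto
        then show "cmod (v b - v k) * cmod (v k - v b) \<le> 4 * cmod (u a - v k) ^ 2"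
          by (simp add: norm_minus_commute power2_eq_square)
      qed auto
      also have "\<dots> = 4 ^ m * q ^ 2" by (simp add: prod.distrib q_def prod_power_distrib B(4))
      finally show ?thesis
        unfolding B(1) using B(2,3)
        by (subst prod_offdiag_insert) (auto intro!: mult_left_mono prod_nonneg)
    qed
    have match: "(\<Prod>a\<in>A. cmod (u a - v (\<tau> a))) = cmod (u a - v b) * (\<Prod>a\<in>A'. cmod (u a - v (\<sigma> a)))"
      unfolding A(1) using A(2,3) by (auto simp: \<tau>_def intro!: prod.cong)
    have full: "(\<Prod>a\<in>A. \<Prod>b\<in>B. cmod (u a - v b)) = (\<Prod>a\<in>A'. \<Prod>b\<in>B'. cmod (u a - v b)) * (cmod (u a - v b) * p * q)"
      unfolding A(1) B(1) using A(2,3) B(2,3) by (simp add: prod.distrib p_def q_def mult_ac)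
    have nn: "0 \<le> (\<Prod>(s, p)\<in>offdiag S. cmod (f s - f p))" for S and f :: "'c \<Rightarrow> complex"
      by (intro prod_nonneg) auto
    have "(\<Prod>(s, p)\<in>offdiag A. cmod (u s - u p)) * (\<Prod>(s, p)\<in>offdiag B. cmod (v s - v p)) * (\<Prod>a\<in>A. cmod (u a - v (\<tau> a))) ^ 2
       \<le> ((\<Prod>(s, p)\<in>offdiag A'. cmod (u s - u p)) * (4 ^ m * p ^ 2)) *
         ((\<Prod>(s, p)\<in>offdiag B'. cmod (v s - v p)) * (4 ^ m * q ^ 2)) * (\<Prod>a\<in>A. cmod (u a - v (\<tau> a))) ^ 2"
      by (intro mult_right_mono mult_mono VA VB mult_nonneg_nonneg nn) (auto intro!: prod_nonneg)
    also have "\<dots> = ((\<Prod>(s, p)\<in>offdiag A'. cmod (u s - u p)) * (\<Prod>(s, p)\<in>offdiag B'. cmod (v s - v p)) *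
       (\<Prod>a\<in>A'. cmod (u a - v (\<sigma> a))) ^ 2) * ((4 ^ m * 4 ^ m) * (cmod (u a - v b) * p * q) ^ 2)"
      unfolding match by (simp add: power_mult_distrib mult_ac)
    also have "\<dots> \<le> (K * (\<Prod>a\<in>A'. \<Prod>b\<in>B'. cmod (u a - v b)) ^ 2) * ((4 ^ m * 4 ^ m) * (cmod (u a - v b) * p * q) ^ 2)"
      by (intro mult_right_mono IH') auto
    also have "\<dots> = K * 16 ^ m * (\<Prod>a\<in>A. \<Prod>b\<in>B. cmod (u a - v b)) ^ 2"
      unfolding full by (simp add: power_mult_distrib mult_ac flip: power_mult_distrib[of 4 4 m])
    finally have "(\<Prod>(s, p)\<in>offdiag A. cmod (u s - u p)) * (\<Prod>(s, p)\<in>offdiag B. cmod (v s - v p)) * (\<Prod>a\<in>A. cmod (u a - v (\<tau> a))) ^ 2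
       \<le> K * 16 ^ m * (\<Prod>a\<in>A. \<Prod>b\<in>B. cmod (u a - v b)) ^ 2" .
    with bij show "\<exists>\<sigma>. bij_betw \<sigma> A B \<and>
       (\<Prod>(s, p)\<in>offdiag A. cmod (u s - u p)) * (\<Prod>(s, p)\<in>offdiag B. cmod (v s - v p)) *
       (\<Prod>a\<in>A. cmod (u a - v (\<sigma> a))) ^ 2 \<le> K * 16 ^ m * (\<Prod>a\<in>A. \<Prod>b\<in>B. cmod (u a - v b)) ^ 2"
      by blast
  qed
qed

text \<open>
  The greedy matching is applied to \<open>\<mu>\<close> and the first \<open>n\<close> entries of \<open>\<nu>\<close>. The last entry acts as a
  pivot: it contributes \<open>\<Prod> \<bar>\<nu>\<^sub>q - \<nu>\<^bsub>n+1\<^esub>\<bar> / \<Prod> \<bar>\<mu>\<^sub>k - \<nu>\<^bsub>n+1\<^esub>\<bar>\<close>, and hence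
  quadratic decay in each \<open>\<mu>\<^sub>k\<close>.
\<close>
lemma interlacing_kernel_bound:
  "\<exists>K\<ge>0. \<forall>\<mu> \<nu>. (\<forall>k\<in>{1..n}. \<forall>q\<in>{1..Suc n}. \<mu> k \<noteq> \<nu> q) \<longrightarrow>
     cmod (vandermonde (Suc n) \<nu>) * cmod (vandermonde n \<mu>) / (\<Prod>k=1..n. \<Prod>q=1..Suc n. cmod (\<mu> k - \<nu> q))
     \<le> K * (\<Sum>\<sigma> | \<sigma> permutes {1..n}. \<Prod>k=1..n. cmod (\<nu> (\<sigma> k) - \<nu> (Suc n)) / (cmod (\<mu> k - \<nu> (\<sigma> k)) * cmod (\<mu> k - \<nu> (Suc n))))"
proof -
  obtain K :: real where K: "0 < K" and gm: "\<And>(A :: nat set) (B :: nat set) (u :: nat \<Rightarrow> complex) v.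
     finite A \<Longrightarrow> finite B \<Longrightarrow> card A = n \<Longrightarrow> card B = n \<Longrightarrow>
     (\<exists>\<sigma>. bij_betw \<sigma> A B \<and>
       (\<Prod>(s, p)\<in>offdiag A. cmod (u s - u p)) * (\<Prod>(s, p)\<in>offdiag B. cmod (v s - v p)) *
       (\<Prod>a\<in>A. cmod (u a - v (\<sigma> a))) ^ 2 \<le> K * (\<Prod>a\<in>A. \<Prod>b\<in>B. cmod (u a - v b)) ^ 2)"
    using greedy_matching[where 'a = nat and 'b = nat, of n] by blast
  show ?thesis
  proof (intro exI[of _ "sqrt K"] conjI allI impI)
    show "0 \<le> sqrt K" using K by simp
    fix \<mu> \<nu> :: "nat \<Rightarrow> complex"
    assume ne: "\<forall>k\<in>{1..n}. \<forall>q\<in>{1..Suc n}. \<mu> k \<noteq> \<nu> q"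
    obtain \<sigma> where \<sigma>: "bij_betw \<sigma> {1..n} {1..n}"
      and le: "(\<Prod>(s, p)\<in>offdiag {1..n}. cmod (\<mu> s - \<mu> p)) * (\<Prod>(s, p)\<in>offdiag {1..n}. cmod (\<nu> s - \<nu> p)) *
       (\<Prod>a\<in>{1..n}. cmod (\<mu> a - \<nu> (\<sigma> a))) ^ 2 \<le> K * (\<Prod>a\<in>{1..n}. \<Prod>b\<in>{1..n}. cmod (\<mu> a - \<nu> b)) ^ 2"
      using gm[of "{1..n}" "{1..n}" \<mu> \<nu>] by auto
    define \<tau> where "\<tau> = (\<lambda>k. if k \<in> {1..n} then \<sigma> k else k)"
    have \<tau>: "\<tau> permutes {1..n}"
    proof (rule bij_imp_permutes)
      show "bij_betw \<tau> {1..n} {1..n}"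
        using \<sigma> by (subst bij_betw_cong[of _ _ \<sigma>]) (auto simp: \<tau>_def)
    qed (auto simp: \<tau>_def)
    have \<tau>in: "\<tau> k \<in> {1..n}" if "k \<in> {1..n}" for k
      using permutes_in_image[OF \<tau>] that by blast
    have eq: "(\<Prod>a\<in>{1..n}. cmod (\<mu> a - \<nu> (\<sigma> a))) = (\<Prod>k=1..n. cmod (\<mu> k - \<nu> (\<tau> k)))"
      by (intro prod.cong) (auto simp: \<tau>_def)
    define P Q S where "P = (\<Prod>k=1..n. cmod (\<mu> k - \<nu> (\<tau> k)))" and "Q = (\<Prod>k=1..n. \<Prod>q=1..n. cmod (\<mu> k - \<nu> q))"
      and "S = (\<Prod>k=1..n. cmod (\<mu> k - \<nu> (Suc n)))"
    have pos: "0 < P" "0 < Q" "0 < S"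
      unfolding P_def Q_def S_def using ne \<tau>in by (force intro!: prod_pos)+
    have off: "(\<Prod>(s, p)\<in>offdiag {1..n}. cmod (f s - f p)) = cmod (vandermonde n f) ^ 2" for f
      using norm_prod_offdiag[of f n] by (simp add: prod_norm[symmetric] case_prod_unfold)
    have "(cmod (vandermonde n \<mu>) * cmod (vandermonde n \<nu>) * P) ^ 2 \<le> (sqrt K * Q) ^ 2"
      using le K unfolding off eq by (simp add: power_mult_distrib P_def Q_def)
    then have 1: "cmod (vandermonde n \<mu>) * cmod (vandermonde n \<nu>) * P \<le> sqrt K * Q"
      by (rule power2_le_imp_le) (use K pos in simp)
    have "cmod (vandermonde (Suc n) \<nu>) = cmod (vandermonde n \<nu>) * (\<Prod>q=1..n. cmod (\<nu> q - \<nu> (Suc n)))"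
      by (simp add: vandermonde_def norm_mult prod_norm[symmetric] atLeastLessThanSuc_atLeastAtMost norm_minus_commute)
    also have "(\<Prod>q=1..n. cmod (\<nu> q - \<nu> (Suc n))) = (\<Prod>k=1..n. cmod (\<nu> (\<tau> k) - \<nu> (Suc n)))"
      using prod.permute[OF \<tau>, of "\<lambda>q. cmod (\<nu> q - \<nu> (Suc n))"] by (simp add: o_def)
    finally have 2: "cmod (vandermonde (Suc n) \<nu>) = cmod (vandermonde n \<nu>) * (\<Prod>k=1..n. cmod (\<nu> (\<tau> k) - \<nu> (Suc n)))" .
    have 3: "(\<Prod>k=1..n. \<Prod>q=1..Suc n. cmod (\<mu> k - \<nu> q)) = Q * S"
      by (simp add: Q_def S_def prod.distrib)
    have 4: "cmod (vandermonde n \<mu>) * cmod (vandermonde n \<nu>) / Q \<le> sqrt K / P"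
      using 1 pos by (simp add: field_simps)
    have "cmod (vandermonde (Suc n) \<nu>) * cmod (vandermonde n \<mu>) / (\<Prod>k=1..n. \<Prod>q=1..Suc n. cmod (\<mu> k - \<nu> q))
        = (cmod (vandermonde n \<mu>) * cmod (vandermonde n \<nu>) / Q) * ((\<Prod>k=1..n. cmod (\<nu> (\<tau> k) - \<nu> (Suc n))) / S)"
      unfolding 2 3 by simp
    also have "\<dots> \<le> sqrt K / P * ((\<Prod>k=1..n. cmod (\<nu> (\<tau> k) - \<nu> (Suc n))) / S)"
      using pos by (intro mult_right_mono 4 divide_nonneg_pos prod_nonneg) auto
    also have "\<dots> = sqrt K * (\<Prod>k=1..n. cmod (\<nu> (\<tau> k) - \<nu> (Suc n)) / (cmod (\<mu> k - \<nu> (\<tau> k)) * cmod (\<mu> k - \<nu> (Suc n))))"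
      by (simp add: P_def S_def prod_dividef prod.distrib)
    also have "\<dots> \<le> sqrt K * (\<Sum>\<sigma> | \<sigma> permutes {1..n}. \<Prod>k=1..n. cmod (\<nu> (\<sigma> k) - \<nu> (Suc n)) / (cmod (\<mu> k - \<nu> (\<sigma> k)) * cmod (\<mu> k - \<nu> (Suc n))))"
      using K \<tau> by (intro mult_left_mono member_le_sum[of \<tau>] finite_permutations prod_nonneg) auto
    finally show "cmod (vandermonde (Suc n) \<nu>) * cmod (vandermonde n \<mu>) / (\<Prod>k=1..n. \<Prod>q=1..Suc n. cmod (\<mu> k - \<nu> q))
     \<le> sqrt K * (\<Sum>\<sigma> | \<sigma> permutes {1..n}. \<Prod>k=1..n. cmod (\<nu> (\<sigma> k) - \<nu> (Suc n)) / (cmod (\<mu> k - \<nu> (\<sigma> k)) * cmod (\<mu> k - \<nu> (Suc n))))" .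
  qed
qed

section \<open>Integrating the kernel over one line\<close>

lemma powr_mult_le_sum:
  fixes u v :: real
  assumes "0 \<le> u" "0 \<le> v" "0 \<le> a" "0 \<le> b"
  shows "u powr a * v powr b \<le> u powr (a + b) + v powr (a + b)"
proof (cases "u \<le> v")
  case True
  have "u powr a * v powr b \<le> v powr a * v powr b"
    using assms True by (intro mult_right_mono powr_mono2) auto
  moreover have "0 \<le> u powr (a + b)" by simp
  ultimately show ?thesis unfolding powr_add[symmetric] by linarith
next
  case False
  have "u powr a * v powr b \<le> u powr a * u powr b"
    using assms False by (intro mult_left_mono powr_mono2) auto
  moreover have "0 \<le> v powr (a + b)" by simp
  ultimately show ?thesis unfolding powr_add[symmetric] by linarith
qed

text \<open>
  The kernel \<open>D = \<bar>\<nu> - \<nu>'\<bar> / (\<bar>z - \<nu>\<bar> \<bar>z - \<nu>'\<bar>)\<close> has two competing bounds: the sum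
  \<open>1 / \<bar>z - \<nu>\<bar> + 1 / \<bar>z - \<nu>'\<bar>\<close>, uniform in the nodes but not integrable, and a multiple of
  \<open>(1 + \<bar>z\<bar>)\<^sup>-\<^sup>2\<close>, integrable but growing with the nodes. Interpolating as \<open>D = D\<^sup>1\<^sup>-\<^sup>\<theta> D\<^sup>\<theta>\<close> gains
  integrability, even with the weight \<open>(1 + \<bar>z\<bar>)\<close> to the power \<open>\<theta> / 2\<close>, and costs only a small
  power of the nodes.
\<close>
lemma pivot_integral_bound:
  assumes \<theta>: "0 < \<theta>" "\<theta> < 1" and d: "0 < (d::real)"
  shows "\<exists>C\<ge>0. \<forall>c \<nu> \<nu>'. c + d \<le> Im \<nu> \<longrightarrow> c + d \<le> Im \<nu>' \<longrightarrow>
    (\<integral>\<^sup>+s. ennreal (cmod (\<nu> - \<nu>') / (cmod (Complex s c - \<nu>) * cmod (Complex s c - \<nu>')) * (1 + cmod (Complex s c)) powr (\<theta> / 2)) \<partial>lborel)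
    \<le> ennreal (C * ((1 + cmod \<nu>) * (1 + cmod \<nu>')) powr (2 * \<theta>))"
proof -
  define p where "p = 1 + \<theta> / 2"
  define \<kappa> where "\<kappa> = 1 + 1 / d"
  define J where "J = enn2real (\<integral>\<^sup>+s. ennreal ((1 + \<bar>s\<bar>) powr - p) \<partial>lborel)"
  have J: "(\<integral>\<^sup>+s. ennreal ((1 + \<bar>s\<bar>) powr - p) \<partial>lborel) = ennreal J" "0 \<le> J"
    using nn_integral_one_plus_abs_powr[of p] \<theta> by (auto simp: J_def p_def)
  have \<kappa>: "0 < \<kappa>" using d by (simp add: \<kappa>_def add_pos_pos)
  define C where "C = \<kappa> powr (2 * \<theta>) * ((2 * \<kappa>) powr p * (J + J) + J)"
  show ?thesis
  proof (intro exI[of _ C] conjI allI impI)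
    show "0 \<le> C" using J \<kappa> by (simp add: C_def)
    fix c \<nu> \<nu>'
    assume im: "c + d \<le> Im \<nu>" "c + d \<le> Im \<nu>'"
    define W where "W = (1 + cmod \<nu>) * (1 + cmod \<nu>')"
    have W: "0 < W" unfolding W_def by (intro mult_pos_pos add_pos_nonneg) auto
    define r where "r = (\<lambda>s::real. (1 + \<bar>s\<bar>) powr - p)"
    have pointwise: "cmod (\<nu> - \<nu>') / (cmod (Complex s c - \<nu>) * cmod (Complex s c - \<nu>')) * (1 + cmod (Complex s c)) powr (\<theta> / 2)
       \<le> (\<kappa> * W) powr (2 * \<theta>) * ((2 * \<kappa>) powr p * (r (s - Re \<nu>) + r (s - Re \<nu>')) + r s)" for s
    proof -
      define z where "z = Complex s c"
      have far: "d \<le> cmod (z - \<nu>)" "d \<le> cmod (z - \<nu>')"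
        using im abs_Im_le_cmod[of "z - \<nu>"] abs_Im_le_cmod[of "z - \<nu>'"] by (auto simp: z_def)
      have far0: "0 < cmod (z - \<nu>)" "0 < cmod (z - \<nu>')" using far d by linarith+
      define a b v where "a = 1 / cmod (z - \<nu>)" and "b = 1 / cmod (z - \<nu>')" and "v = 1 / (1 + cmod z)"
      define D where "D = cmod (\<nu> - \<nu>') * a * b"
      have ab: "0 < a" "0 < b" using far d by (auto simp: a_def b_def)
      have v: "0 < v" unfolding v_def by (intro divide_pos_pos add_pos_nonneg) auto
      have D0: "0 \<le> D" using ab by (simp add: D_def)
      have "cmod (\<nu> - \<nu>') \<le> cmod (z - \<nu>) + cmod (z - \<nu>')"
        using norm_triangle_ineq4[of "z - \<nu>'" "z - \<nu>"] by simp
      then have "D \<le> (cmod (z - \<nu>) + cmod (z - \<nu>')) * a * b"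
        unfolding D_def using ab by (intro mult_right_mono) auto
      also have "\<dots> = a + b" using far0 by (simp add: a_def b_def divide_simps)
      finally have D1: "D \<le> a + b" .
      have a': "a \<le> \<kappa> * (1 + cmod \<nu>) * v" and b': "b \<le> \<kappa> * (1 + cmod \<nu>') * v"
        using one_plus_norm_le[OF d far(1), folded \<kappa>_def] one_plus_norm_le[OF d far(2), folded \<kappa>_def] far0
        by (auto simp: a_def b_def v_def divide_simps mult_ac add_pos_nonneg)
      have "cmod (\<nu> - \<nu>') \<le> cmod \<nu> + cmod \<nu>'" by (rule norm_triangle_ineq4)
      also have "\<dots> \<le> W" by (simp add: W_def algebra_simps)
      finally have "D \<le> W * (\<kappa> * (1 + cmod \<nu>) * v) * (\<kappa> * (1 + cmod \<nu>') * v)"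
        unfolding D_def using ab W v \<kappa> by (intro mult_mono a' b') auto
      also have "\<dots> = (\<kappa> * W * v) ^ 2" by (simp add: W_def power2_eq_square)
      finally have D2: "D \<le> (\<kappa> * W * v) ^ 2" .
      have "D = D powr (1 - \<theta>) * D powr \<theta>" using D0 by (simp add: powr_add[symmetric])
      also have "\<dots> \<le> (a + b) powr (1 - \<theta>) * ((\<kappa> * W * v) ^ 2) powr \<theta>"
        using \<theta> D0 D1 D2 by (intro mult_mono powr_mono2) auto
      also have "((\<kappa> * W * v) ^ 2) powr \<theta> = (\<kappa> * W) powr (2 * \<theta>) * v powr (2 * \<theta>)"
        using \<kappa> W v by (simp add: powr_mult powr_powr flip: powr_numeral)
      finally have D3: "D \<le> (\<kappa> * W) powr (2 * \<theta>) * ((a + b) powr (1 - \<theta>) * v powr (2 * \<theta>))"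
        by (simp add: mult_ac)
      have "D * (1 + cmod z) powr (\<theta> / 2) = D * v powr (- (\<theta> / 2))"
        using v by (simp add: v_def powr_minus powr_divide)
      also have "\<dots> \<le> ((\<kappa> * W) powr (2 * \<theta>) * ((a + b) powr (1 - \<theta>) * v powr (2 * \<theta>))) * v powr (- (\<theta> / 2))"
        using D3 by (rule mult_right_mono) simp
      also have "\<dots> = (\<kappa> * W) powr (2 * \<theta>) * ((a + b) powr (1 - \<theta>) * v powr (3 * \<theta> / 2))"
        using v by (simp add: powr_add[symmetric] mult.assoc)
      also have "\<dots> \<le> (\<kappa> * W) powr (2 * \<theta>) * ((a + b) powr p + v powr p)"
        using powr_mult_le_sum[of "a + b" v "1 - \<theta>" "3 * \<theta> / 2"] ab v \<theta>
        by (intro mult_left_mono) (auto simp: p_def add.commute)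
      also have "\<dots> \<le> (\<kappa> * W) powr (2 * \<theta>) * ((2 * \<kappa>) powr p * (r (s - Re \<nu>) + r (s - Re \<nu>')) + r s)"
      proof (intro mult_left_mono add_mono)
        have p0: "0 \<le> p" using \<theta> by (simp add: p_def)
        have r_eq: "r x = (1 / (1 + \<bar>x\<bar>)) powr p" for x
          by (simp add: r_def powr_minus powr_divide inverse_eq_divide)
        have inv: "1 / cmod (z - \<eta>) \<le> \<kappa> * (1 / (1 + \<bar>s - Re \<eta>\<bar>))" if "d \<le> cmod (z - \<eta>)" for \<eta>
        proof -
          have "\<bar>s - Re \<eta>\<bar> \<le> cmod (z - \<eta>)" using abs_Re_le_cmod[of "z - \<eta>"] by (simp add: z_def)
          moreover have "1 \<le> cmod (z - \<eta>) / d" using that d by simp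
          ultimately have "1 + \<bar>s - Re \<eta>\<bar> \<le> \<kappa> * cmod (z - \<eta>)" by (simp add: \<kappa>_def algebra_simps)
          moreover have "0 < cmod (z - \<eta>)" using that d by linarith
          ultimately show ?thesis by (simp add: divide_simps mult_ac add_pos_nonneg)
        qed
        have "a + b \<le> 2 * max a b" by simp
        then have "(a + b) powr p \<le> (2 * max a b) powr p" using ab p0 by (intro powr_mono2) auto
        also have "\<dots> = 2 powr p * (max a b) powr p" by (rule powr_mult)
        also have "\<dots> \<le> 2 powr p * (a powr p + b powr p)" by (intro mult_left_mono) (auto simp: max_def)
        also have "\<dots> \<le> 2 powr p * ((\<kappa> * (1 / (1 + \<bar>s - Re \<nu>\<bar>))) powr p + (\<kappa> * (1 / (1 + \<bar>s - Re \<nu>'\<bar>))) powr p)"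
          using inv[OF far(1)] inv[OF far(2)] ab p0
          by (intro mult_left_mono add_mono powr_mono2) (simp_all add: a_def b_def)
        also have "\<dots> = (2 * \<kappa>) powr p * (r (s - Re \<nu>) + r (s - Re \<nu>'))"
          unfolding r_eq using \<kappa> by (simp only: powr_mult less_imp_le zero_le_numeral) (simp add: algebra_simps powr_mult)
        finally show "(a + b) powr p \<le> (2 * \<kappa>) powr p * (r (s - Re \<nu>) + r (s - Re \<nu>'))" .
        have "\<bar>s\<bar> \<le> cmod z" using abs_Re_le_cmod[of z] by (simp add: z_def)
        then show "v powr p \<le> r s"
          unfolding r_eq v_def using p0 by (intro powr_mono2 frac_le) auto
      qed simp
      finally show ?thesis by (simp add: D_def a_def b_def z_def)
    qed
    have [measurable]: "r \<in> borel_measurable borel" unfolding r_def by measurable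
    have r0: "0 \<le> r s" for s by (simp add: r_def)
    have Jr: "(\<integral>\<^sup>+s. ennreal (r s) \<partial>lborel) = ennreal J" using J by (simp add: r_def)
    have Jshift: "(\<integral>\<^sup>+s. ennreal (r (s - x)) \<partial>lborel) = ennreal J" for x
      using nn_integral_lborel_shift[of "\<lambda>s. ennreal (r s)" x] Jr by simp
    have "(\<integral>\<^sup>+s. ennreal (cmod (\<nu> - \<nu>') / (cmod (Complex s c - \<nu>) * cmod (Complex s c - \<nu>')) * (1 + cmod (Complex s c)) powr (\<theta> / 2)) \<partial>lborel)
       \<le> (\<integral>\<^sup>+s. ennreal ((\<kappa> * W) powr (2 * \<theta>)) * (ennreal ((2 * \<kappa>) powr p) * (ennreal (r (s - Re \<nu>)) + ennreal (r (s - Re \<nu>'))) + ennreal (r s)) \<partial>lborel)"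
      by (intro nn_integral_mono order.trans[OF ennreal_leI[OF pointwise]])
         (simp add: ennreal_mult' ennreal_plus r0)
    also have "\<dots> = ennreal ((\<kappa> * W) powr (2 * \<theta>)) * (ennreal ((2 * \<kappa>) powr p) * (ennreal J + ennreal J) + ennreal J)"
      by (simp add: nn_integral_cmult nn_integral_add Jr Jshift)
    also have "\<dots> = ennreal (C * W powr (2 * \<theta>))"
      using J(2) \<kappa> W by (simp add: C_def powr_mult mult_ac flip: ennreal_plus ennreal_mult')
    finally show "(\<integral>\<^sup>+s. ennreal (cmod (\<nu> - \<nu>') / (cmod (Complex s c - \<nu>) * cmod (Complex s c - \<nu>')) * (1 + cmod (Complex s c)) powr (\<theta> / 2)) \<partial>lborel)
      \<le> ennreal (C * ((1 + cmod \<nu>) * (1 + cmod \<nu>')) powr (2 * \<theta>))" by (simp add: W_def)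
  qed
qed

section \<open>Triangular arrays and the recursion of the integrand\<close>

definition cells :: "nat \<Rightarrow> (nat \<times> nat) set" where
  "cells m = {(n, j). 1 \<le> j \<and> j \<le> n \<and> n \<le> m}"

definition row :: "nat \<Rightarrow> (nat \<times> nat) set" where
  "row n = Pair n ` {1..n}"

lemma cells_0: "cells 0 = {}"
  by (auto simp: cells_def)

lemma cells_Suc: "cells (Suc m) = row (Suc m) \<union> cells m"
  by (auto simp: cells_def row_def le_Suc_eq)

lemma row_cells_disjoint: "row (Suc m) \<inter> cells m = {}"
  by (auto simp: cells_def row_def)

lemma finite_row: "finite (row n)"
  by (simp add: row_def)

lemma finite_cells: "finite (cells m)"
  by (induction m) (auto simp: cells_0 cells_Suc finite_row)

abbreviation lborel_on :: "(nat \<times> nat) set \<Rightarrow> (nat \<times> nat \<Rightarrow> real) measure" where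
  "lborel_on I \<equiv> Pi\<^sub>M I (\<lambda>_. lborel)"

lemma product_sigma_finite_lborel: "product_sigma_finite (\<lambda>_ :: nat \<times> nat. lborel :: real measure)"
  by (simp add: product_sigma_finite_def sigma_finite_lborel)

text \<open>
  A triangular array of spectral variables. Unlike in the integral of the theorem, the top row
  \<open>\<nu>\<close> is complex, so that any row of integration variables can take its place in an induction.
\<close>
definition pattern ::
  "nat \<Rightarrow> (nat \<Rightarrow> nat \<Rightarrow> real) \<Rightarrow> (nat \<Rightarrow> complex) \<Rightarrow> (nat \<times> nat \<Rightarrow> real) \<Rightarrow> nat \<Rightarrow> nat \<Rightarrow> complex" where
  "pattern m c \<nu> t n j =
     (if 1 \<le> j \<and> j \<le> n then (if n = Suc m then \<nu> j else Complex (t (n, j)) (c n j)) else 0)"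

definition row_point :: "(nat \<Rightarrow> nat \<Rightarrow> real) \<Rightarrow> nat \<Rightarrow> (nat \<times> nat \<Rightarrow> real) \<Rightarrow> nat \<Rightarrow> complex" where
  "row_point c n s j = Complex (s (n, j)) (c n j)"

definition row_factor :: "nat \<Rightarrow> (nat \<Rightarrow> complex) \<Rightarrow> (nat \<Rightarrow> complex) \<Rightarrow> complex" where
  "row_factor n \<mu> \<nu> = (\<Prod>(s, p)\<in>offdiag {1..n}. \<mu> s - \<mu> p) / (fact n * (\<Prod>k=1..n. \<Prod>m=1..n + 1. \<mu> k - \<nu> m))"

definition weights :: "nat \<Rightarrow> (nat \<Rightarrow> nat \<Rightarrow> complex) \<Rightarrow> complex" where
  "weights l \<gamma> = (\<Prod>n=1..l. row_factor n (\<gamma> n) (\<gamma> (n + 1)))"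

lemma whittaker_integrand_weights:
  "whittaker_integrand l \<gamma> x = weights l \<gamma> *
     exp (\<i> * (\<Sum>n=1..l + 1. \<Sum>j=1..n. (\<gamma> n j - \<gamma> (n - 1) j) * complex_of_real (x n)))"
  by (simp add: whittaker_integrand_def weights_def row_factor_def offdiag_def)

lemma weights_cong:
  assumes "\<And>n j. n \<le> Suc l \<Longrightarrow> \<gamma> n j = \<gamma>' n j"
  shows "weights l \<gamma> = weights l \<gamma>'"
proof -
  have "\<gamma> n = \<gamma>' n" if "n \<le> Suc l" for n using assms[OF that] by auto
  then show ?thesis unfolding weights_def by (intro prod.cong) auto
qed

lemma pattern_merge:
  "n \<le> Suc m \<Longrightarrow> pattern (Suc m) c \<nu> (merge (row (Suc m)) (cells m) (s, t)) n j
     = pattern m c (row_point c (Suc m) s) t n j"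
  by (auto simp: pattern_def merge_def cells_def row_def row_point_def)

lemma pattern_merge_row:
  "1 \<le> j \<Longrightarrow> j \<le> Suc m \<Longrightarrow> pattern (Suc m) c \<nu> (merge (row (Suc m)) (cells m) (s, t)) (Suc m) j
     = row_point c (Suc m) s j"
  by (simp add: pattern_merge) (simp add: pattern_def)

lemma row_factor_cong:
  assumes "\<And>j. j \<in> {1..n} \<Longrightarrow> \<mu> j = \<mu>' j" "\<And>j. j \<in> {1..Suc n} \<Longrightarrow> \<nu> j = \<nu>' j"
  shows "row_factor n \<mu> \<nu> = row_factor n \<mu>' \<nu>'"
  unfolding row_factor_def using assms
  by (intro arg_cong2[where f = "(/)"] arg_cong2[where f = "(*)"] prod.cong refl)
     (auto simp: offdiag_def)

lemma weights_Suc_merge: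
  "weights (Suc m) (pattern (Suc m) c \<nu> (merge (row (Suc m)) (cells m) (s, t)))
     = weights m (pattern m c (row_point c (Suc m) s) t) * row_factor (Suc m) (row_point c (Suc m) s) \<nu>"
proof -
  let ?\<gamma> = "pattern (Suc m) c \<nu> (merge (row (Suc m)) (cells m) (s, t))"
  have "weights (Suc m) ?\<gamma> = weights m ?\<gamma> * row_factor (Suc m) (?\<gamma> (Suc m)) (?\<gamma> (Suc (Suc m)))"
    by (simp add: weights_def)
  also have "weights m ?\<gamma> = weights m (pattern m c (row_point c (Suc m) s) t)"
    by (rule weights_cong) (rule pattern_merge)
  also have "row_factor (Suc m) (?\<gamma> (Suc m)) (?\<gamma> (Suc (Suc m))) = row_factor (Suc m) (row_point c (Suc m) s) \<nu>"
  proof (rule row_factor_cong)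
    show "?\<gamma> (Suc m) j = row_point c (Suc m) s j" if "j \<in> {1..Suc m}" for j
      using that by (intro pattern_merge_row) auto
  qed (auto simp: pattern_def)
  finally show ?thesis .
qed

lemma whittaker_integrand_Suc_merge:
  fixes x :: "nat \<Rightarrow> real" and m :: nat
  defines "y \<equiv> complex_of_real (x (Suc (Suc m)))"
  shows "whittaker_integrand (Suc m) (pattern (Suc m) c \<nu> (merge (row (Suc m)) (cells m) (s, t))) x
     = row_factor (Suc m) (row_point c (Suc m) s) \<nu>
       * exp (\<i> * ((\<Sum>j=1..Suc (Suc m). \<nu> j) - (\<Sum>j=1..Suc m. row_point c (Suc m) s j)) * y)
       * whittaker_integrand m (pattern m c (row_point c (Suc m) s) t) x"
proof -
  let ?\<gamma> = "pattern (Suc m) c \<nu> (merge (row (Suc m)) (cells m) (s, t))"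
  let ?\<beta> = "pattern m c (row_point c (Suc m) s) t"
  have top: "(\<Sum>j=1..Suc (Suc m). (?\<gamma> (Suc (Suc m)) j - ?\<gamma> (Suc m) j) * y)
      = ((\<Sum>j=1..Suc (Suc m). \<nu> j) - (\<Sum>j=1..Suc m. row_point c (Suc m) s j)) * y"
  proof -
    have "(\<Sum>j=1..Suc (Suc m). ?\<gamma> (Suc (Suc m)) j) = (\<Sum>j=1..Suc (Suc m). \<nu> j)"
      by (intro sum.cong) (auto simp: pattern_def)
    moreover have "(\<Sum>j=1..Suc (Suc m). ?\<gamma> (Suc m) j) = (\<Sum>j=1..Suc m. row_point c (Suc m) s j)"
    proof -
      have "?\<gamma> (Suc m) (Suc (Suc m)) = 0" by (simp add: pattern_def)
      moreover have "(\<Sum>j=1..Suc m. ?\<gamma> (Suc m) j) = (\<Sum>j=1..Suc m. row_point c (Suc m) s j)"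
        by (intro sum.cong refl pattern_merge_row) auto
      ultimately show ?thesis by simp
    qed
    ultimately show ?thesis by (simp only: sum_subtractf left_diff_distrib flip: sum_distrib_right)
  qed
  have "(\<Sum>n=1..Suc m + 1. \<Sum>j=1..n. (?\<gamma> n j - ?\<gamma> (n - 1) j) * complex_of_real (x n))
      = (\<Sum>n=1..m + 1. \<Sum>j=1..n. (?\<gamma> n j - ?\<gamma> (n - 1) j) * complex_of_real (x n))
        + (\<Sum>j=1..Suc (Suc m). (?\<gamma> (Suc (Suc m)) j - ?\<gamma> (Suc m) j) * y)"
    by (simp only: add_Suc Suc_eq_plus1[symmetric] sum.cl_ivl_Suc[of _ 1 "Suc m"] y_def) simp
  also have "(\<Sum>n=1..m + 1. \<Sum>j=1..n. (?\<gamma> n j - ?\<gamma> (n - 1) j) * complex_of_real (x n))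
      = (\<Sum>n=1..m + 1. \<Sum>j=1..n. (?\<beta> n j - ?\<beta> (n - 1) j) * complex_of_real (x n))"
    by (intro sum.cong refl) (auto simp: pattern_merge)
  finally show ?thesis
    unfolding whittaker_integrand_weights weights_Suc_merge top
    by (simp only: distrib_left exp_add mult_ac)
qed

lemma pattern_measurable:
  assumes "n \<le> Suc m"
  shows "(\<lambda>t. pattern m c \<nu> t n j) \<in> borel_measurable (lborel_on (cells m))"
proof (cases "1 \<le> j \<and> j \<le> n \<and> n \<noteq> Suc m")
  case True
  then have "(n, j) \<in> cells m" using assms by (auto simp: cells_def)
  then have [measurable]: "(\<lambda>t. t (n, j)) \<in> borel_measurable (lborel_on (cells m))"
    using measurable_component_singleton[of "(n, j)" "cells m" "\<lambda>_. lborel :: real measure"] by simp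
  have "(\<lambda>t. pattern m c \<nu> t n j) = (\<lambda>t. of_real (t (n, j)) + \<i> * of_real (c n j))"
    using True by (auto simp: pattern_def Complex_eq)
  then show ?thesis by simp
next
  case False
  then have "(\<lambda>t. pattern m c \<nu> t n j) = (\<lambda>t. if 1 \<le> j \<and> j \<le> n then \<nu> j else 0)"
    by (auto simp: pattern_def)
  then show ?thesis by simp
qed

lemma weights_measurable:
  "(\<lambda>t. weights m (pattern m c \<nu> t)) \<in> borel_measurable (lborel_on (cells m))"
  unfolding weights_def row_factor_def case_prod_unfold
  by (intro borel_measurable_prod borel_measurable_divide borel_measurable_times borel_measurable_diff
      borel_measurable_const pattern_measurable) auto

lemma whittaker_integrand_measurable:
  "(\<lambda>t. whittaker_integrand m (pattern m c \<nu> t) x) \<in> borel_measurable (lborel_on (cells m))"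
  unfolding whittaker_integrand_weights
  by (intro borel_measurable_times weights_measurable measurable_compose[OF _ borel_measurable_exp] borel_measurable_sum
      borel_measurable_diff borel_measurable_const pattern_measurable) auto

section \<open>Absolute convergence\<close>

definition ascending :: "nat \<Rightarrow> (nat \<Rightarrow> nat \<Rightarrow> real) \<Rightarrow> bool" where
  "ascending m c \<longleftrightarrow> (\<forall>n\<in>{1..m}. \<forall>i\<in>{1..n}. \<forall>j\<in>{1..Suc n}. c n i < c (Suc n) j)"

lemma ascending_Suc: "ascending (Suc m) c \<Longrightarrow> ascending m c"
  by (auto simp: ascending_def)

lemma ascending_gap:
  assumes "ascending (Suc m) c"
  obtains d where "0 < d" "\<And>k q. k \<in> {1..Suc m} \<Longrightarrow> q \<in> {1..Suc (Suc m)} \<Longrightarrow> c (Suc m) k + d \<le> c (Suc (Suc m)) q"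
proof
  let ?S = "(\<lambda>(k, q). c (Suc (Suc m)) q - c (Suc m) k) ` ({1..Suc m} \<times> {1..Suc (Suc m)})"
  show "0 < Min ?S"
    using assms by (subst Min_gr_iff) (auto simp: ascending_def)
  show "c (Suc m) k + Min ?S \<le> c (Suc (Suc m)) q" if "k \<in> {1..Suc m}" "q \<in> {1..Suc (Suc m)}" for k q
  proof -
    have "Min ?S \<le> c (Suc (Suc m)) q - c (Suc m) k"
      using that by (intro Min_le) (auto intro!: rev_image_eqI[of "(k, q)"])
    then show ?thesis by simp
  qed
qed

lemma norm_row_factor:
  "cmod (row_factor n \<mu> \<nu>) = cmod (vandermonde n \<mu>) ^ 2 / (fact n * (\<Prod>k=1..n. \<Prod>q=1..Suc n. cmod (\<mu> k - \<nu> q)))"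
proof -
  have "cmod (\<Prod>k=1..n. \<Prod>q=1..n + 1. \<mu> k - \<nu> q) = (\<Prod>k=1..n. \<Prod>q=1..Suc n. cmod (\<mu> k - \<nu> q))"
    by (simp only: prod_norm Suc_eq_plus1)
  then show ?thesis
    unfolding row_factor_def norm_divide norm_mult norm_prod_offdiag
    by (simp only: norm_fact)
qed

lemma prod_row: "(\<Prod>k=1..n. F k (s (n, k))) = (\<Prod>i\<in>row n. F (snd i) (s i))"
  unfolding row_def by (subst prod.reindex) (auto simp: inj_on_def)

lemma measurable_row_component:
  assumes "k \<in> {1..n}"
  shows "(\<lambda>s. s (n, k)) \<in> borel_measurable (lborel_on (row n))"
  using measurable_component_singleton[of "(n, k)" "row n" "\<lambda>_. lborel :: real measure"] assms
  by (simp add: row_def)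

text \<open>
  The absolute integral over all rows below \<open>\<nu>\<close> grows slower than every power of \<open>\<nu>\<close> once it is
  multiplied by the Vandermonde product of \<open>\<nu>\<close>. In the induction step one Vandermonde product of the
  row \<open>\<mu>\<close> is absorbed by the induction hypothesis with exponent \<open>\<theta> / 2\<close>, and the other one, together
  with that of \<open>\<nu>\<close>, by the kernel bound; the integral over \<open>\<mu>\<close> then factorizes. The exponent has
  to be arbitrarily small, since each row multiplies it by a factor.
\<close>
lemma weights_bound:
  assumes "ascending m c" "0 < \<delta>"
  shows "\<exists>C\<ge>0. \<forall>\<nu>. (\<forall>j\<in>{1..Suc m}. Im (\<nu> j) = c (Suc m) j) \<longrightarrow>
     ennreal (cmod (vandermonde (Suc m) \<nu>)) * (\<integral>\<^sup>+t. ennreal (cmod (weights m (pattern m c \<nu> t))) \<partial>lborel_on (cells m))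
     \<le> ennreal (C * (\<Prod>j=1..Suc m. (1 + cmod (\<nu> j)) powr \<delta>))"
  using assms
proof (induction m arbitrary: \<delta>)
  case 0
  interpret product_sigma_finite "\<lambda>_ :: nat \<times> nat. lborel :: real measure"
    by (rule product_sigma_finite_lborel)
  show ?case
  proof (intro exI[of _ 1] conjI allI impI)
    fix \<nu> :: "nat \<Rightarrow> complex"
    have "1 \<le> (1 + cmod (\<nu> 1)) powr \<delta>" using 0 by (intro ge_one_powr_ge_zero) auto
    then show "ennreal (cmod (vandermonde (Suc 0) \<nu>)) * (\<integral>\<^sup>+t. ennreal (cmod (weights 0 (pattern 0 c \<nu> t))) \<partial>lborel_on (cells 0))
     \<le> ennreal (1 * (\<Prod>j=1..Suc 0. (1 + cmod (\<nu> j)) powr \<delta>))"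
      by (simp add: cells_0 space_PiM_empty weights_def vandermonde_def)
  qed simp
next
  case (Suc m)
  interpret product_sigma_finite "\<lambda>_ :: nat \<times> nat. lborel :: real measure"
    by (rule product_sigma_finite_lborel)
  define n where "n = Suc m"
  have n0: "0 < n" by (simp add: n_def)
  \<comment> \<open>Each \<open>\<nu>\<^sub>q\<close> collects the exponent \<open>2 \<theta>\<close>, the pivot \<open>\<nu>\<^bsub>n+1\<^esub>\<close> collects it \<open>n\<close> times.\<close>
  define \<theta> where "\<theta> = min (1 / 2) (\<delta> / (2 * real n))"
  have \<theta>: "0 < \<theta>" "\<theta> < 1" "2 * \<theta> * real n \<le> \<delta>"
    using Suc.prems n0 by (auto simp: \<theta>_def min_def field_simps)
  have \<theta>': "2 * \<theta> \<le> \<delta>"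
  proof -
    have "2 * \<theta> * 1 \<le> 2 * \<theta> * real n" using \<theta> n0 by (intro mult_left_mono) auto
    then show ?thesis using \<theta>(3) by linarith
  qed
  obtain C' where C': "0 \<le> C'" and IH: "\<And>\<mu>. (\<forall>j\<in>{1..n}. Im (\<mu> j) = c n j) \<Longrightarrow>
     ennreal (cmod (vandermonde n \<mu>)) * (\<integral>\<^sup>+t. ennreal (cmod (weights m (pattern m c \<mu> t))) \<partial>lborel_on (cells m))
     \<le> ennreal (C' * (\<Prod>j=1..n. (1 + cmod (\<mu> j)) powr (\<theta> / 2)))"
    using Suc.IH[OF ascending_Suc[OF Suc.prems(1)], of "\<theta> / 2"] \<theta> unfolding n_def by auto
  obtain d where d: "0 < d" "\<And>k q. k \<in> {1..n} \<Longrightarrow> q \<in> {1..Suc n} \<Longrightarrow> c n k + d \<le> c (Suc n) q"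
    using ascending_gap[OF Suc.prems(1)] unfolding n_def by blast
  obtain C1 where C1: "0 \<le> C1" and pivot: "\<And>b \<nu> \<nu>'. b + d \<le> Im \<nu> \<Longrightarrow> b + d \<le> Im \<nu>' \<Longrightarrow>
    (\<integral>\<^sup>+s. ennreal (cmod (\<nu> - \<nu>') / (cmod (Complex s b - \<nu>) * cmod (Complex s b - \<nu>')) * (1 + cmod (Complex s b)) powr (\<theta> / 2)) \<partial>lborel)
    \<le> ennreal (C1 * ((1 + cmod \<nu>) * (1 + cmod \<nu>')) powr (2 * \<theta>))"
    using pivot_integral_bound[OF \<theta>(1,2) d(1)] by blast
  obtain K where K: "0 \<le> K" and kernel: "\<And>\<mu> \<nu>. (\<forall>k\<in>{1..n}. \<forall>q\<in>{1..Suc n}. \<mu> k \<noteq> \<nu> q) \<Longrightarrow>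
     cmod (vandermonde (Suc n) \<nu>) * cmod (vandermonde n \<mu>) / (\<Prod>k=1..n. \<Prod>q=1..Suc n. cmod (\<mu> k - \<nu> q))
     \<le> K * (\<Sum>\<sigma> | \<sigma> permutes {1..n}. \<Prod>k=1..n. cmod (\<nu> (\<sigma> k) - \<nu> (Suc n)) / (cmod (\<mu> k - \<nu> (\<sigma> k)) * cmod (\<mu> k - \<nu> (Suc n))))"
    using interlacing_kernel_bound[of n] by blast
  define C where "C = K * C' * (fact n * C1 ^ n)"
  show ?case unfolding n_def[symmetric]
  proof (intro exI[of _ C] conjI allI impI)
    show "0 \<le> C" using K C' C1 by (simp add: C_def)
    fix \<nu> :: "nat \<Rightarrow> complex"
    assume im: "\<forall>j\<in>{1..Suc n}. Im (\<nu> j) = c (Suc n) j"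
    define w where "w = (\<lambda>j. 1 + cmod (\<nu> j))"
    have w: "1 \<le> w j" for j by (simp add: w_def)
    define V where "V = cmod (vandermonde (Suc n) \<nu>)"
    define D where "D = (\<lambda>q k s. cmod (\<nu> q - \<nu> (Suc n)) / (cmod (Complex s (c n k) - \<nu> q) * cmod (Complex s (c n k) - \<nu> (Suc n)))
        * (1 + cmod (Complex s (c n k))) powr (\<theta> / 2))"
    have [measurable]: "D q k \<in> borel_measurable borel" for q k
      unfolding D_def Complex_eq by measurable
    have D0: "0 \<le> D q k s" for q k s by (simp add: D_def)
    have DI: "(\<integral>\<^sup>+s. ennreal (D q k s) \<partial>lborel) \<le> ennreal (C1 * (w q * w (Suc n)) powr (2 * \<theta>))"
      if "q \<in> {1..n}" "k \<in> {1..n}" for q k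
      unfolding D_def w_def by (rule pivot) (use that im d in auto)
    have inner: "(\<integral>\<^sup>+t. ennreal V * ennreal (cmod (weights n (pattern n c \<nu> (merge (row n) (cells m) (s, t))))) \<partial>lborel_on (cells m))
        \<le> ennreal (K * C') * (\<Sum>\<sigma> | \<sigma> permutes {1..n}. \<Prod>k=1..n. ennreal (D (\<sigma> k) k (s (n, k))))" for s
    proof -
      define \<mu> where "\<mu> = row_point c n s"
      have \<mu>k: "\<mu> k = Complex (s (n, k)) (c n k)" for k by (simp add: \<mu>_def row_point_def)
      have ne: "\<forall>k\<in>{1..n}. \<forall>q\<in>{1..Suc n}. \<mu> k \<noteq> \<nu> q"
      proof (intro ballI)
        fix k q assume "k \<in> {1..n}" "q \<in> {1..Suc n}"
        then have "Im (\<mu> k) < Im (\<nu> q)" using d im by (force simp: \<mu>k)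
        then show "\<mu> k \<noteq> \<nu> q" by auto
      qed
      define P where "P = (\<Prod>k=1..n. \<Prod>q=1..Suc n. cmod (\<mu> k - \<nu> q))"
      have P0: "0 \<le> P" unfolding P_def by (intro prod_nonneg) auto
      define B where "B = (\<integral>\<^sup>+t. ennreal (cmod (weights m (pattern m c \<mu> t))) \<partial>lborel_on (cells m))"
      have meas: "(\<lambda>t. ennreal (cmod (weights m (pattern m c \<mu> t)))) \<in> borel_measurable (lborel_on (cells m))"
        using weights_measurable by measurable
      have "(\<integral>\<^sup>+t. ennreal V * ennreal (cmod (weights n (pattern n c \<nu> (merge (row n) (cells m) (s, t))))) \<partial>lborel_on (cells m))
         = (\<integral>\<^sup>+t. ennreal (V * cmod (row_factor n \<mu> \<nu>)) * ennreal (cmod (weights m (pattern m c \<mu> t))) \<partial>lborel_on (cells m))"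
        unfolding n_def weights_Suc_merge \<mu>_def
        by (intro nn_integral_cong) (simp add: norm_mult V_def mult_ac flip: ennreal_mult')
      also have "\<dots> = ennreal (V * cmod (row_factor n \<mu> \<nu>)) * B"
        unfolding B_def by (rule nn_integral_cmult[OF meas])
      also have "\<dots> \<le> ennreal (V * cmod (vandermonde n \<mu>) / P * cmod (vandermonde n \<mu>)) * B"
      proof (intro mult_right_mono ennreal_leI)
        have "V * cmod (row_factor n \<mu> \<nu>) = V * cmod (vandermonde n \<mu>) / P * cmod (vandermonde n \<mu>) / fact n"
          unfolding norm_row_factor P_def[symmetric] by (simp add: power2_eq_square mult_ac)
        also have "\<dots> \<le> V * cmod (vandermonde n \<mu>) / P * cmod (vandermonde n \<mu>) / 1"
          using P0 by (intro divide_left_mono) (auto simp: V_def)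
        finally show "V * cmod (row_factor n \<mu> \<nu>) \<le> V * cmod (vandermonde n \<mu>) / P * cmod (vandermonde n \<mu>)" by simp
      qed simp
      also have "\<dots> = ennreal (V * cmod (vandermonde n \<mu>) / P) * (ennreal (cmod (vandermonde n \<mu>)) * B)"
        using P0 by (subst ennreal_mult) (auto simp: V_def mult.assoc)
      also have "\<dots> \<le> ennreal (K * (\<Sum>\<sigma> | \<sigma> permutes {1..n}. \<Prod>k=1..n. cmod (\<nu> (\<sigma> k) - \<nu> (Suc n)) / (cmod (\<mu> k - \<nu> (\<sigma> k)) * cmod (\<mu> k - \<nu> (Suc n)))))
          * ennreal (C' * (\<Prod>j=1..n. (1 + cmod (\<mu> j)) powr (\<theta> / 2)))"
        unfolding V_def P_def B_def
        by (intro mult_mono ennreal_leI kernel[OF ne] IH) (auto simp: \<mu>k)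
      also have "\<dots> = ennreal (K * (\<Sum>\<sigma> | \<sigma> permutes {1..n}. \<Prod>k=1..n. cmod (\<nu> (\<sigma> k) - \<nu> (Suc n)) / (cmod (\<mu> k - \<nu> (\<sigma> k)) * cmod (\<mu> k - \<nu> (Suc n))))
          * (C' * (\<Prod>j=1..n. (1 + cmod (\<mu> j)) powr (\<theta> / 2))))"
        using C' K by (intro ennreal_mult'[symmetric]) (auto intro!: mult_nonneg_nonneg prod_nonneg sum_nonneg)
      also have "K * (\<Sum>\<sigma> | \<sigma> permutes {1..n}. \<Prod>k=1..n. cmod (\<nu> (\<sigma> k) - \<nu> (Suc n)) / (cmod (\<mu> k - \<nu> (\<sigma> k)) * cmod (\<mu> k - \<nu> (Suc n))))
          * (C' * (\<Prod>j=1..n. (1 + cmod (\<mu> j)) powr (\<theta> / 2))) = K * C' * (\<Sum>\<sigma> | \<sigma> permutes {1..n}. \<Prod>k=1..n. D (\<sigma> k) k (s (n, k)))"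
      proof -
        have "(\<Prod>k=1..n. D (\<sigma> k) k (s (n, k)))
           = (\<Prod>k=1..n. cmod (\<nu> (\<sigma> k) - \<nu> (Suc n)) / (cmod (\<mu> k - \<nu> (\<sigma> k)) * cmod (\<mu> k - \<nu> (Suc n))))
             * (\<Prod>j=1..n. (1 + cmod (\<mu> j)) powr (\<theta> / 2))" for \<sigma>
          unfolding D_def \<mu>k by (rule prod.distrib)
        then show ?thesis by (simp only: sum_distrib_right[symmetric]) (simp add: mult_ac)
      qed
      also have "ennreal \<dots> = ennreal (K * C') * (\<Sum>\<sigma> | \<sigma> permutes {1..n}. \<Prod>k=1..n. ennreal (D (\<sigma> k) k (s (n, k))))"
        using K C' by (simp add: ennreal_mult' sum_ennreal prod_ennreal D0 prod_nonneg)
      finally show ?thesis .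
    qed
    have meas: "(\<lambda>t. ennreal (cmod (weights n (pattern n c \<nu> t)))) \<in> borel_measurable (lborel_on (cells n))"
      using weights_measurable by measurable
    have Dprod: "(\<integral>\<^sup>+s. (\<Prod>k=1..n. ennreal (D (\<sigma> k) k (s (n, k)))) \<partial>lborel_on (row n)) = (\<Prod>k=1..n. \<integral>\<^sup>+s. ennreal (D (\<sigma> k) k s) \<partial>lborel)" for \<sigma>
    proof -
      have "(\<integral>\<^sup>+s. (\<Prod>k=1..n. ennreal (D (\<sigma> k) k (s (n, k)))) \<partial>lborel_on (row n)) = (\<Prod>i\<in>row n. \<integral>\<^sup>+s. ennreal (D (\<sigma> (snd i)) (snd i) s) \<partial>lborel)"
        unfolding prod_row[of "\<lambda>k s. ennreal (D (\<sigma> k) k s)"]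
        by (rule product_nn_integral_prod) (auto simp: finite_row)
      then show ?thesis unfolding row_def by (subst (asm) prod.reindex) (auto simp: inj_on_def)
    qed
    have Dmeas: "(\<lambda>s. \<Prod>k=1..n. ennreal (D (\<sigma> k) k (s (n, k)))) \<in> borel_measurable (lborel_on (row n))" for \<sigma>
      by (intro borel_measurable_prod_ennreal measurable_compose[OF measurable_row_component]) auto
    have exps: "(\<Prod>k=1..n. (w (\<sigma> k) * w (Suc n)) powr (2 * \<theta>)) \<le> (\<Prod>j=1..Suc n. w j powr \<delta>)"
      if "\<sigma> permutes {1..n}" for \<sigma>
    proof -
      have w0: "0 < w j" for j using w[of j] by simp
      have "(\<Prod>k=1..n. (w (\<sigma> k) * w (Suc n)) powr (2 * \<theta>)) = (\<Prod>k=1..n. w (\<sigma> k) powr (2 * \<theta>)) * w (Suc n) powr (2 * \<theta> * real n)"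
        using w0[of "Suc n"] by (simp add: powr_mult prod.distrib powr_powr flip: powr_realpow)
      also have "(\<Prod>k=1..n. w (\<sigma> k) powr (2 * \<theta>)) = (\<Prod>k=1..n. w k powr (2 * \<theta>))"
        using prod.permute[OF that, of "\<lambda>k. w k powr (2 * \<theta>)"] by (simp add: o_def)
      also have "(\<Prod>k=1..n. w k powr (2 * \<theta>)) * w (Suc n) powr (2 * \<theta> * real n) \<le> (\<Prod>k=1..n. w k powr \<delta>) * w (Suc n) powr \<delta>"
        using \<theta> \<theta>' w by (intro mult_mono prod_mono powr_mono conjI prod_nonneg) auto
      finally show ?thesis by simp
    qed
    have "ennreal V * (\<integral>\<^sup>+t. ennreal (cmod (weights n (pattern n c \<nu> t))) \<partial>lborel_on (cells n))
       = (\<integral>\<^sup>+t. ennreal V * ennreal (cmod (weights n (pattern n c \<nu> t))) \<partial>lborel_on (row n \<union> cells m))"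
      by (subst nn_integral_cmult[OF meas, symmetric]) (simp add: n_def cells_Suc)
    also have "\<dots> = (\<integral>\<^sup>+s. (\<integral>\<^sup>+t. ennreal V * ennreal (cmod (weights n (pattern n c \<nu> (merge (row n) (cells m) (s, t))))) \<partial>lborel_on (cells m)) \<partial>lborel_on (row n))"
    proof (rule product_nn_integral_fold)
      show "(\<lambda>t. ennreal V * ennreal (cmod (weights n (pattern n c \<nu> t)))) \<in> borel_measurable (lborel_on (row n \<union> cells m))"
        using meas by (simp add: n_def cells_Suc)
    qed (use row_cells_disjoint[of m] finite_cells[of m] in \<open>auto simp: n_def finite_row\<close>)
    also have "\<dots> \<le> (\<integral>\<^sup>+s. ennreal (K * C') * (\<Sum>\<sigma> | \<sigma> permutes {1..n}. \<Prod>k=1..n. ennreal (D (\<sigma> k) k (s (n, k)))) \<partial>lborel_on (row n))"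
      by (intro nn_integral_mono inner)
    also have "\<dots> = ennreal (K * C') * (\<Sum>\<sigma> | \<sigma> permutes {1..n}. \<Prod>k=1..n. \<integral>\<^sup>+s. ennreal (D (\<sigma> k) k s) \<partial>lborel)"
      by (simp only: nn_integral_cmult borel_measurable_sum Dmeas nn_integral_sum Dprod)
    also have "\<dots> \<le> ennreal (K * C') * (\<Sum>\<sigma> | \<sigma> permutes {1..n}. ennreal (C1 ^ n * (\<Prod>j=1..Suc n. w j powr \<delta>)))"
    proof (intro mult_left_mono sum_mono)
      fix \<sigma> assume "\<sigma> \<in> {\<sigma>. \<sigma> permutes {1..n}}"
      then have \<sigma>: "\<sigma> permutes {1..n}" by simp
      have "(\<Prod>k=1..n. \<integral>\<^sup>+s. ennreal (D (\<sigma> k) k s) \<partial>lborel) \<le> (\<Prod>k=1..n. ennreal (C1 * (w (\<sigma> k) * w (Suc n)) powr (2 * \<theta>)))"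
        using permutes_in_image[OF \<sigma>] by (intro prod_mono_ennreal DI) auto
      also have "\<dots> = ennreal (C1 ^ n * (\<Prod>k=1..n. (w (\<sigma> k) * w (Suc n)) powr (2 * \<theta>)))"
        using C1 by (simp add: prod_ennreal prod.distrib)
      also have "\<dots> \<le> ennreal (C1 ^ n * (\<Prod>j=1..Suc n. w j powr \<delta>))"
        using C1 by (intro ennreal_leI mult_left_mono exps[OF \<sigma>]) auto
      finally show "(\<Prod>k=1..n. \<integral>\<^sup>+s. ennreal (D (\<sigma> k) k s) \<partial>lborel) \<le> ennreal (C1 ^ n * (\<Prod>j=1..Suc n. w j powr \<delta>))" .
    qed simp
    also have "\<dots> = ennreal (C * (\<Prod>j=1..Suc n. w j powr \<delta>))"
    proof -
      have nn: "0 \<le> C1 ^ n * (\<Prod>j=1..Suc n. w j powr \<delta>)" using C1 by (intro mult_nonneg_nonneg prod_nonneg) auto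
      have "(\<Sum>\<sigma> | \<sigma> permutes {1..n}. ennreal (C1 ^ n * (\<Prod>j=1..Suc n. w j powr \<delta>))) = ennreal (fact n * (C1 ^ n * (\<Prod>j=1..Suc n. w j powr \<delta>)))"
        using nn by (simp add: sum_ennreal card_permutations del: prod.cl_ivl_Suc sum_constant) (simp add: card_permutations del: prod.cl_ivl_Suc)
      then show ?thesis
        using K C' by (simp add: C_def mult_ac flip: ennreal_mult' del: prod.cl_ivl_Suc)
    qed
    finally show "ennreal (cmod (vandermonde (Suc n) \<nu>)) * (\<integral>\<^sup>+t. ennreal (cmod (weights n (pattern n c \<nu> t))) \<partial>lborel_on (cells n))
     \<le> ennreal (C * (\<Prod>j=1..Suc n. (1 + cmod (\<nu> j)) powr \<delta>))"
      by (simp add: V_def w_def)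
  qed
qed

text \<open>
  For coinciding \<open>\<nu>\<close> the weighted bound is void. But then \<open>\<nu>\<close> can be replaced by a distinct row
  \<open>\<rho>\<close> on the same lines, which changes the finitely many denominators by bounded factors only.
\<close>
lemma weights_integral_finite:
  assumes asc: "ascending m c" and im: "\<forall>j\<in>{1..Suc m}. Im (\<nu> j) = c (Suc m) j"
  shows "(\<integral>\<^sup>+t. ennreal (cmod (weights m (pattern m c \<nu> t))) \<partial>lborel_on (cells m)) < \<infinity>"
proof -
  define \<rho> where "\<rho> = (\<lambda>j. Complex (real j) (c (Suc m) j))"
  have inj: "inj_on \<rho> {1..Suc m}" by (auto simp: inj_on_def \<rho>_def)
  have one: "0 < (1::real)" by simp
  obtain C0 where "\<And>\<nu>. (\<forall>j\<in>{1..Suc m}. Im (\<nu> j) = c (Suc m) j) \<Longrightarrow>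
     ennreal (cmod (vandermonde (Suc m) \<nu>)) * (\<integral>\<^sup>+t. ennreal (cmod (weights m (pattern m c \<nu> t))) \<partial>lborel_on (cells m))
     \<le> ennreal (C0 * (\<Prod>j=1..Suc m. (1 + cmod (\<nu> j)) powr 1))"
    using weights_bound[OF asc one] by blast
  from this[of \<rho>] obtain C where C: "ennreal (cmod (vandermonde (Suc m) \<rho>)) * (\<integral>\<^sup>+t. ennreal (cmod (weights m (pattern m c \<rho> t))) \<partial>lborel_on (cells m))
     \<le> ennreal C"
    by (simp add: \<rho>_def)
  have "cmod (vandermonde (Suc m) \<rho>) \<noteq> 0" using vandermonde_nonzero[OF inj] by simp
  with C have fin: "(\<integral>\<^sup>+t. ennreal (cmod (weights m (pattern m c \<rho> t))) \<partial>lborel_on (cells m)) < \<infinity>"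
    by (metis ennreal_eq_0_iff ennreal_less_top ennreal_mult_top infinity_ennreal_def less_top norm_ge_zero order_antisym_conv top.not_eq_extremum top.extremum_unique)
  show ?thesis
  proof (cases m)
    case 0
    then show ?thesis using fin by (simp add: weights_def)
  next
    case (Suc l)
    obtain d where d: "0 < d" "\<And>k q. k \<in> {1..m} \<Longrightarrow> q \<in> {1..Suc m} \<Longrightarrow> c m k + d \<le> c (Suc m) q"
      using ascending_gap asc Suc by metis
    define M where "M = (\<Prod>k=1..m. \<Prod>q=1..Suc m. 1 + cmod (\<nu> q - \<rho> q) / d)"
    have M0: "0 \<le> M" unfolding M_def using d(1) by (intro prod_nonneg) auto
    have pointwise: "cmod (weights m (pattern m c \<nu> t)) \<le> M * cmod (weights m (pattern m c \<rho> t))" for t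
    proof -
      let ?\<gamma> = "pattern m c \<nu> t"
      let ?\<gamma>' = "pattern m c \<rho> t"
      \<comment> \<open>The two arrays differ in the top row only, which occurs in the last row factor alone.\<close>
      have low: "?\<gamma> n = ?\<gamma>' n" if "n \<le> m" for n using that by (auto simp: pattern_def fun_eq_iff)
      define W where "W = (\<Prod>n=1..l. row_factor n (?\<gamma> n) (?\<gamma> (n + 1)))"
      have W: "W = (\<Prod>n=1..l. row_factor n (?\<gamma>' n) (?\<gamma>' (n + 1)))"
        unfolding W_def
      proof (intro prod.cong refl)
        fix n assume "n \<in> {1..l}"
        then show "row_factor n (?\<gamma> n) (?\<gamma> (n + 1)) = row_factor n (?\<gamma>' n) (?\<gamma>' (n + 1))"
          using low[of n] low[of "n + 1"] Suc by simp
      qed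
      have s1: "weights m ?\<gamma> = W * row_factor m (?\<gamma> m) (?\<gamma> (Suc m))"
        unfolding weights_def W_def Suc by simp
      have s2: "weights m ?\<gamma>' = W * row_factor m (?\<gamma> m) (?\<gamma>' (Suc m))"
        unfolding weights_def W Suc using low[of "Suc l"] Suc by simp
      define \<mu> where "\<mu> = ?\<gamma> m"
      have top: "?\<gamma> (Suc m) q = \<nu> q" "?\<gamma>' (Suc m) q = \<rho> q" if "q \<in> {1..Suc m}" for q
        using that by (auto simp: pattern_def)
      have far: "d \<le> cmod (\<mu> k - \<nu> q)" "d \<le> cmod (\<mu> k - \<rho> q)" if "k \<in> {1..m}" "q \<in> {1..Suc m}" for k q
      proof -
        have "Im (\<mu> k) = c m k" using that by (simp add: \<mu>_def pattern_def)
        then show "d \<le> cmod (\<mu> k - \<nu> q)" "d \<le> cmod (\<mu> k - \<rho> q)"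
          using d(2)[OF that] im that abs_Im_le_cmod[of "\<mu> k - \<nu> q"] abs_Im_le_cmod[of "\<mu> k - \<rho> q"]
          by (auto simp: \<rho>_def)
      qed
      have "(\<Prod>k=1..m. \<Prod>q=1..Suc m. cmod (\<mu> k - \<rho> q)) \<le> (\<Prod>k=1..m. \<Prod>q=1..Suc m. (1 + cmod (\<nu> q - \<rho> q) / d) * cmod (\<mu> k - \<nu> q))"
      proof (intro prod_mono conjI prod_nonneg)
        fix k q assume kq: "k \<in> {1..m}" "q \<in> {1..Suc m}"
        have "cmod (\<mu> k - \<rho> q) \<le> cmod (\<mu> k - \<nu> q) + cmod (\<nu> q - \<rho> q)"
          using norm_triangle_ineq[of "\<mu> k - \<nu> q" "\<nu> q - \<rho> q"] by simp
        also have "cmod (\<nu> q - \<rho> q) \<le> cmod (\<nu> q - \<rho> q) * (cmod (\<mu> k - \<nu> q) / d)"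
          using far(1)[OF kq] d(1) by (intro mult_le_cancel_left1[THEN iffD2]) auto
        finally show "cmod (\<mu> k - \<rho> q) \<le> (1 + cmod (\<nu> q - \<rho> q) / d) * cmod (\<mu> k - \<nu> q)"
          by (simp add: algebra_simps)
      qed auto
      also have "\<dots> = M * (\<Prod>k=1..m. \<Prod>q=1..Suc m. cmod (\<mu> k - \<nu> q))"
        by (simp only: M_def prod.distrib)
      finally have le: "(\<Prod>k=1..m. \<Prod>q=1..Suc m. cmod (\<mu> k - \<rho> q)) \<le> M * (\<Prod>k=1..m. \<Prod>q=1..Suc m. cmod (\<mu> k - \<nu> q))" .
      have pos: "0 < (\<Prod>k=1..m. \<Prod>q=1..Suc m. cmod (\<mu> k - \<nu> q))" "0 < (\<Prod>k=1..m. \<Prod>q=1..Suc m. cmod (\<mu> k - \<rho> q))"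
        by (intro prod_pos ballI less_le_trans[OF d(1)] far; assumption)+
      have "1 / (\<Prod>k=1..m. \<Prod>q=1..Suc m. cmod (\<mu> k - \<nu> q)) \<le> M / (\<Prod>k=1..m. \<Prod>q=1..Suc m. cmod (\<mu> k - \<rho> q))"
      proof -
        have "1 / A \<le> M / B" if "0 < A" "0 < B" "B \<le> M * A" for A B :: real
          using that by (simp add: field_simps)
        from this[OF pos le] show ?thesis .
      qed
      then have "cmod (vandermonde m \<mu>) ^ 2 / fact m * (1 / (\<Prod>k=1..m. \<Prod>q=1..Suc m. cmod (\<mu> k - \<nu> q)))
         \<le> cmod (vandermonde m \<mu>) ^ 2 / fact m * (M / (\<Prod>k=1..m. \<Prod>q=1..Suc m. cmod (\<mu> k - \<rho> q)))"
        by (rule mult_left_mono) simp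
      then have "cmod (row_factor m \<mu> \<nu>) \<le> M * cmod (row_factor m \<mu> \<rho>)"
        unfolding norm_row_factor by (simp add: mult_ac)
      moreover have "row_factor m \<mu> (?\<gamma> (Suc m)) = row_factor m \<mu> \<nu>" "row_factor m \<mu> (?\<gamma>' (Suc m)) = row_factor m \<mu> \<rho>"
        using top by (auto intro!: row_factor_cong)
      ultimately show ?thesis
        unfolding s1 s2 \<mu>_def[symmetric] norm_mult
        by (simp add: mult_left_mono mult.left_commute[of M])
    qed
    have meas: "(\<lambda>t. ennreal (cmod (weights m (pattern m c \<rho> t)))) \<in> borel_measurable (lborel_on (cells m))"
      using weights_measurable by measurable
    have "(\<integral>\<^sup>+t. ennreal (cmod (weights m (pattern m c \<nu> t))) \<partial>lborel_on (cells m))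
       \<le> (\<integral>\<^sup>+t. ennreal M * ennreal (cmod (weights m (pattern m c \<rho> t))) \<partial>lborel_on (cells m))"
      using M0 by (intro nn_integral_mono order.trans[OF ennreal_leI[OF pointwise]]) (simp add: ennreal_mult')
    also have "\<dots> = ennreal M * (\<integral>\<^sup>+t. ennreal (cmod (weights m (pattern m c \<rho> t))) \<partial>lborel_on (cells m))"
      by (rule nn_integral_cmult[OF meas])
    also have "\<dots> < \<infinity>" using fin by (simp add: ennreal_mult_less_top)
    finally show ?thesis .
  qed
qed

text \<open>
  On horizontal lines the exponential factor has constant modulus.
\<close>
lemma whittaker_integrand_integrable:
  assumes asc: "ascending m c" and im: "\<forall>j\<in>{1..Suc m}. Im (\<nu> j) = c (Suc m) j"
  shows "integrable (lborel_on (cells m)) (\<lambda>t. whittaker_integrand m (pattern m c \<nu> t) x)"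
proof (rule integrableI_bounded[OF whittaker_integrand_measurable])
  define E where "E = (\<lambda>t. exp (- (\<Sum>n=1..m + 1. \<Sum>j=1..n. (Im (pattern m c \<nu> t n j) - Im (pattern m c \<nu> t (n - 1) j)) * x n)))"
  have E: "E t = E (\<lambda>_. 0)" for t
    unfolding E_def by (intro arg_cong[where f = exp] arg_cong[where f = uminus] sum.cong refl) (auto simp: pattern_def)
  have eq: "cmod (whittaker_integrand m (pattern m c \<nu> t) x) = E (\<lambda>_. 0) * cmod (weights m (pattern m c \<nu> t))" for t
    unfolding whittaker_integrand_weights norm_mult E[of t, symmetric] norm_exp_eq_Re
    by (simp add: E_def)
  have meas: "(\<lambda>t. ennreal (cmod (weights m (pattern m c \<nu> t)))) \<in> borel_measurable (lborel_on (cells m))"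
    using weights_measurable by measurable
  have "(\<integral>\<^sup>+t. ennreal (cmod (whittaker_integrand m (pattern m c \<nu> t) x)) \<partial>lborel_on (cells m))
      = ennreal (E (\<lambda>_. 0)) * (\<integral>\<^sup>+t. ennreal (cmod (weights m (pattern m c \<nu> t))) \<partial>lborel_on (cells m))"
    unfolding eq by (subst nn_integral_cmult[OF meas, symmetric]) (simp add: ennreal_mult' E_def)
  also have "\<dots> < \<infinity>"
    using weights_integral_finite[OF assms] by (simp add: ennreal_mult_less_top)
  finally show "(\<integral>\<^sup>+t. ennreal (norm (whittaker_integrand m (pattern m c \<nu> t) x)) \<partial>lborel_on (cells m)) < \<infinity>" by simp
qed

section \<open>Evaluation of the integral\<close>

lemma fdet_product_sum:
  "(\<Sum>\<sigma> | \<sigma> permutes {0..<n}. \<Sum>\<tau> | \<tau> permutes {0..<n}. of_int (sign \<sigma>) * of_int (sign \<tau>) *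
      (\<Prod>j<n. T (Suc (\<sigma> j)) (Suc (\<tau> j)))) = fact n * fdet n T"
proof -
  have "(\<Sum>\<tau> | \<tau> permutes {0..<n}. of_int (sign \<sigma>) * of_int (sign \<tau>) * (\<Prod>j<n. T (Suc (\<sigma> j)) (Suc (\<tau> j)))) = fdet n T"
    if \<sigma>: "\<sigma> permutes {0..<n}" for \<sigma>
  proof -
    let ?g = "\<lambda>\<tau>. of_int (sign \<sigma>) * of_int (sign \<tau>) * (\<Prod>j<n. T (Suc (\<sigma> j)) (Suc (\<tau> j)))"
    have "(\<Sum>\<tau> | \<tau> permutes {0..<n}. ?g \<tau>) = (\<Sum>\<tau> | \<tau> permutes {0..<n}. ?g (\<tau> \<circ> \<sigma>))"
      by (rule sum_permutations_compose_right[OF \<sigma>])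
    also have "\<dots> = (\<Sum>\<tau> | \<tau> permutes {0..<n}. of_int (sign \<tau>) * (\<Prod>j<n. T (Suc j) (Suc (\<tau> j))))"
    proof (intro sum.cong refl)
      fix \<tau> assume "\<tau> \<in> {\<tau>. \<tau> permutes {0..<n}}"
      then have \<tau>: "\<tau> permutes {0..<n}" by simp
      have "sign (\<tau> \<circ> \<sigma>) = sign \<tau> * sign \<sigma>"
        using \<sigma> \<tau> by (intro sign_compose permutes_imp_permutation[of "{0..<n}"]) auto
      moreover have "(\<Prod>j<n. T (Suc (\<sigma> j)) (Suc ((\<tau> \<circ> \<sigma>) j))) = (\<Prod>j<n. T (Suc j) (Suc (\<tau> j)))"
        using prod.permute[OF \<sigma>, of "\<lambda>j. T (Suc j) (Suc (\<tau> j))"] by (simp add: o_def atLeast0LessThan)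
      moreover have "(of_int (sign \<sigma>) * of_int (sign \<sigma>) :: complex) = 1"
        by (simp add: sign_def)
      ultimately show "?g (\<tau> \<circ> \<sigma>) = of_int (sign \<tau>) * (\<Prod>j<n. T (Suc j) (Suc (\<tau> j)))"
        by (simp add: mult_ac)
    qed
    also have "\<dots> = fdet n (\<lambda>i j. T j i)" by (simp add: fdet_sum)
    also have "\<dots> = fdet n T" by (rule fdet_transpose)
    finally show ?thesis .
  qed
  then have "(\<Sum>\<sigma> | \<sigma> permutes {0..<n}. \<Sum>\<tau> | \<tau> permutes {0..<n}. of_int (sign \<sigma>) * of_int (sign \<tau>) *
      (\<Prod>j<n. T (Suc (\<sigma> j)) (Suc (\<tau> j)))) = (\<Sum>\<sigma> | \<sigma> permutes {0..<n}. fdet n T)"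
    by (intro sum.cong) auto
  then show ?thesis by (simp add: card_permutations[of _ n])
qed

text \<open>
  This is Andreief's identity. The functions \<open>p\<close> and \<open>q\<close> may depend on the index \<open>j\<close> of the variable, as they do
  when each variable runs on its own line; only the integrals of the products have to be the same for
  all \<open>j\<close>.
\<close>
lemma andreief:
  assumes int: "\<And>a b j. a \<in> {1..n} \<Longrightarrow> b \<in> {1..n} \<Longrightarrow> j \<in> {1..n} \<Longrightarrow> integrable lborel (\<lambda>s. p a j s * q b j s)"
    and T: "\<And>a b j. a \<in> {1..n} \<Longrightarrow> b \<in> {1..n} \<Longrightarrow> j \<in> {1..n} \<Longrightarrow> (\<integral>s. p a j s * q b j s \<partial>lborel) = T a b"
  shows "(\<integral>s. fdet n (\<lambda>a j. p a j (s (n, j))) * fdet n (\<lambda>b j. q b j (s (n, j))) \<partial>lborel_on (row n)) = fact n * fdet n T"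
proof -
  interpret product_sigma_finite "\<lambda>_ :: nat \<times> nat. lborel :: real measure"
    by (rule product_sigma_finite_lborel)
  let ?P = "{\<sigma>. \<sigma> permutes {0..<n}}"
  have reindex: "(\<Prod>j<n. h (Suc j)) = (\<Prod>i\<in>row n. h (snd i))" for h :: "nat \<Rightarrow> complex"
    unfolding row_def by (subst prod.reindex) (auto simp: inj_on_def prod.atLeast1_atMost_eq)
  have reindex': "(\<Prod>j<n. h (Suc j) (s (n, Suc j))) = (\<Prod>i\<in>row n. h (snd i) (s i))" for h :: "nat \<Rightarrow> real \<Rightarrow> complex" and s
    unfolding row_def by (subst prod.reindex) (auto simp: inj_on_def prod.atLeast1_atMost_eq)
  have in_range: "Suc (\<sigma> (j - 1)) \<in> {1..n}" if "\<sigma> \<in> ?P" "j \<in> {1..n}" for \<sigma> j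
    using that permutes_in_image[of \<sigma> "{0..<n}" "j - 1"] by (auto simp: Suc_le_eq)
  define F where "F = (\<lambda>\<sigma> \<tau> j s. p (Suc (\<sigma> (j - 1))) j s * q (Suc (\<tau> (j - 1))) j s)"
  have Fint: "integrable lborel (F \<sigma> \<tau> j)" if "\<sigma> \<in> ?P" "\<tau> \<in> ?P" "j \<in> {1..n}" for \<sigma> \<tau> j
    unfolding F_def by (intro int in_range that)
  have term_int: "integrable (lborel_on (row n)) (\<lambda>s. \<Prod>j<n. F \<sigma> \<tau> (Suc j) (s (n, Suc j)))" if "\<sigma> \<in> ?P" "\<tau> \<in> ?P" for \<sigma> \<tau>
    unfolding reindex'[of "F \<sigma> \<tau>"]
    by (rule product_integrable_prod[OF finite_row]) (use Fint[OF that] in \<open>auto simp: row_def\<close>)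
  have term_val: "(\<integral>s. (\<Prod>j<n. F \<sigma> \<tau> (Suc j) (s (n, Suc j))) \<partial>lborel_on (row n)) = (\<Prod>j<n. T (Suc (\<sigma> j)) (Suc (\<tau> j)))"
    if "\<sigma> \<in> ?P" "\<tau> \<in> ?P" for \<sigma> \<tau>
  proof -
    have "(\<integral>s. (\<Prod>j<n. F \<sigma> \<tau> (Suc j) (s (n, Suc j))) \<partial>lborel_on (row n)) = (\<Prod>i\<in>row n. \<integral>s. F \<sigma> \<tau> (snd i) s \<partial>lborel)"
      unfolding reindex'[of "F \<sigma> \<tau>"]
      by (rule product_integral_prod[OF finite_row]) (use Fint[OF that] in \<open>auto simp: row_def\<close>)
    also have "\<dots> = (\<Prod>j<n. \<integral>s. F \<sigma> \<tau> (Suc j) s \<partial>lborel)" by (rule reindex[symmetric])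
    also have "\<dots> = (\<Prod>j<n. T (Suc (\<sigma> j)) (Suc (\<tau> j)))"
    proof (intro prod.cong refl)
      fix j assume "j \<in> {..<n}"
      then show "(\<integral>s. F \<sigma> \<tau> (Suc j) s \<partial>lborel) = T (Suc (\<sigma> j)) (Suc (\<tau> j))"
        unfolding F_def using in_range[OF that(1), of "Suc j"] in_range[OF that(2), of "Suc j"] by (subst T) auto
    qed
    finally show ?thesis .
  qed
  have "fdet n (\<lambda>a j. p a j (s (n, j))) * fdet n (\<lambda>b j. q b j (s (n, j)))
     = (\<Sum>\<sigma>\<in>?P. \<Sum>\<tau>\<in>?P. of_int (sign \<sigma>) * of_int (sign \<tau>) * (\<Prod>j<n. F \<sigma> \<tau> (Suc j) (s (n, Suc j))))" for s
    unfolding fdet_sum sum_product F_def by (simp add: prod.distrib mult_ac)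
  then have "(\<integral>s. fdet n (\<lambda>a j. p a j (s (n, j))) * fdet n (\<lambda>b j. q b j (s (n, j))) \<partial>lborel_on (row n))
     = (\<integral>s. (\<Sum>\<sigma>\<in>?P. \<Sum>\<tau>\<in>?P. of_int (sign \<sigma>) * of_int (sign \<tau>) * (\<Prod>j<n. F \<sigma> \<tau> (Suc j) (s (n, Suc j)))) \<partial>lborel_on (row n))"
    by simp
  also have "\<dots> = (\<Sum>\<sigma>\<in>?P. \<Sum>\<tau>\<in>?P. of_int (sign \<sigma>) * of_int (sign \<tau>) * (\<Prod>j<n. T (Suc (\<sigma> j)) (Suc (\<tau> j))))"
  proof -
    have int2: "integrable (lborel_on (row n)) (\<lambda>s. of_int (sign \<sigma>) * of_int (sign \<tau>) * (\<Prod>j<n. F \<sigma> \<tau> (Suc j) (s (n, Suc j))))"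
      if "\<sigma> \<in> ?P" "\<tau> \<in> ?P" for \<sigma> \<tau>
      using integrable_mult_right[OF term_int[OF that]] .
    have "(\<integral>s. (\<Sum>\<tau>\<in>?P. of_int (sign \<sigma>) * of_int (sign \<tau>) * (\<Prod>j<n. F \<sigma> \<tau> (Suc j) (s (n, Suc j)))) \<partial>lborel_on (row n))
       = (\<Sum>\<tau>\<in>?P. of_int (sign \<sigma>) * of_int (sign \<tau>) * (\<Prod>j<n. T (Suc (\<sigma> j)) (Suc (\<tau> j))))" if "\<sigma> \<in> ?P" for \<sigma>
      by (subst Bochner_Integration.integral_sum[OF int2[OF that]])
         (use that in \<open>simp_all add: term_val\<close>)
    then show ?thesis
      by (subst Bochner_Integration.integral_sum) (intro Bochner_Integration.integrable_sum int2, simp_all)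
  qed
  also have "\<dots> = fact n * fdet n T" by (rule fdet_product_sum)
  finally show ?thesis .
qed

lemma antidiagonal_square: "fdet n (antidiagonal n) * fdet n (antidiagonal n) = 1"
proof -
  have "fdet n (antidiagonal n) * fdet n (antidiagonal n) = fdet n (\<lambda>i j. \<Sum>k=1..n. antidiagonal n i k * antidiagonal n k j)"
    by (rule fdet_mult[symmetric])
  also have "\<dots> = fdet n (\<lambda>i j. if i = j then 1 else 0)"
  proof (rule fdet_cong)
    fix i j assume ij: "i \<in> {1..n}" "j \<in> {1..n}"
    have "(\<Sum>k=1..n. antidiagonal n i k * antidiagonal n k j) = (\<Sum>k=1..n. if k = Suc n - i then antidiagonal n k j else 0)"
      using ij by (intro sum.cong) (auto simp: antidiagonal_def)
    also have "\<dots> = antidiagonal n (Suc n - i) j" using ij by (subst sum.delta) auto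
    also have "\<dots> = (if i = j then 1 else 0)" using ij by (auto simp: antidiagonal_def)
    finally show "(\<Sum>k=1..n. antidiagonal n i k * antidiagonal n k j) = (if i = j then 1 else 0)" .
  qed
  also have "\<dots> = 1" by (subst fdet_upper_triangular) auto
  finally show ?thesis .
qed

lemma chain_le:
  fixes x :: "nat \<Rightarrow> real"
  assumes "\<forall>k\<in>{1..m}. x (Suc k) \<le> x k" "1 \<le> k" "k \<le> Suc m"
  shows "x (Suc m) \<le> x k"
  using assms(3,2,1)
  by (induction k rule: inc_induct) (auto intro: order_trans)

text \<open>
  The constant \<open>K\<close> depends neither on the top row nor on \<open>x\<close>; in the induction step the formula is
  applied to a top row that is an integration variable, and \<open>K\<close> has to leave the integral.
\<close>
lemma whittaker_integral_formula:
  assumes "ascending m c"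
  shows "\<exists>K. \<forall>\<nu> x R. (\<forall>j\<in>{1..Suc m}. Im (\<nu> j) = c (Suc m) j) \<longrightarrow> (\<forall>k\<in>{1..m}. x (Suc k) \<le> x k) \<longrightarrow>
     encloses R \<nu> (Suc m) \<longrightarrow>
     (\<integral>t. whittaker_integrand m (pattern m c \<nu> t) x \<partial>lborel_on (cells m))
       = K * fdet (Suc m) (\<lambda>i k. divdiff R \<nu> i (\<lambda>z. exp (\<i> * z * of_real (x k))))"
  using assms
proof (induction m)
  case 0
  show ?case
  proof (intro exI[of _ 1] allI impI)
    fix \<nu> and x :: "nat \<Rightarrow> real" and R assume e: "encloses R \<nu> (Suc 0)"
    let ?e = "\<lambda>z. exp (\<i> * z * of_real (x 1))"
    have "(\<integral>t. whittaker_integrand 0 (pattern 0 c \<nu> t) x \<partial>lborel_on (cells 0)) = ?e (\<nu> 1)"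
      by (simp add: cells_0 whittaker_integrand_weights weights_def pattern_def space_PiM_empty measure_def mult.assoc)
    also have "\<dots> = divdiff R \<nu> 1 ?e"
      using divdiff_first[of R \<nu> ?e] e by (simp add: holomorphic_intros)
    also have "\<dots> = 1 * fdet (Suc 0) (\<lambda>i k. divdiff R \<nu> i (\<lambda>z. exp (\<i> * z * of_real (x k))))"
      by (subst fdet_upper_triangular) auto
    finally show "(\<integral>t. whittaker_integrand 0 (pattern 0 c \<nu> t) x \<partial>lborel_on (cells 0))
       = 1 * fdet (Suc 0) (\<lambda>i k. divdiff R \<nu> i (\<lambda>z. exp (\<i> * z * of_real (x k))))" .
  qed
next
  case (Suc m)
  interpret product_sigma_finite "\<lambda>_ :: nat \<times> nat. lborel :: real measure"
    by (rule product_sigma_finite_lborel)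
  define n where "n = Suc m"
  obtain K where IH: "\<And>\<mu> x R. (\<forall>j\<in>{1..n}. Im (\<mu> j) = c n j) \<Longrightarrow> (\<forall>k\<in>{1..m}. x (Suc k) \<le> x k) \<Longrightarrow>
     encloses R \<mu> n \<Longrightarrow>
     (\<integral>t. whittaker_integrand m (pattern m c \<mu> t) x \<partial>lborel_on (cells m))
       = K * fdet n (\<lambda>i k. divdiff R \<mu> i (\<lambda>z. exp (\<i> * z * of_real (x k))))"
    using Suc.IH[OF ascending_Suc[OF Suc.prems]] unfolding n_def by blast
  obtain d where d: "0 < d" "\<And>k q. k \<in> {1..n} \<Longrightarrow> q \<in> {1..Suc n} \<Longrightarrow> c n k + d \<le> c (Suc n) q"
    using ascending_gap[OF Suc.prems] unfolding n_def by blast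
  define sg where "sg = (\<Prod>k=1..n. (- 1) ^ (k - 1) :: complex)"
  define ad where "ad = fdet n (antidiagonal n)"
  define L where "L = K * sg * ad * (2 * of_real pi * \<i>) ^ n * (- 1) ^ n"
  show ?case unfolding n_def[symmetric]
  proof (intro exI[of _ L] allI impI)
    fix \<nu> and x :: "nat \<Rightarrow> real" and R
    assume im: "\<forall>j\<in>{1..Suc n}. Im (\<nu> j) = c (Suc n) j" and x: "\<forall>k\<in>{1..n}. x (Suc k) \<le> x k"
      and e: "encloses R \<nu> (Suc n)"
    define y where "y = (\<lambda>k. x k - x (Suc n))"
    have y: "0 \<le> y k" if "k \<in> {1..n}" for k
      using chain_le[OF x, of k] that by (simp add: y_def)
    define G where "G = exp (\<i> * (\<Sum>r=1..Suc n. \<nu> r) * of_real (x (Suc n)))"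
    \<comment> \<open>\<open>p\<close> is the rational part, \<open>q\<close> the exponential part; the factor \<open>exp(- \<i> x\<^bsub>n+1\<^esub> \<Sum> \<mu>\<^sub>j)\<close> shifts \<open>x\<^sub>k\<close> to \<open>y\<^sub>k\<close>.\<close>
    define p where "p = (\<lambda>a j s. (\<Prod>r=a+2..n+1. Complex s (c n j) - \<nu> r) / (\<Prod>r=1..Suc n. Complex s (c n j) - \<nu> r))"
    define q where "q = (\<lambda>k j s. exp (\<i> * Complex s (c n j) * of_real (y k)))"
    have pq: "p a j s * q k j s = exp (\<i> * Complex s (c n j) * of_real (y k)) / (\<Prod>r=1..Suc a. Complex s (c n j) - \<nu> r)"
      if "a \<in> {1..n}" "j \<in> {1..n}" for a j k s
    proof -
      have split: "(\<Prod>r=1..Suc n. Complex s (c n j) - \<nu> r)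
          = (\<Prod>r=1..Suc a. Complex s (c n j) - \<nu> r) * (\<Prod>r=a+2..n+1. Complex s (c n j) - \<nu> r)"
      proof -
        have "{1..Suc n} = {1..Suc a} \<union> {a+2..n+1}" using that by auto
        then show ?thesis by (simp only:) (rule prod.union_disjoint; simp)
      qed
      have "(\<Prod>r=a+2..n+1. Complex s (c n j) - \<nu> r) \<noteq> 0"
      proof -
        have "Complex s (c n j) \<noteq> \<nu> r" if "r \<in> {a+2..n+1}" for r
        proof -
          have "c n j < Im (\<nu> r)" using d(1) d(2)[of j r] im that \<open>j \<in> {1..n}\<close> by auto
          then show ?thesis by (metis complex.sel(2) less_irrefl)
        qed
        then show ?thesis by auto
      qed
      then show ?thesis unfolding p_def q_def split by simp
    qed
    have below: "c n j < Im (\<nu> r)" if "j \<in> {1..n}" "r \<in> {1..Suc n}" for j r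
      using d(1) d(2)[OF that] im that by auto
    have inner: "(\<integral>t. whittaker_integrand n (pattern n c \<nu> (merge (row n) (cells m) (s, t))) x \<partial>lborel_on (cells m))
        = K * sg * ad * G / fact n * (fdet n (\<lambda>a j. p a j (s (n, j))) * fdet n (\<lambda>k j. q k j (s (n, j))))" for s
    proof -
      define \<mu> where "\<mu> = row_point c n s"
      have \<mu>k: "\<mu> k = Complex (s (n, k)) (c n k)" for k by (simp add: \<mu>_def row_point_def)
      obtain R' where e': "encloses R' \<mu> n" using encloses_exists by blast
      define D where "D = fdet n (\<lambda>i k. divdiff R' \<mu> i (\<lambda>z. exp (\<i> * z * of_real (x k))))"
      define P where "P = (\<Prod>j=1..n. \<Prod>r=1..Suc n. \<mu> j - \<nu> r)"
      define E where "E = exp (- (\<i> * (\<Sum>j=1..n. \<mu> j) * of_real (x (Suc n))))"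
      have "(\<integral>t. whittaker_integrand n (pattern n c \<nu> (merge (row n) (cells m) (s, t))) x \<partial>lborel_on (cells m))
        = row_factor n \<mu> \<nu> * exp (\<i> * ((\<Sum>j=1..Suc n. \<nu> j) - (\<Sum>j=1..n. \<mu> j)) * of_real (x (Suc n)))
          * (\<integral>t. whittaker_integrand m (pattern m c \<mu> t) x \<partial>lborel_on (cells m))"
        unfolding n_def whittaker_integrand_Suc_merge \<mu>_def by (rule integral_mult_right_zero)
      also have "(\<integral>t. whittaker_integrand m (pattern m c \<mu> t) x \<partial>lborel_on (cells m)) = K * D"
        unfolding D_def using x by (intro IH e') (auto simp: \<mu>k n_def)
      also have "exp (\<i> * ((\<Sum>j=1..Suc n. \<nu> j) - (\<Sum>j=1..n. \<mu> j)) * of_real (x (Suc n))) = G * E"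
        by (simp add: G_def E_def algebra_simps flip: exp_add)
      also have "row_factor n \<mu> \<nu> = sg * vandermonde n \<mu> ^ 2 / (fact n * P)"
        by (simp only: row_factor_def prod_offdiag_vandermonde sg_def P_def Suc_eq_plus1)
      finally have 1: "(\<integral>t. whittaker_integrand n (pattern n c \<nu> (merge (row n) (cells m) (s, t))) x \<partial>lborel_on (cells m))
         = K * sg * G / fact n * ((vandermonde n \<mu> / P) * (E * (vandermonde n \<mu> * D)))"
        by (simp add: power2_eq_square mult_ac)
      have "vandermonde n \<mu> * D = fdet n (\<lambda>j k. exp (\<i> * \<mu> j * of_real (x k)))"
        unfolding D_def by (intro vandermonde_mult_divdiff e' holomorphic_intros)
      also have "\<dots> = fdet n (\<lambda>k j. exp (\<i> * \<mu> j * of_real (x k)))"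
        by (rule fdet_transpose)
      also have "E * \<dots> = fdet n (\<lambda>k j. exp (- (\<i> * \<mu> j * of_real (x (Suc n)))) * exp (\<i> * \<mu> j * of_real (x k)))"
      proof -
        have "E = (\<Prod>j=1..n. exp (- (\<i> * \<mu> j * of_real (x (Suc n)))))"
          by (simp add: E_def exp_sum[symmetric] sum_distrib_left sum_distrib_right sum_negf)
        then show ?thesis by (simp only: fdet_scale_columns)
      qed
      also have "\<dots> = fdet n (\<lambda>k j. q k j (s (n, j)))"
        by (simp add: q_def \<mu>k y_def algebra_simps flip: exp_add)
      finally have 2: "E * (vandermonde n \<mu> * D) = fdet n (\<lambda>k j. q k j (s (n, j)))" .
      \<comment> \<open>The reversal of the columns is an involution, so its determinant \<open>ad\<close> squares to \<open>1\<close>.\<close>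
      have "vandermonde n \<mu> = ad * (vandermonde n \<mu> * ad)"
        using antidiagonal_square[of n] by (simp add: ad_def mult.left_commute[of "fdet n (antidiagonal n)"])
      also have "vandermonde n \<mu> * ad = fdet n (\<lambda>j a. \<Prod>r=a+2..n+1. \<mu> j - \<nu> r)"
        unfolding ad_def by (rule fdet_monic_basis[symmetric])
      also have "\<dots> = fdet n (\<lambda>a j. \<Prod>r=a+2..n+1. \<mu> j - \<nu> r)"
        by (rule fdet_transpose)
      finally have "vandermonde n \<mu> / P = ad * ((1 / P) * fdet n (\<lambda>a j. \<Prod>r=a+2..n+1. \<mu> j - \<nu> r))"
        by simp
      also have "(1 / P) * fdet n (\<lambda>a j. \<Prod>r=a+2..n+1. \<mu> j - \<nu> r)
          = fdet n (\<lambda>a j. (1 / (\<Prod>r=1..Suc n. \<mu> j - \<nu> r)) * (\<Prod>r=a+2..n+1. \<mu> j - \<nu> r))"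
        unfolding fdet_scale_columns P_def by (simp add: prod_dividef)
      also have "\<dots> = fdet n (\<lambda>a j. p a j (s (n, j)))"
        by (simp add: p_def \<mu>k)
      finally have 3: "vandermonde n \<mu> / P = ad * fdet n (\<lambda>a j. p a j (s (n, j)))" .
      show ?thesis unfolding 1 2 3 by (simp add: mult_ac)
    qed
    define T where "T = (\<lambda>a k. 2 * of_real pi * \<i> * divdiff R \<nu> (Suc a) (\<lambda>z. exp (\<i> * z * of_real (y k))))"
    have andr: "(\<integral>s. fdet n (\<lambda>a j. p a j (s (n, j))) * fdet n (\<lambda>k j. q k j (s (n, j))) \<partial>lborel_on (row n)) = fact n * fdet n T"
    proof (rule andreief)
      fix a k j assume r: "a \<in> {1..n}" "k \<in> {1..n}" "j \<in> {1..n}"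
      show "integrable lborel (\<lambda>s. p a j s * q k j s)"
        unfolding pq[OF r(1,3)] using r below by (intro integrable_line_prod) auto
      show "(\<integral>s. p a j s * q k j s \<partial>lborel) = T a k"
        unfolding pq[OF r(1,3)] T_def using r below
        by (intro line_integral_divdiff encloses_mono[OF e] y) auto
    qed
    have "(\<integral>t. whittaker_integrand n (pattern n c \<nu> t) x \<partial>lborel_on (cells n))
       = (\<integral>s. (\<integral>t. whittaker_integrand n (pattern n c \<nu> (merge (row n) (cells m) (s, t))) x \<partial>lborel_on (cells m)) \<partial>lborel_on (row n))"
    proof -
      have "integrable (lborel_on (row n \<union> cells m)) (\<lambda>t. whittaker_integrand n (pattern n c \<nu> t) x)"
        using whittaker_integrand_integrable[of n c \<nu> x] Suc.prems im by (simp add: n_def cells_Suc)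
      from product_integral_fold[OF _ finite_row finite_cells this] show ?thesis
        using row_cells_disjoint[of m] by (simp add: n_def cells_Suc)
    qed
    also have "\<dots> = K * sg * ad * G / fact n * (fact n * fdet n T)"
      unfolding inner andr[symmetric] by (rule integral_mult_right_zero)
    also have "fdet n T = (2 * of_real pi * \<i>) ^ n * fdet n (\<lambda>i k. divdiff R \<nu> (Suc i) (\<lambda>z. exp (\<i> * z * of_real (y k))))"
      unfolding T_def fdet_scale_columns by simp
    also have "K * sg * ad * G / fact n * (fact n * ((2 * of_real pi * \<i>) ^ n * fdet n (\<lambda>i k. divdiff R \<nu> (Suc i) (\<lambda>z. exp (\<i> * z * of_real (y k))))))
       = L * (G * (- 1) ^ n * fdet n (\<lambda>i k. divdiff R \<nu> (Suc i) (\<lambda>z. exp (\<i> * z * of_real (y k)))))"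
      by (simp add: L_def mult_ac flip: power_mult_distrib)
    also have "G * (- 1) ^ n * fdet n (\<lambda>i k. divdiff R \<nu> (Suc i) (\<lambda>z. exp (\<i> * z * of_real (y k))))
       = fdet (Suc n) (\<lambda>i k. divdiff R \<nu> i (\<lambda>z. exp (\<i> * z * of_real (x k))))"
      unfolding G_def y_def by (rule fdet_divdiff_exp_translate[OF e, symmetric])
    finally show "(\<integral>t. whittaker_integrand n (pattern n c \<nu> t) x \<partial>lborel_on (cells n))
       = L * fdet (Suc n) (\<lambda>i k. divdiff R \<nu> i (\<lambda>z. exp (\<i> * z * of_real (x k))))" .
  qed
qed

section \<open>The determinant as a function on the chamber\<close>

text \<open>
  The exponents \<open>m\<close> record how often each variable has been differentiated.
\<close>
definition exp_det ::
  "real \<Rightarrow> (nat \<Rightarrow> complex) \<Rightarrow> nat \<Rightarrow> (nat \<Rightarrow> nat) \<Rightarrow> (nat \<Rightarrow> real) \<Rightarrow> complex" where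
  "exp_det R \<nu> n m x = fdet n (\<lambda>i k. divdiff R \<nu> i (\<lambda>z. (\<i> * z) ^ m k * exp (\<i> * z * of_real (x k))))"

lemma exp_det_cong:
  assumes "\<And>k. k \<in> {1..n} \<Longrightarrow> m k = m' k" "\<And>k. k \<in> {1..n} \<Longrightarrow> x k = x' k"
  shows "exp_det R \<nu> n m x = exp_det R \<nu> n m' x'"
  unfolding exp_det_def using assms by (intro fdet_cong) simp

lemma divdiff_power_exp_has_vector_derivative:
  assumes "encloses R \<nu> j"
  shows "((\<lambda>y. divdiff R \<nu> j (\<lambda>z. (\<i> * z) ^ a * exp (\<i> * z * of_real y))) has_vector_derivative
      divdiff R \<nu> j (\<lambda>z. (\<i> * z) ^ Suc a * exp (\<i> * z * of_real y))) (at y)"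
proof -
  have "continuous_on UNIV (\<lambda>z::complex. (\<i> * z) ^ a)" by (intro continuous_intros)
  from divdiff_exp_has_vector_derivative[OF assms this, of y] show ?thesis
    by (simp add: mult_ac)
qed

lemma exp_det_has_vector_derivative:
  assumes e: "encloses R \<nu> n" and k: "k \<in> {1..n}"
  shows "((\<lambda>t. exp_det R \<nu> n m (x(k := t))) has_vector_derivative
      exp_det R \<nu> n (m(k := Suc (m k))) x) (at (x k))"
proof -
  define A where "A = (\<lambda>(m :: nat \<Rightarrow> nat) (y :: nat \<Rightarrow> real) i k. divdiff R \<nu> i (\<lambda>z. (\<i> * z) ^ m k * exp (\<i> * z * of_real (y k))))"
  have expand: "exp_det R \<nu> n m' y
      = (\<Sum>\<sigma> | \<sigma> permutes {0..<n}. of_int (sign \<sigma>) * (A m' y (Suc (\<sigma> (k - 1))) k * (\<Prod>j\<in>{..<n} - {k - 1}. A m' y (Suc (\<sigma> j)) (Suc j))))" for m' y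
    unfolding exp_det_def fdet_sum A_def
    by (intro sum.cong refl arg_cong2[where f = "(*)"], subst prod.remove[of _ "k - 1"]) (use k in auto)
  have rest: "A m (x(k := t)) i (Suc j) = A m x i (Suc j)" "A (m(k := Suc (m k))) x i (Suc j) = A m x i (Suc j)"
    if "j \<in> {..<n} - {k - 1}" for i j t
    using that k by (auto simp: A_def)
  show ?thesis
    unfolding expand
  proof (intro has_vector_derivative_sum has_vector_derivative_mult_right)
    fix \<sigma> assume "\<sigma> \<in> {\<sigma>. \<sigma> permutes {0..<n}}"
    then have i: "Suc (\<sigma> (k - 1)) \<le> n"
      using permutes_in_image[of \<sigma> "{0..<n}" "k - 1"] k by (auto simp: Suc_le_eq)
    have "((\<lambda>t. A m (x(k := t)) (Suc (\<sigma> (k - 1))) k) has_vector_derivative A (m(k := Suc (m k))) x (Suc (\<sigma> (k - 1))) k) (at (x k))"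
      using divdiff_power_exp_has_vector_derivative[OF encloses_mono[OF e i]] by (simp add: A_def)
    moreover have "(\<Prod>j\<in>{..<n} - {k - 1}. A m (x(k := t)) (Suc (\<sigma> j)) (Suc j)) = (\<Prod>j\<in>{..<n} - {k - 1}. A m x (Suc (\<sigma> j)) (Suc j))" for t
      by (intro prod.cong refl rest(1))
    moreover have "(\<Prod>j\<in>{..<n} - {k - 1}. A (m(k := Suc (m k))) x (Suc (\<sigma> j)) (Suc j)) = (\<Prod>j\<in>{..<n} - {k - 1}. A m x (Suc (\<sigma> j)) (Suc j))"
      by (intro prod.cong refl rest(2))
    ultimately show "((\<lambda>t. A m (x(k := t)) (Suc (\<sigma> (k - 1))) k * (\<Prod>j\<in>{..<n} - {k - 1}. A m (x(k := t)) (Suc (\<sigma> j)) (Suc j))) has_vector_derivative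
       A (m(k := Suc (m k))) x (Suc (\<sigma> (k - 1))) k * (\<Prod>j\<in>{..<n} - {k - 1}. A (m(k := Suc (m k))) x (Suc (\<sigma> j)) (Suc j))) (at (x k))"
      by (simp only: has_vector_derivative_mult_left)
  qed
qed

lemma exp_det_tendsto:
  assumes e: "encloses R \<nu> n"
  shows "(exp_det R \<nu> n m \<longlongrightarrow> exp_det R \<nu> n m x) (at x within S)"
proof -
  have coord: "((\<lambda>y. y k) \<longlongrightarrow> x k) (at x within S)" for k :: nat
  proof -
    have "continuous_on UNIV (\<lambda>y :: nat \<Rightarrow> real. y k)" by (rule continuous_on_product_coordinates)
    then show ?thesis by (auto simp: continuous_on_def intro: tendsto_within_subset)
  qed
  have dd: "((\<lambda>y. divdiff R \<nu> i (\<lambda>z. (\<i> * z) ^ m k * exp (\<i> * z * of_real (y k)))) \<longlongrightarrow>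
      divdiff R \<nu> i (\<lambda>z. (\<i> * z) ^ m k * exp (\<i> * z * of_real (x k)))) (at x within S)" if "i \<le> n" for i k
  proof (rule isCont_tendsto_compose[OF _ coord])
    show "isCont (\<lambda>t. divdiff R \<nu> i (\<lambda>z. (\<i> * z) ^ m k * exp (\<i> * z * of_real t))) (x k)"
      using divdiff_power_exp_has_vector_derivative[OF encloses_mono[OF e that]]
      by (rule has_vector_derivative_continuous)
  qed
  show ?thesis
    unfolding exp_det_def[abs_def] fdet_sum
  proof (intro tendsto_intros dd)
    fix \<sigma> j assume "\<sigma> \<in> {\<sigma>. \<sigma> permutes {0..<n}}" "j \<in> {..<n}"
    then show "Suc (\<sigma> j) \<le> n" using permutes_in_image[of \<sigma> "{0..<n}" j] by (auto simp: Suc_le_eq)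
  qed
qed

lemma open_chamber_coordinate:
  assumes x: "x \<in> open_chamber l" and k: "k \<in> {1..l + 1}"
  shows "eventually (\<lambda>t. x(k := t) \<in> open_chamber l) (nhds (x k))"
proof -
  have chain: "eventually (\<lambda>t. \<forall>j\<in>{1..l}. (x(k := t)) (j + 1) < (x(k := t)) j) (nhds (x k))"
  proof (intro eventually_ball_finite ballI finite_atLeastAtMost)
    fix j assume j: "j \<in> {1..l}"
    have "((\<lambda>t. (x(k := t)) i) \<longlongrightarrow> x i) (nhds (x k))" for i
      by (cases "i = k") (auto simp: filterlim_ident)
    then have "((\<lambda>t. (x(k := t)) j - (x(k := t)) (j + 1)) \<longlongrightarrow> x j - x (j + 1)) (nhds (x k))"
      by (intro tendsto_diff)
    moreover have "0 < x j - x (j + 1)" using x j by (auto simp: open_chamber_def)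
    ultimately have "eventually (\<lambda>t. 0 < (x(k := t)) j - (x(k := t)) (j + 1)) (nhds (x k))"
      by (rule order_tendstoD(1))
    then show "eventually (\<lambda>t. (x(k := t)) (j + 1) < (x(k := t)) j) (nhds (x k))"
      by eventually_elim simp
  qed
  have "x(k := t) \<in> {1..l + 1} \<rightarrow>\<^sub>E UNIV" for t
    using x k by (auto simp: open_chamber_def PiE_def extensional_def)
  then show ?thesis
    by (intro eventually_mono[OF chain]) (simp add: open_chamber_def)
qed

lemma open_chamber_subset: "open_chamber l \<subseteq> closed_chamber l"
  by (auto simp: open_chamber_def closed_chamber_def less_imp_le)

text \<open>
  Lowering the coordinate \<open>x\<^sub>k\<close> by \<open>s k\<close> moves \<open>x\<close> into the interior for every \<open>s > 0\<close>. Without this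
  the limits defining boundary values of derivatives would not be unique.
\<close>
lemma closed_chamber_limit_point:
  assumes x: "x \<in> closed_chamber l" "x \<notin> open_chamber l"
  shows "at x within open_chamber l \<noteq> bot"
proof -
  define g where "g = (\<lambda>s::real. \<lambda>k. if k \<in> {1..l + 1} then x k - s * real k else undefined)"
  have g0: "g 0 = x"
    using x(1) by (auto simp: g_def closed_chamber_def PiE_def extensional_def fun_eq_iff)
  have "continuous_on UNIV (\<lambda>s. g s k)" for k
    by (cases "k \<in> {1..l + 1}") (auto simp: g_def intro!: continuous_intros)
  then have cont: "continuous_on UNIV g" by (rule continuous_on_coordinatewise_then_product)
  have "g s \<in> open_chamber l" if "0 < s" for s
  proof -
    have "x (j + 1) - s * real (j + 1) < x j - s * real j" if "j \<in> {1..l}" for j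
    proof -
      have "x (j + 1) \<le> x j" using x(1) that by (auto simp: closed_chamber_def)
      then show ?thesis using \<open>0 < s\<close> by (simp add: algebra_simps)
    qed
    then show ?thesis by (auto simp: g_def open_chamber_def)
  qed
  moreover have "eventually (\<lambda>s::real. 0 < s) (at_right 0)" by (simp add: eventually_at_right_less)
  ultimately have "eventually (\<lambda>s. g s \<in> closure (open_chamber l)) (at_right 0)"
    using closure_subset by (auto elim!: eventually_mono)
  moreover have "(g \<longlongrightarrow> x) (at_right 0)"
    using cont g0 by (auto simp: continuous_on_def intro: tendsto_within_subset)
  ultimately have "x \<in> closure (open_chamber l)"
    using Lim_in_closed_set[of "closure (open_chamber l)" g "at_right 0" x] by simp
  then have "x islimpt open_chamber l" using x(2) by (auto simp: closure_def)
  then show ?thesis by (simp add: trivial_limit_within)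
qed

text \<open>
  The values of \<open>f\<close> on the open chamber determine its iterated derivatives there, because the chamber
  is open along each coordinate line.
\<close>
lemma iter_deriv_exp_det:
  assumes e: "encloses R \<nu> (l + 1)"
    and f: "\<And>x. x \<in> open_chamber l \<Longrightarrow> f x = K * exp_det R \<nu> (l + 1) (\<lambda>_. 0) x"
    and ks: "set ks \<subseteq> {1..l + 1}" and x: "x \<in> open_chamber l"
  shows "iter_deriv ks f x = K * exp_det R \<nu> (l + 1) (count_list ks) x \<and>
    (\<forall>k\<in>{1..l + 1}. ((\<lambda>t. iter_deriv ks f (x(k := t))) has_vector_derivative
        K * exp_det R \<nu> (l + 1) (count_list (k # ks)) x) (at (x k)))"
proof -
  have step: "((\<lambda>t. iter_deriv ks f (x(k := t))) has_vector_derivative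
        K * exp_det R \<nu> (l + 1) (count_list (k # ks)) x) (at (x k))"
    if x: "x \<in> open_chamber l" and k: "k \<in> {1..l + 1}"
      and val: "\<And>y. y \<in> open_chamber l \<Longrightarrow> iter_deriv ks f y = K * exp_det R \<nu> (l + 1) (count_list ks) y"
    for x k ks
  proof -
    have count: "count_list (k # ks) = (count_list ks)(k := Suc (count_list ks k))"
      by (auto simp: fun_eq_iff)
    have "((\<lambda>t. K * exp_det R \<nu> (l + 1) (count_list ks) (x(k := t))) has_vector_derivative
        K * exp_det R \<nu> (l + 1) (count_list (k # ks)) x) (at (x k))"
      unfolding count using exp_det_has_vector_derivative[OF e k, of "count_list ks" x]
      by (rule has_vector_derivative_mult_right)
    moreover have "eventually (\<lambda>t. iter_deriv ks f (x(k := t)) = K * exp_det R \<nu> (l + 1) (count_list ks) (x(k := t))) (nhds (x k))"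
      using open_chamber_coordinate[OF x k] by eventually_elim (rule val)
    ultimately show ?thesis by (subst has_vector_derivative_cong_ev) (auto simp: val x)
  qed
  have val: "x \<in> open_chamber l \<Longrightarrow> iter_deriv ks f x = K * exp_det R \<nu> (l + 1) (count_list ks) x" for x
    using ks
  proof (induction ks arbitrary: x)
    case Nil
    have "count_list [] = (\<lambda>_ :: nat. 0 :: nat)" by (simp add: fun_eq_iff)
    then show ?case using f[OF Nil(1)] by (simp only: iter_deriv_def foldr.simps id_apply)
  next
    case (Cons q ks)
    have "((\<lambda>t. iter_deriv ks f (x(q := t))) has_vector_derivative
        K * exp_det R \<nu> (l + 1) (count_list (q # ks)) x) (at (x q))"
      using Cons.prems by (intro step Cons.IH) auto
    from vector_derivative_at[OF this] show ?case
      by (simp only: iter_deriv_def partial_deriv_def foldr.simps o_apply)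
  qed
  from val[OF x] step[OF x _ val] show ?thesis by blast
qed

section \<open>The elementary Whittaker function\<close>

lemma admissible_imp_ascending:
  assumes "admissible_contour l eps"
  shows "ascending l (contour_im l eps)"
  unfolding ascending_def
proof (intro ballI)
  fix n i j assume n: "n \<in> {1..l}" and ij: "i \<in> {1..n}" "j \<in> {1..Suc n}"
  have "contour_im l eps n i \<le> Max (contour_im l eps n ` {1..n})" using ij by (intro Max_ge) auto
  also have "\<dots> < Min (contour_im l eps (n + 1) ` {1..n + 1})" using assms n by (simp add: admissible_contour_def)
  also have "\<dots> \<le> contour_im l eps (Suc n) j" using ij by (intro Min_le) auto
  finally show "contour_im l eps n i < contour_im l eps (Suc n) j" .
qed

lemma elementary_whittaker_eq_det:
  fixes lam :: "nat \<Rightarrow> real"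
  assumes "admissible_contour l eps"
  defines "\<nu> \<equiv> \<lambda>j. complex_of_real (lam j)"
  shows "\<exists>K. \<forall>x\<in>closed_chamber l. \<forall>R. encloses R \<nu> (l + 1) \<longrightarrow>
     elementary_whittaker l eps lam x = K * exp_det R \<nu> (l + 1) (\<lambda>_. 0) x"
proof -
  define c where "c = contour_im l eps"
  have \<gamma>: "gamma_var l eps lam t = pattern l c \<nu> t" for t
    by (auto simp: gamma_var_def pattern_def c_def \<nu>_def contour_im_def complex_of_real_def fun_eq_iff)
  obtain K where K: "\<And>x R. (\<forall>k\<in>{1..l}. x (Suc k) \<le> x k) \<Longrightarrow> encloses R \<nu> (Suc l) \<Longrightarrow>
     (\<integral>t. whittaker_integrand l (pattern l c \<nu> t) x \<partial>lborel_on (cells l))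
       = K * fdet (Suc l) (\<lambda>i k. divdiff R \<nu> i (\<lambda>z. exp (\<i> * z * of_real (x k))))"
    using whittaker_integral_formula[OF admissible_imp_ascending[OF assms(1)]]
    by (force simp: c_def contour_im_def \<nu>_def)
  define L where "L = \<i> powi (- int (l * (l + 1) div 2)) * (K * (\<Prod>n=1..l. \<Prod>j=1..n. 1 / (2 * complex_of_real pi * \<i>)))"
  show ?thesis
  proof (intro exI[of _ L] ballI allI impI)
    fix x R assume x: "x \<in> closed_chamber l" and e: "encloses R \<nu> (l + 1)"
    have "elementary_whittaker l eps lam x = \<i> powi (- int (l * (l + 1) div 2)) *
       ((\<integral>t. whittaker_integrand l (pattern l c \<nu> t) x \<partial>lborel_on (cells l)) * (\<Prod>n=1..l. \<Prod>j=1..n. 1 / (2 * complex_of_real pi * \<i>)))"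
      unfolding elementary_whittaker_def \<gamma> cells_def by (subst integral_mult_left_zero) (rule refl)
    also have "\<dots> = L * exp_det R \<nu> (l + 1) (\<lambda>_. 0) x"
      using K[of x R] x e by (simp add: L_def exp_det_def closed_chamber_def)
    finally show "elementary_whittaker l eps lam x = L * exp_det R \<nu> (l + 1) (\<lambda>_. 0) x" .
  qed
qed

lemma lookup_map_key_permutes:
  assumes "\<tau> permutes A"
  shows "Poly_Mapping.lookup (Poly_Mapping.map_key \<tau> p) k = Poly_Mapping.lookup p (\<tau> k)"
  using map_key.rep_eq[OF permutes_inj[OF assms], of p] by (simp add: o_def)

lemma symmetric_polynomial_sum:
  assumes P: "symmetric_polynomial n P" and \<tau>: "\<tau> permutes {1..n}"
  shows "(\<Sum>a\<in>Poly_Mapping.keys P. Poly_Mapping.lookup P a * (\<Prod>k=1..n. v (\<tau> k) ^ Poly_Mapping.lookup a k))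
     = (\<Sum>a\<in>Poly_Mapping.keys P. Poly_Mapping.lookup P a * (\<Prod>k=1..n. v k ^ Poly_Mapping.lookup a k))"
proof -
  let ?\<tau>' = "inv_into UNIV \<tau>"
  have \<tau>': "?\<tau>' permutes {1..n}" by (rule permutes_inv[OF \<tau>])
  have inv: "Poly_Mapping.lookup P (Poly_Mapping.map_key \<pi> a) = Poly_Mapping.lookup P a" if "\<pi> permutes {1..n}" for \<pi> a
    using P that by (simp add: symmetric_polynomial_def)
  have keys: "Poly_Mapping.map_key \<pi> a \<in> Poly_Mapping.keys P" if "\<pi> permutes {1..n}" "a \<in> Poly_Mapping.keys P" for \<pi> a
    using inv[OF that(1), of a] that(2) by (simp add: in_keys_iff)
  show ?thesis
  proof (rule sum.reindex_bij_witness[of _ "Poly_Mapping.map_key \<tau>" "Poly_Mapping.map_key ?\<tau>'"])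
    fix a assume a: "a \<in> Poly_Mapping.keys P"
    show "Poly_Mapping.map_key \<tau> (Poly_Mapping.map_key ?\<tau>' a) = a"
      by (rule poly_mapping_eqI) (simp add: lookup_map_key_permutes[OF \<tau>] lookup_map_key_permutes[OF \<tau>'] permutes_inverses[OF \<tau>])
    show "Poly_Mapping.map_key ?\<tau>' (Poly_Mapping.map_key \<tau> a) = a"
      by (rule poly_mapping_eqI) (simp add: lookup_map_key_permutes[OF \<tau>] lookup_map_key_permutes[OF \<tau>'] permutes_inverses[OF \<tau>])
    show "Poly_Mapping.map_key ?\<tau>' a \<in> Poly_Mapping.keys P" "Poly_Mapping.map_key \<tau> a \<in> Poly_Mapping.keys P"
      using keys \<tau> \<tau>' a by blast+
    have "(\<Prod>k=1..n. v (\<tau> k) ^ Poly_Mapping.lookup a k) = (\<Prod>k=1..n. v k ^ Poly_Mapping.lookup a (?\<tau>' k))"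
      using prod.permute[OF \<tau>, of "\<lambda>k. v k ^ Poly_Mapping.lookup a (?\<tau>' k)"]
      by (simp add: o_def permutes_inverses[OF \<tau>])
    then show "Poly_Mapping.lookup P (Poly_Mapping.map_key ?\<tau>' a) * (\<Prod>k=1..n. v k ^ Poly_Mapping.lookup (Poly_Mapping.map_key ?\<tau>' a) k)
       = Poly_Mapping.lookup P a * (\<Prod>k=1..n. v (\<tau> k) ^ Poly_Mapping.lookup a k)"
      by (simp add: inv[OF \<tau>'] lookup_map_key_permutes[OF \<tau>'])
  qed
qed

lemma count_list_concat_replicate:
  "count_list (concat (map (\<lambda>j. replicate (m j) j) js)) k = m k * count_list js k"
proof -
  have "count_list (replicate a j) k = (if j = k then a else 0)" for a j by (induction a) auto
  then show ?thesis by (induction js) auto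
qed

theorem proposition3p5:
  fixes l :: nat
    and lam :: "nat \<Rightarrow> real"
    and eps :: "nat \<Rightarrow> nat \<Rightarrow> real"
  assumes "l \<ge> 1"
    and "admissible_contour l eps"
  shows "smooth_up_to_boundary l (elementary_whittaker l eps lam) \<and>
    (\<forall>P. symmetric_polynomial (l + 1) P \<longrightarrow>
       (\<forall>x\<in>closed_chamber l.
          diff_operator l P (elementary_whittaker l eps lam) x =
          eval_polynomial (l + 1) P (\<lambda>j. \<i> * complex_of_real (lam j)) *
            elementary_whittaker l eps lam x)) \<and>
    (\<forall>j\<in>{1..l}. \<forall>x\<in>closed_chamber l.
       x j = x (j + 1) \<longrightarrow> elementary_whittaker l eps lam x = 0)"
proof (intro conjI allI impI ballI)
  define \<nu> where "\<nu> = (\<lambda>j. complex_of_real (lam j))"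
  define f where "f = elementary_whittaker l eps lam"
  obtain R where e: "encloses R \<nu> (l + 1)" using encloses_exists by blast
  obtain K where K: "\<And>x. x \<in> closed_chamber l \<Longrightarrow> f x = K * exp_det R \<nu> (l + 1) (\<lambda>_. 0) x"
    using elementary_whittaker_eq_det[OF assms(2), of lam] e unfolding \<nu>_def f_def by blast
  have fo: "f x = K * exp_det R \<nu> (l + 1) (\<lambda>_. 0) x" if "x \<in> open_chamber l" for x
    using K that open_chamber_subset by blast
  note deriv = iter_deriv_exp_det[OF e fo, THEN conjunct1] iter_deriv_exp_det[OF e fo, THEN conjunct2, rule_format]
  have lim: "(iter_deriv ks f \<longlongrightarrow> K * exp_det R \<nu> (l + 1) (count_list ks) x) (at x within open_chamber l)"
    if "set ks \<subseteq> {1..l + 1}" for ks x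
  proof (subst tendsto_cong)
    show "eventually (\<lambda>y. iter_deriv ks f y = K * exp_det R \<nu> (l + 1) (count_list ks) y) (at x within open_chamber l)"
      unfolding eventually_at_filter using deriv(1)[OF _ that] by simp
    show "((\<lambda>y. K * exp_det R \<nu> (l + 1) (count_list ks) y) \<longlongrightarrow> K * exp_det R \<nu> (l + 1) (count_list ks) x) (at x within open_chamber l)"
      by (intro tendsto_intros exp_det_tendsto[OF e])
  qed
  show "smooth_up_to_boundary l (elementary_whittaker l eps lam)"
    unfolding smooth_up_to_boundary_def f_def[symmetric]
    using lim deriv(2) differentiableI_vector by blast
  show "diff_operator l P (elementary_whittaker l eps lam) x =
      eval_polynomial (l + 1) P (\<lambda>j. \<i> * complex_of_real (lam j)) * elementary_whittaker l eps lam x"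
    if P: "symmetric_polynomial (l + 1) P" and x: "x \<in> closed_chamber l" for P x
  proof -
    have chamber: "chamber_deriv l ks f x = K * exp_det R \<nu> (l + 1) (count_list ks) x" if "set ks \<subseteq> {1..l + 1}" for ks
    proof (cases "x \<in> open_chamber l")
      case True
      then show ?thesis using deriv(1)[OF _ that] by (simp add: chamber_deriv_def)
    next
      case False
      then show ?thesis
        using tendsto_Lim[OF closed_chamber_limit_point[OF x False] lim[OF that]]
        by (simp add: chamber_deriv_def)
    qed
    have "diff_operator l P f x = (\<Sum>a\<in>Poly_Mapping.keys P. Poly_Mapping.lookup P a * (K * exp_det R \<nu> (l + 1) (Poly_Mapping.lookup a) x))"
      unfolding diff_operator_def
    proof (intro sum.cong refl arg_cong2[where f = "(*)"])
      fix a
      let ?ks = "concat (map (\<lambda>j. replicate (Poly_Mapping.lookup a j) j) [1..<l + 2])"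
      have "chamber_deriv l ?ks f x = K * exp_det R \<nu> (l + 1) (count_list ?ks) x"
        by (rule chamber) auto
      also have "exp_det R \<nu> (l + 1) (count_list ?ks) x = exp_det R \<nu> (l + 1) (Poly_Mapping.lookup a) x"
      proof (rule exp_det_cong)
        fix k assume "k \<in> {1..l + 1}"
        moreover have "count_list [1..<n] k = (if 1 \<le> k \<and> k < n then 1 else 0)" for n by (induction n) auto
        ultimately have "count_list [1..<l + 2] k = 1" by (simp del: upt_Suc)
        then show "count_list ?ks k = Poly_Mapping.lookup a k"
          unfolding count_list_concat_replicate by simp
      qed simp
      finally show "chamber_deriv l ?ks f x = K * exp_det R \<nu> (l + 1) (Poly_Mapping.lookup a) x" .
    qed
    also have "\<dots> = K * (\<Sum>a\<in>Poly_Mapping.keys P. Poly_Mapping.lookup P a * fdet (l + 1) (\<lambda>i k. divdiff R \<nu> i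
        (\<lambda>z. (\<i> * z) ^ Poly_Mapping.lookup a k * exp (\<i> * z * of_real (x k)))))"
      unfolding exp_det_def by (simp add: sum_distrib_left mult_ac)
    also have "(\<Sum>a\<in>Poly_Mapping.keys P. Poly_Mapping.lookup P a * fdet (l + 1) (\<lambda>i k. divdiff R \<nu> i
        (\<lambda>z. (\<i> * z) ^ Poly_Mapping.lookup a k * exp (\<i> * z * of_real (x k)))))
      = (\<Sum>a\<in>Poly_Mapping.keys P. Poly_Mapping.lookup P a * (\<Prod>k=1..l + 1. (\<i> * \<nu> k) ^ Poly_Mapping.lookup a k))
        * fdet (l + 1) (\<lambda>i k. divdiff R \<nu> i (\<lambda>z. exp (\<i> * z * of_real (x k))))"
      by (rule fdet_divdiff_symmetric[OF finite_keys e symmetric_polynomial_sum[OF P]])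
         (auto intro!: holomorphic_intros)
    also have "K * \<dots> = eval_polynomial (l + 1) P (\<lambda>j. \<i> * complex_of_real (lam j)) * f x"
      unfolding K[OF x] by (simp add: eval_polynomial_def \<nu>_def exp_det_def)
    finally show ?thesis by (simp add: f_def)
  qed
  show "elementary_whittaker l eps lam x = 0" if "j \<in> {1..l}" "x \<in> closed_chamber l" "x j = x (j + 1)" for j x
  proof -
    have "exp_det R \<nu> (l + 1) (\<lambda>_. 0) x = 0"
      unfolding exp_det_def by (rule fdet_equal_columns[of j _ "j + 1"]) (use that in auto)
    then show ?thesis using K[OF that(2)] by (simp add: f_def)
  qed
qed

end
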